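(* Let $(\mathcal{M},\otimes,\mathbf{1})$ be a cocomplete abelian monoidal category, and assume that the tensor product commutes with direct sums. Let $(A=\bigoplus_{n\in\mathbb{N}}A_n,m_A,u_A)$ be a graded algebra in $\mathcal{M}$ and let $T:=T_{A_0}(A_1)$ be the tensor algebra of the $A_0$-bimodule $A_1$. Then there is a unique algebra homomorphism $$\varphi:T_{A_0}(A_1)\to A$$ such that $\varphi\circ i_0^T=i_0^A$ and $\varphi\circ i_1^T=i_1^A$. Moreover $\varphi$ is a graded algebra homomorphism with $$\varphi_t=p_t^A\circ\overline{m}_A^{\,t-1}\circ(i_1^A)^{\otimes_{A_0}t}\quad\text{for every }t\in\mathbb{N},$$ and the following assertions are equivalent: (a) $A$ is a strongly $\mathbb{N}$-graded algebra. (a$'$) $m^A_{a,1}:A_a\otimes A_1\to A_{a+1}$ is an epimorphism for every $a\in\mathbb{N}$. (b) $\varphi_n$ is an epimorphism for every $n\in\mathbb{N}$. (c) $\varphi$ is an epimorphism. (d) $(A[n],\nu_n^A)=A[1]^n$ (as subobjects of $A$) for every $n\in\mathbb{N}$. (e) $(A[2],\nu_2^A)=A[1]^2$ (as subobjects of $A$).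
   Context: Monoidal categories: associativity constraints are suppressed. A monoidal category $\mathcal{M}$ is abelian monoidal if $\mathcal{M}$ is abelian and all functors $X\otimes(-)$ and $(-)\otimes X$ are additive and right exact. Algebras and (bi)modules in $\mathcal{M}$ are defined as usual. Graded objects: a graded object is $X=\bigoplus_{n\in\mathbb{N}}X_n$ with canonical injections $i_n=i_n^X:X_n\to X$ and projections $p_n=p_n^X:X\to X_n$. A morphism $f:X\to Y$ of graded objects is graded if there are $f_n:X_n\to Y_n$ with $f i_n^X=i_n^Y f_n$ for all $n$. Put $X[n]=\bigoplus_{i\ge n}X_i$, with canonical injection $\nu_n:X[n]\to X$. The tensor product is graded by $(X\otimes Y)_n=\bigoplus_{a+b=n}X_a\otimes Y_b$. Graded algebra: an algebra $(A,m,u)$ with $A=\bigoplus_n A_n$ a graded object and $m$ a graded morphism. $m_{a,b}:A_a\otimes A_b\to A_{a+b}$ denotes the induced component, so $m(i_a\otimes i_b)=i_{a+b}m_{a,b}$. Then $(A_0,m_{0,0},p_0u)$ is an algebra, $i_0$ is an algebra homomorphism, and each $A_n$ is an $A_0$-bimodule via $m_{0,n},m_{n,0}$. A graded algebra homomorphism is an algebra homomorphism which is graded. $A$ is strongly $\mathbb{N}$-graded if $m_{i,j}:A_i\otimes A_j\to A_{i+j}$ is an epimorphism for all $i,j\in\mathbb{N}$. Powers of an ideal: for an ideal $(I,i_I)$ of an algebra $A$, $I^n$ ($n\ge1$) is the image of the composite $I^{\otimes n}\xrightarrow{i_I^{\otimes n}}A^{\otimes n}\to A$ with the iterated multiplication,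 as a subobject of $A$; $I^0:=A$. For a graded algebra $A$, $A[1]$ is an ideal via $\nu_1$. Tensor algebra: for an algebra $D$, the tensor product $V\otimes_D W$ of a right and a left $D$-module is the coequalizer of $\mu_V\otimes W,\ V\otimes\mu_W:V\otimes D\otimes W\to V\otimes W$; $({}_D\mathcal{M}_D,\otimes_D,D)$ is a monoidal category. For a $D$-bimodule $M$, $T_D(M)=\bigoplus_{n\in\mathbb{N}}M^{\otimes_D n}$ with $M^{\otimes_D0}=D$; it is a graded algebra in $\mathcal{M}$ with $m_{p,q}:M^{\otimes_Dp}\otimes M^{\otimes_Dq}\to M^{\otimes_Dp}\otimes_DM^{\otimes_Dq}\cong M^{\otimes_D(p+q)}$ the canonical morphism and unit $i_0\circ u_D$. Iterated multiplication over $A_0$: $A$ is regarded as an algebra in $({}_{A_0}\mathcal{M}_{A_0},\otimes_{A_0},A_0)$ via $i_0^A$; $\overline m_A^{\,t-1}:A^{\otimes_{A_0}t}\to A$ is its iterated multiplication, with $\overline m_A^{\,0}=\mathrm{Id}_A$ and $\overline m_A^{\,-1}=i_0^A:A_0\to A$ (the unit), and $(i_1^A)^{\otimes_{A_0}0}=\mathrm{Id}_{A_0}$. *)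

theory Defs
  imports Main
begin

section \<open>Categories, colimits, cocompleteness\<close>

record ('o, 'm) cat =
  Obj :: "'o set"
  Arr :: "'m set"
  Dom :: "'m \<Rightarrow> 'o"
  Cod :: "'m \<Rightarrow> 'o"
  Ide :: "'o \<Rightarrow> 'm"
  Comp :: "'m \<Rightarrow> 'm \<Rightarrow> 'm"  (infixr "\<cdot>\<index>" 70)

definition Hom :: "('o, 'm, 'z) cat_scheme \<Rightarrow> 'o \<Rightarrow> 'o \<Rightarrow> 'm set"
  where "Hom C a b = {f \<in> Arr C. Dom C f = a \<and> Cod C f = b}"

locale category =
  fixes C :: "('o, 'm, 'z) cat_scheme" (structure)
  assumes Dom_Obj: "f \<in> Arr C \<Longrightarrow> Dom C f \<in> Obj C"
    and Cod_Obj: "f \<in> Arr C \<Longrightarrow> Cod C f \<in> Obj C"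
    and Ide_Hom: "a \<in> Obj C \<Longrightarrow> Ide C a \<in> Hom C a a"
    and Comp_Hom: "f \<in> Hom C a b \<Longrightarrow> g \<in> Hom C b c \<Longrightarrow> g \<cdot> f \<in> Hom C a c"
    and Comp_assoc: "f \<in> Hom C a b \<Longrightarrow> g \<in> Hom C b c \<Longrightarrow> h \<in> Hom C c d
      \<Longrightarrow> (h \<cdot> g) \<cdot> f = h \<cdot> (g \<cdot> f)"
    and Comp_Ide: "f \<in> Hom C a b \<Longrightarrow> f \<cdot> Ide C a = f"
    and Ide_Comp: "f \<in> Hom C a b \<Longrightarrow> Ide C b \<cdot> f = f"

definition is_functor ::
  "('i, 'k, 'y) cat_scheme \<Rightarrow> ('o, 'm, 'z) cat_scheme \<Rightarrow> ('i \<Rightarrow> 'o) \<Rightarrow> ('k \<Rightarrow> 'm) \<Rightarrow> bool"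
  where "is_functor J C Fo Fa \<longleftrightarrow>
    (\<forall>i\<in>Obj J. Fo i \<in> Obj C) \<and>
    (\<forall>k\<in>Arr J. Fa k \<in> Hom C (Fo (Dom J k)) (Fo (Cod J k))) \<and>
    (\<forall>i\<in>Obj J. Fa (Ide J i) = Ide C (Fo i)) \<and>
    (\<forall>k\<in>Arr J. \<forall>l\<in>Arr J. Dom J l = Cod J k \<longrightarrow> Fa (l \<cdot>\<^bsub>J\<^esub> k) = Fa l \<cdot>\<^bsub>C\<^esub> Fa k)"

definition is_cocone ::
  "('i, 'k, 'y) cat_scheme \<Rightarrow> ('o, 'm, 'z) cat_scheme \<Rightarrow> ('i \<Rightarrow> 'o) \<Rightarrow> ('k \<Rightarrow> 'm)
    \<Rightarrow> 'o \<Rightarrow> ('i \<Rightarrow> 'm) \<Rightarrow> bool"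
  where "is_cocone J C Fo Fa L c \<longleftrightarrow>
    L \<in> Obj C \<and> (\<forall>i\<in>Obj J. c i \<in> Hom C (Fo i) L) \<and>
    (\<forall>k\<in>Arr J. c (Cod J k) \<cdot>\<^bsub>C\<^esub> Fa k = c (Dom J k))"

definition is_colimit ::
  "('i, 'k, 'y) cat_scheme \<Rightarrow> ('o, 'm, 'z) cat_scheme \<Rightarrow> ('i \<Rightarrow> 'o) \<Rightarrow> ('k \<Rightarrow> 'm)
    \<Rightarrow> 'o \<Rightarrow> ('i \<Rightarrow> 'm) \<Rightarrow> bool"
  where "is_colimit J C Fo Fa L c \<longleftrightarrow>
    is_cocone J C Fo Fa L c \<and>
    (\<forall>L' c'. is_cocone J C Fo Fa L' c' \<longrightarrow>
      (\<exists>!h. h \<in> Hom C L L' \<and> (\<forall>i\<in>Obj J. h \<cdot>\<^bsub>C\<^esub> c i = c' i)))"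

text \<open>
  Smallness is relative to a type \<open>'s\<close>: a category is small if its objects and its arrows
  are taken from \<open>'s\<close>.  Quantifying over all diagrams whose size is that of \<open>C\<close> itself
  would only leave preorders (Freyd).
\<close>

definition cocomplete :: "'s itself \<Rightarrow> ('o, 'm, 'z) cat_scheme \<Rightarrow> bool"
  where "cocomplete (_ :: 's itself) C \<longleftrightarrow>
    (\<forall>(J :: ('s, 's) cat) Fo Fa. category J \<longrightarrow> is_functor J C Fo Fa \<longrightarrow>
      (\<exists>L c. is_colimit J C Fo Fa L c))"

context
  fixes C :: "('o, 'm, 'z) cat_scheme" (structure)
begin

definition is_mono :: "'m \<Rightarrow> bool"
  where "is_mono f \<longleftrightarrow> f \<in> Arr C \<and>
    (\<forall>g\<in>Arr C. \<forall>h\<in>Arr C. Dom C g = Dom C h \<longrightarrow> Cod C g = Dom C f \<longrightarrow> Cod C h = Dom C f \<longrightarrow>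
      f \<cdot> g = f \<cdot> h \<longrightarrow> g = h)"

definition is_epi :: "'m \<Rightarrow> bool"
  where "is_epi f \<longleftrightarrow> f \<in> Arr C \<and>
    (\<forall>g\<in>Arr C. \<forall>h\<in>Arr C. Cod C g = Cod C h \<longrightarrow> Dom C g = Cod C f \<longrightarrow> Dom C h = Cod C f \<longrightarrow>
      g \<cdot> f = h \<cdot> f \<longrightarrow> g = h)"

definition are_inverse :: "'m \<Rightarrow> 'm \<Rightarrow> bool"
  where "are_inverse f g \<longleftrightarrow> f \<in> Arr C \<and> g \<in> Hom C (Cod C f) (Dom C f) \<and>
    g \<cdot> f = Ide C (Dom C f) \<and> f \<cdot> g = Ide C (Cod C f)"

definition is_iso :: "'m \<Rightarrow> bool"
  where "is_iso f \<longleftrightarrow> (\<exists>g. are_inverse f g)"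

definition inverse_arr :: "'m \<Rightarrow> 'm"
  where "inverse_arr f = (THE g. are_inverse f g)"

text \<open>A subobject of \<open>X\<close> is represented by a monomorphism with codomain \<open>X\<close>.\<close>

definition same_subobject :: "'m \<Rightarrow> 'm \<Rightarrow> bool"
  where "same_subobject k l \<longleftrightarrow> is_mono k \<and> is_mono l \<and> Cod C k = Cod C l \<and>
    (\<exists>h \<in> Hom C (Dom C k) (Dom C l). is_iso h \<and> l \<cdot> h = k)"

definition is_coproduct :: "'i set \<Rightarrow> ('i \<Rightarrow> 'o) \<Rightarrow> 'o \<Rightarrow> ('i \<Rightarrow> 'm) \<Rightarrow> bool"
  where "is_coproduct I F P j \<longleftrightarrow>
    P \<in> Obj C \<and> (\<forall>k\<in>I. F k \<in> Obj C \<and> j k \<in> Hom C (F k) P) \<and>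
    (\<forall>Z\<in>Obj C. \<forall>g. (\<forall>k\<in>I. g k \<in> Hom C (F k) Z) \<longrightarrow>
      (\<exists>!h. h \<in> Hom C P Z \<and> (\<forall>k\<in>I. h \<cdot> j k = g k)))"

definition coprod :: "'i set \<Rightarrow> ('i \<Rightarrow> 'o) \<Rightarrow> 'o \<times> ('i \<Rightarrow> 'm)"
  where "coprod I F = (SOME (P, j). is_coproduct I F P j)"

definition coprod_obj :: "'i set \<Rightarrow> ('i \<Rightarrow> 'o) \<Rightarrow> 'o"
  where "coprod_obj I F = fst (coprod I F)"

definition coprod_inj :: "'i set \<Rightarrow> ('i \<Rightarrow> 'o) \<Rightarrow> 'i \<Rightarrow> 'm"
  where "coprod_inj I F = snd (coprod I F)"

text \<open>The morphism from the chosen coproduct to \<open>Z\<close> with components \<open>g\<close>.\<close>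

definition copair :: "'i set \<Rightarrow> ('i \<Rightarrow> 'o) \<Rightarrow> 'o \<Rightarrow> ('i \<Rightarrow> 'm) \<Rightarrow> 'm"
  where "copair I F Z g =
    (THE h. h \<in> Hom C (coprod_obj I F) Z \<and> (\<forall>k\<in>I. h \<cdot> coprod_inj I F k = g k))"

definition is_coequalizer :: "'m \<Rightarrow> 'm \<Rightarrow> 'm \<Rightarrow> bool"
  where "is_coequalizer f g q \<longleftrightarrow>
    f \<in> Arr C \<and> g \<in> Arr C \<and> q \<in> Arr C \<and> Dom C f = Dom C g \<and> Cod C f = Cod C g \<and>
    Dom C q = Cod C f \<and> q \<cdot> f = q \<cdot> g \<and>
    (\<forall>h\<in>Arr C. Dom C h = Cod C f \<longrightarrow> h \<cdot> f = h \<cdot> g \<longrightarrow>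
      (\<exists>!e. e \<in> Hom C (Cod C q) (Cod C h) \<and> e \<cdot> q = h))"

definition is_null :: "'o \<Rightarrow> bool"
  where "is_null N \<longleftrightarrow> N \<in> Obj C \<and>
    (\<forall>a\<in>Obj C. (\<exists>!f. f \<in> Hom C a N) \<and> (\<exists>!f. f \<in> Hom C N a))"

end


section \<open>Abelian categories\<close>

record ('o, 'm) addcat = "('o, 'm) cat" +
  Zer :: "'o \<Rightarrow> 'o \<Rightarrow> 'm"
  Add :: "'m \<Rightarrow> 'm \<Rightarrow> 'm"  (infixl "\<oplus>\<index>" 65)

context
  fixes C :: "('o, 'm, 'z) addcat_scheme" (structure)
begin

definition is_kernel :: "'m \<Rightarrow> 'm \<Rightarrow> bool"
  where "is_kernel f k \<longleftrightarrow> f \<in> Arr C \<and> k \<in> Arr C \<and> Cod C k = Dom C f \<and>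
    f \<cdot> k = Zer C (Dom C k) (Cod C f) \<and>
    (\<forall>g\<in>Arr C. Cod C g = Dom C f \<longrightarrow> f \<cdot> g = Zer C (Dom C g) (Cod C f) \<longrightarrow>
      (\<exists>!e. e \<in> Hom C (Dom C g) (Dom C k) \<and> k \<cdot> e = g))"

definition is_cokernel :: "'m \<Rightarrow> 'm \<Rightarrow> bool"
  where "is_cokernel f q \<longleftrightarrow> f \<in> Arr C \<and> q \<in> Arr C \<and> Dom C q = Cod C f \<and>
    q \<cdot> f = Zer C (Dom C f) (Cod C q) \<and>
    (\<forall>g\<in>Arr C. Dom C g = Cod C f \<longrightarrow> g \<cdot> f = Zer C (Dom C f) (Cod C g) \<longrightarrow>
      (\<exists>!e. e \<in> Hom C (Cod C q) (Cod C g) \<and> e \<cdot> q = g))"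

definition is_biproduct :: "'o \<Rightarrow> 'o \<Rightarrow> 'o \<Rightarrow> 'm \<Rightarrow> 'm \<Rightarrow> 'm \<Rightarrow> 'm \<Rightarrow> bool"
  where "is_biproduct a b c i\<^sub>1 i\<^sub>2 p\<^sub>1 p\<^sub>2 \<longleftrightarrow> c \<in> Obj C \<and>
    i\<^sub>1 \<in> Hom C a c \<and> i\<^sub>2 \<in> Hom C b c \<and> p\<^sub>1 \<in> Hom C c a \<and> p\<^sub>2 \<in> Hom C c b \<and>
    p\<^sub>1 \<cdot> i\<^sub>1 = Ide C a \<and> p\<^sub>2 \<cdot> i\<^sub>2 = Ide C b \<and> (i\<^sub>1 \<cdot> p\<^sub>1) \<oplus> (i\<^sub>2 \<cdot> p\<^sub>2) = Ide C c"

text \<open>The image of \<open>f\<close>, as a subobject of \<open>Cod C f\<close>: a kernel of a cokernel of \<open>f\<close>.\<close>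

definition is_image :: "'m \<Rightarrow> 'm \<Rightarrow> bool"
  where "is_image f k \<longleftrightarrow> (\<exists>q. is_cokernel f q \<and> is_kernel q k)"

definition additive_functor :: "('o \<Rightarrow> 'o) \<Rightarrow> ('m \<Rightarrow> 'm) \<Rightarrow> bool"
  where "additive_functor Fo Fa \<longleftrightarrow> is_functor C C Fo Fa \<and>
    (\<forall>a b. \<forall>f\<in>Hom C a b. \<forall>g\<in>Hom C a b. Fa (f \<oplus> g) = Fa f \<oplus> Fa g)"

text \<open>
  For an additive functor: exactness of \<open>X \<rightarrow> Y \<rightarrow> Z \<rightarrow> 0\<close>, that is, \<open>Y \<rightarrow> Z\<close> being a cokernel
  of \<open>X \<rightarrow> Y\<close>, is preserved.
\<close>

definition right_exact :: "('m \<Rightarrow> 'm) \<Rightarrow> bool"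
  where "right_exact Fa \<longleftrightarrow> (\<forall>f q. is_cokernel f q \<longrightarrow> is_cokernel (Fa f) (Fa q))"

end

locale preadditive_category = category C
  for C :: "('o, 'm, 'z) addcat_scheme" (structure) +
  assumes Zer_Hom: "a \<in> Obj C \<Longrightarrow> b \<in> Obj C \<Longrightarrow> Zer C a b \<in> Hom C a b"
    and Add_Hom: "f \<in> Hom C a b \<Longrightarrow> g \<in> Hom C a b \<Longrightarrow> f \<oplus> g \<in> Hom C a b"
    and Add_assoc: "f \<in> Hom C a b \<Longrightarrow> g \<in> Hom C a b \<Longrightarrow> h \<in> Hom C a b
      \<Longrightarrow> (f \<oplus> g) \<oplus> h = f \<oplus> (g \<oplus> h)"
    and Add_commute: "f \<in> Hom C a b \<Longrightarrow> g \<in> Hom C a b \<Longrightarrow> f \<oplus> g = g \<oplus> f"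
    and Zer_Add: "f \<in> Hom C a b \<Longrightarrow> Zer C a b \<oplus> f = f"
    and Add_inverse: "f \<in> Hom C a b \<Longrightarrow> \<exists>g \<in> Hom C a b. f \<oplus> g = Zer C a b"
    and Comp_Add: "f \<in> Hom C a b \<Longrightarrow> g \<in> Hom C a b \<Longrightarrow> h \<in> Hom C b c
      \<Longrightarrow> h \<cdot> (f \<oplus> g) = (h \<cdot> f) \<oplus> (h \<cdot> g)"
    and Add_Comp: "h \<in> Hom C a b \<Longrightarrow> f \<in> Hom C b c \<Longrightarrow> g \<in> Hom C b c
      \<Longrightarrow> (f \<oplus> g) \<cdot> h = (f \<cdot> h) \<oplus> (g \<cdot> h)"

locale abelian_category = preadditive_category C
  for C :: "('o, 'm, 'z) addcat_scheme" (structure) +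
  assumes null_exists: "\<exists>N. is_null C N"
    and biproduct_exists: "a \<in> Obj C \<Longrightarrow> b \<in> Obj C
      \<Longrightarrow> \<exists>c i\<^sub>1 i\<^sub>2 p\<^sub>1 p\<^sub>2. is_biproduct C a b c i\<^sub>1 i\<^sub>2 p\<^sub>1 p\<^sub>2"
    and kernel_exists: "f \<in> Arr C \<Longrightarrow> \<exists>k. is_kernel C f k"
    and cokernel_exists: "f \<in> Arr C \<Longrightarrow> \<exists>q. is_cokernel C f q"
    and mono_is_kernel: "is_mono C k \<Longrightarrow> \<exists>f. is_kernel C f k"
    and epi_is_cokernel: "is_epi C q \<Longrightarrow> \<exists>f. is_cokernel C f q"


section \<open>Monoidal categories\<close>

text \<open>
  The category is not assumed strict.  \<open>Assoc C X Y Z : (X \<otimes> Y) \<otimes> Z \<rightarrow> X \<otimes> (Y \<otimes> Z)\<close>,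
  \<open>LUni C X : \<one> \<otimes> X \<rightarrow> X\<close> and \<open>RUni C X : X \<otimes> \<one> \<rightarrow> X\<close> are the constraints.  On objects the
  tensor product is written \<open>\<odot>\<close>.
\<close>

record ('o, 'm) moncat = "('o, 'm) addcat" +
  TenO :: "'o \<Rightarrow> 'o \<Rightarrow> 'o"  (infixr "\<odot>\<index>" 75)
  TenA :: "'m \<Rightarrow> 'm \<Rightarrow> 'm"  (infixr "\<otimes>\<index>" 75)
  One :: 'o
  Assoc :: "'o \<Rightarrow> 'o \<Rightarrow> 'o \<Rightarrow> 'm"
  LUni :: "'o \<Rightarrow> 'm"
  RUni :: "'o \<Rightarrow> 'm"

locale monoidal_category = category C
  for C :: "('o, 'm, 'z) moncat_scheme" (structure) +
  assumes One_Obj: "One C \<in> Obj C"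
    and TenO_Obj: "X \<in> Obj C \<Longrightarrow> Y \<in> Obj C \<Longrightarrow> X \<odot> Y \<in> Obj C"
    and TenA_Hom: "f \<in> Hom C X X' \<Longrightarrow> g \<in> Hom C Y Y' \<Longrightarrow> f \<otimes> g \<in> Hom C (X \<odot> Y) (X' \<odot> Y')"
    and TenA_Ide: "X \<in> Obj C \<Longrightarrow> Y \<in> Obj C \<Longrightarrow> Ide C X \<otimes> Ide C Y = Ide C (X \<odot> Y)"
    and TenA_Comp: "f \<in> Hom C X X' \<Longrightarrow> f' \<in> Hom C X' X'' \<Longrightarrow> g \<in> Hom C Y Y' \<Longrightarrow> g' \<in> Hom C Y' Y''
      \<Longrightarrow> (f' \<cdot> f) \<otimes> (g' \<cdot> g) = (f' \<otimes> g') \<cdot> (f \<otimes> g)"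
    and Assoc_Hom: "X \<in> Obj C \<Longrightarrow> Y \<in> Obj C \<Longrightarrow> Z \<in> Obj C
      \<Longrightarrow> Assoc C X Y Z \<in> Hom C ((X \<odot> Y) \<odot> Z) (X \<odot> (Y \<odot> Z))"
    and Assoc_iso: "X \<in> Obj C \<Longrightarrow> Y \<in> Obj C \<Longrightarrow> Z \<in> Obj C \<Longrightarrow> is_iso C (Assoc C X Y Z)"
    and Assoc_natural: "f \<in> Hom C X X' \<Longrightarrow> g \<in> Hom C Y Y' \<Longrightarrow> h \<in> Hom C Z Z'
      \<Longrightarrow> Assoc C X' Y' Z' \<cdot> ((f \<otimes> g) \<otimes> h) = (f \<otimes> (g \<otimes> h)) \<cdot> Assoc C X Y Z"
    and LUni_Hom: "X \<in> Obj C \<Longrightarrow> LUni C X \<in> Hom C (One C \<odot> X) X"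
    and LUni_iso: "X \<in> Obj C \<Longrightarrow> is_iso C (LUni C X)"
    and LUni_natural: "f \<in> Hom C X X' \<Longrightarrow> LUni C X' \<cdot> (Ide C (One C) \<otimes> f) = f \<cdot> LUni C X"
    and RUni_Hom: "X \<in> Obj C \<Longrightarrow> RUni C X \<in> Hom C (X \<odot> One C) X"
    and RUni_iso: "X \<in> Obj C \<Longrightarrow> is_iso C (RUni C X)"
    and RUni_natural: "f \<in> Hom C X X' \<Longrightarrow> RUni C X' \<cdot> (f \<otimes> Ide C (One C)) = f \<cdot> RUni C X"
    and pentagon: "W \<in> Obj C \<Longrightarrow> X \<in> Obj C \<Longrightarrow> Y \<in> Obj C \<Longrightarrow> Z \<in> Obj C
      \<Longrightarrow> (Ide C W \<otimes> Assoc C X Y Z) \<cdot> Assoc C W (X \<odot> Y) Z \<cdot> (Assoc C W X Y \<otimes> Ide C Z)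
        = Assoc C W X (Y \<odot> Z) \<cdot> Assoc C (W \<odot> X) Y Z"
    and triangle: "X \<in> Obj C \<Longrightarrow> Y \<in> Obj C
      \<Longrightarrow> (Ide C X \<otimes> LUni C Y) \<cdot> Assoc C X (One C) Y = RUni C X \<otimes> Ide C Y"

locale abelian_monoidal_category = abelian_category C + monoidal_category C
  for C :: "('o, 'm, 'z) moncat_scheme" (structure) +
  assumes left_additive: "X \<in> Obj C
      \<Longrightarrow> additive_functor C (\<lambda>Y. X \<odot> Y) (\<lambda>f. Ide C X \<otimes> f)"
    and right_additive: "X \<in> Obj C
      \<Longrightarrow> additive_functor C (\<lambda>Y. Y \<odot> X) (\<lambda>f. f \<otimes> Ide C X)"
    and left_right_exact: "X \<in> Obj C \<Longrightarrow> right_exact C (\<lambda>f. Ide C X \<otimes> f)"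
    and right_right_exact: "X \<in> Obj C \<Longrightarrow> right_exact C (\<lambda>f. f \<otimes> Ide C X)"

definition tensor_commutes_with_direct_sums ::
  "'s itself \<Rightarrow> ('o, 'm, 'z) moncat_scheme \<Rightarrow> bool"
  where "tensor_commutes_with_direct_sums (_ :: 's itself) C \<longleftrightarrow>
    (\<forall>(I :: 's set) F P j. \<forall>X \<in> Obj C. is_coproduct C I F P j \<longrightarrow>
      is_coproduct C I (\<lambda>k. X \<odot>\<^bsub>C\<^esub> F k) (X \<odot>\<^bsub>C\<^esub> P) (\<lambda>k. Ide C X \<otimes>\<^bsub>C\<^esub> j k) \<and>
      is_coproduct C I (\<lambda>k. F k \<odot>\<^bsub>C\<^esub> X) (P \<odot>\<^bsub>C\<^esub> X) (\<lambda>k. j k \<otimes>\<^bsub>C\<^esub> Ide C X))"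


section \<open>Algebras, graded objects and graded algebras\<close>

record ('o, 'm) alg =
  aobj :: 'o
  amult :: 'm
  aunit :: 'm

record ('o, 'm) graded =
  gobj :: 'o
  gcomp :: "nat \<Rightarrow> 'o"
  ginj :: "nat \<Rightarrow> 'm"

record ('o, 'm) galg = "('o, 'm) graded" +
  gmult :: 'm
  gunit :: 'm

definition alg_of :: "('o, 'm, 'y) galg_scheme \<Rightarrow> ('o, 'm) alg"
  where "alg_of A = \<lparr>aobj = gobj A, amult = gmult A, aunit = gunit A\<rparr>"

context
  fixes C :: "('o, 'm, 'z) moncat_scheme" (structure)
begin

definition algebra :: "('o, 'm) alg \<Rightarrow> bool"
  where "algebra A \<longleftrightarrow> aobj A \<in> Obj C \<and>
    amult A \<in> Hom C (aobj A \<odot> aobj A) (aobj A) \<and> aunit A \<in> Hom C (One C) (aobj A) \<and>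
    amult A \<cdot> (amult A \<otimes> Ide C (aobj A))
      = amult A \<cdot> (Ide C (aobj A) \<otimes> amult A) \<cdot> Assoc C (aobj A) (aobj A) (aobj A) \<and>
    amult A \<cdot> (aunit A \<otimes> Ide C (aobj A)) = LUni C (aobj A) \<and>
    amult A \<cdot> (Ide C (aobj A) \<otimes> aunit A) = RUni C (aobj A)"

definition alg_hom :: "('o, 'm) alg \<Rightarrow> ('o, 'm) alg \<Rightarrow> 'm \<Rightarrow> bool"
  where "alg_hom A B f \<longleftrightarrow> algebra A \<and> algebra B \<and> f \<in> Hom C (aobj A) (aobj B) \<and>
    f \<cdot> amult A = amult B \<cdot> (f \<otimes> f) \<and> f \<cdot> aunit A = aunit B"

definition graded_object :: "('o, 'm, 'y) graded_scheme \<Rightarrow> bool"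
  where "graded_object X \<longleftrightarrow> is_coproduct C UNIV (gcomp X) (gobj X) (ginj X)"

definition gproj :: "('o, 'm, 'y) graded_scheme \<Rightarrow> nat \<Rightarrow> 'm"
  where "gproj X n = (THE p. p \<in> Hom C (gobj X) (gcomp X n) \<and>
    (\<forall>k. p \<cdot> ginj X k = (if k = n then Ide C (gcomp X n) else Zer C (gcomp X k) (gcomp X n))))"

definition graded_morphism ::
  "('o, 'm, 'x) graded_scheme \<Rightarrow> ('o, 'm, 'y) graded_scheme \<Rightarrow> 'm \<Rightarrow> bool"
  where "graded_morphism X Y f \<longleftrightarrow> f \<in> Hom C (gobj X) (gobj Y) \<and>
    (\<exists>fn. \<forall>n. fn n \<in> Hom C (gcomp X n) (gcomp Y n) \<and> f \<cdot> ginj X n = ginj Y n \<cdot> fn n)"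

definition gmor_comp ::
  "('o, 'm, 'x) graded_scheme \<Rightarrow> ('o, 'm, 'y) graded_scheme \<Rightarrow> 'm \<Rightarrow> nat \<Rightarrow> 'm"
  where "gmor_comp X Y f n =
    (THE h. h \<in> Hom C (gcomp X n) (gcomp Y n) \<and> f \<cdot> ginj X n = ginj Y n \<cdot> h)"

text \<open>The canonical injection \<open>\<nu>\<^sub>n : X[n] \<rightarrow> X\<close>, where \<open>X[n] = \<Oplus>\<^bsub>i \<ge> n\<^esub> X\<^sub>i\<close> is its domain.\<close>

definition tail_inj :: "('o, 'm, 'y) graded_scheme \<Rightarrow> nat \<Rightarrow> 'm"
  where "tail_inj X n = copair C {n..} (gcomp X) (gobj X) (ginj X)"

definition graded_tensor ::
  "('o, 'm, 'x) graded_scheme \<Rightarrow> ('o, 'm, 'y) graded_scheme \<Rightarrow> ('o, 'm) graded"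
  where "graded_tensor X Y =
    \<lparr>gobj = gobj X \<odot> gobj Y,
     gcomp = (\<lambda>n. coprod_obj C {(a, b). a + b = n} (\<lambda>(a, b). gcomp X a \<odot> gcomp Y b)),
     ginj = (\<lambda>n. copair C {(a, b). a + b = n} (\<lambda>(a, b). gcomp X a \<odot> gcomp Y b)
       (gobj X \<odot> gobj Y) (\<lambda>(a, b). ginj X a \<otimes> ginj Y b))\<rparr>"

definition graded_algebra :: "('o, 'm, 'y) galg_scheme \<Rightarrow> bool"
  where "graded_algebra A \<longleftrightarrow> algebra (alg_of A) \<and> graded_object A \<and>
    graded_morphism (graded_tensor A A) A (gmult A)"

definition graded_alg_hom ::
  "('o, 'm, 'x) galg_scheme \<Rightarrow> ('o, 'm, 'y) galg_scheme \<Rightarrow> 'm \<Rightarrow> bool"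
  where "graded_alg_hom A B f \<longleftrightarrow> graded_algebra A \<and> graded_algebra B \<and>
    alg_hom (alg_of A) (alg_of B) f \<and> graded_morphism A B f"

text \<open>\<open>m\<^bsub>a,b\<^esub> : A\<^sub>a \<otimes> A\<^sub>b \<rightarrow> A\<^bsub>a+b\<^esub>\<close>\<close>

definition mult_comp :: "('o, 'm, 'y) galg_scheme \<Rightarrow> nat \<Rightarrow> nat \<Rightarrow> 'm"
  where "mult_comp A a b =
    (THE h. h \<in> Hom C (gcomp A a \<odot> gcomp A b) (gcomp A (a + b)) \<and>
      gmult A \<cdot> (ginj A a \<otimes> ginj A b) = ginj A (a + b) \<cdot> h)"

definition strongly_graded :: "('o, 'm, 'y) galg_scheme \<Rightarrow> bool"
  where "strongly_graded A \<longleftrightarrow> (\<forall>i j. is_epi C (mult_comp A i j))"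

definition deg_zero_alg :: "('o, 'm, 'y) galg_scheme \<Rightarrow> ('o, 'm) alg"
  where "deg_zero_alg A =
    \<lparr>aobj = gcomp A 0, amult = mult_comp A 0 0, aunit = gproj A 0 \<cdot> gunit A\<rparr>"


section \<open>Powers of an ideal\<close>

text \<open>Powers are bracketed to the left: \<open>X\<^sup>\<otimes>\<^sup>(\<^sup>n\<^sup>+\<^sup>1\<^sup>) = X\<^sup>\<otimes>\<^sup>n \<otimes> X\<close> for \<open>n \<ge> 1\<close>, and \<open>X\<^sup>\<otimes>\<^sup>1 = X\<close>.\<close>

fun arr_pow :: "'m \<Rightarrow> nat \<Rightarrow> 'm"
  where
    "arr_pow f 0 = Ide C (One C)"
  | "arr_pow f (Suc 0) = f"
  | "arr_pow f (Suc (Suc n)) = arr_pow f (Suc n) \<otimes> f"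

fun mult_pow :: "('o, 'm) alg \<Rightarrow> nat \<Rightarrow> 'm"
  where
    "mult_pow A 0 = aunit A"
  | "mult_pow A (Suc 0) = Ide C (aobj A)"
  | "mult_pow A (Suc (Suc n)) = amult A \<cdot> (mult_pow A (Suc n) \<otimes> Ide C (aobj A))"

text \<open>The ideal is given by its inclusion \<open>i\<close> into \<open>A\<close>, and so is the power.\<close>

definition ideal_power :: "('o, 'm) alg \<Rightarrow> 'm \<Rightarrow> nat \<Rightarrow> 'm"
  where "ideal_power A i n =
    (if n = 0 then Ide C (aobj A) else (SOME k. is_image C (mult_pow A n \<cdot> arr_pow i n) k))"


end


section \<open>Tensor products over an algebra\<close>

text \<open>
  The data of a bimodule over an algebra \<open>D\<close>: \<open>lact : D \<otimes> V \<rightarrow> V\<close> and \<open>ract : V \<otimes> D \<rightarrow> V\<close>.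
\<close>

record ('o, 'm) bimod =
  bobj :: 'o
  lact :: 'm
  ract :: 'm

context
  fixes C :: "('o, 'm, 'z) moncat_scheme" (structure)
begin

definition regular_bimod :: "('o, 'm) alg \<Rightarrow> ('o, 'm) bimod"
  where "regular_bimod D = \<lparr>bobj = aobj D, lact = amult D, ract = amult D\<rparr>"

text \<open>The canonical epimorphism \<open>V \<otimes> W \<rightarrow> V \<otimes>\<^sub>D W\<close>.\<close>

definition bal_proj :: "('o, 'm) alg \<Rightarrow> ('o, 'm) bimod \<Rightarrow> ('o, 'm) bimod \<Rightarrow> 'm"
  where "bal_proj D V W =
    (SOME q. is_coequalizer C (ract V \<otimes> Ide C (bobj W))
      ((Ide C (bobj V) \<otimes> lact W) \<cdot> Assoc C (bobj V) (aobj D) (bobj W)) q)"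

text \<open>\<open>V \<otimes>\<^sub>D W\<close> with the actions induced by the left action on \<open>V\<close> and the right one on \<open>W\<close>.\<close>

definition bal_tensor ::
  "('o, 'm) alg \<Rightarrow> ('o, 'm) bimod \<Rightarrow> ('o, 'm) bimod \<Rightarrow> ('o, 'm) bimod"
  where "bal_tensor D V W =
    (let q = bal_proj D V W; Q = Cod C q in
     \<lparr>bobj = Q,
      lact = (THE l. l \<in> Hom C (aobj D \<odot> Q) Q \<and>
        l \<cdot> (Ide C (aobj D) \<otimes> q) =
        q \<cdot> (lact V \<otimes> Ide C (bobj W)) \<cdot> inverse_arr C (Assoc C (aobj D) (bobj V) (bobj W))),
      ract = (THE r. r \<in> Hom C (Q \<odot> aobj D) Q \<and>
        r \<cdot> (q \<otimes> Ide C (aobj D)) =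
        q \<cdot> (Ide C (bobj V) \<otimes> ract W) \<cdot> Assoc C (bobj V) (bobj W) (aobj D))\<rparr>)"

text \<open>\<open>f \<otimes>\<^sub>D g : V \<otimes>\<^sub>D W \<rightarrow> V' \<otimes>\<^sub>D W'\<close>\<close>

definition bal_tensor_arr ::
  "('o, 'm) alg \<Rightarrow> ('o, 'm) bimod \<Rightarrow> ('o, 'm) bimod \<Rightarrow> ('o, 'm) bimod \<Rightarrow> ('o, 'm) bimod
    \<Rightarrow> 'm \<Rightarrow> 'm \<Rightarrow> 'm"
  where "bal_tensor_arr D V W V' W' f g =
    (THE h. h \<in> Hom C (bobj (bal_tensor D V W)) (bobj (bal_tensor D V' W')) \<and>
      h \<cdot> bal_proj D V W = bal_proj D V' W' \<cdot> (f \<otimes> g))"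

text \<open>The canonical isomorphism \<open>U \<otimes>\<^sub>D (V \<otimes>\<^sub>D W) \<rightarrow> (U \<otimes>\<^sub>D V) \<otimes>\<^sub>D W\<close>.\<close>

definition bal_reassoc ::
  "('o, 'm) alg \<Rightarrow> ('o, 'm) bimod \<Rightarrow> ('o, 'm) bimod \<Rightarrow> ('o, 'm) bimod \<Rightarrow> 'm"
  where "bal_reassoc D U V W =
    (THE h. h \<in> Hom C (bobj (bal_tensor D U (bal_tensor D V W)))
                      (bobj (bal_tensor D (bal_tensor D U V) W)) \<and>
      h \<cdot> bal_proj D U (bal_tensor D V W) \<cdot> (Ide C (bobj U) \<otimes> bal_proj D V W) =
      bal_proj D (bal_tensor D U V) W \<cdot> (bal_proj D U V \<otimes> Ide C (bobj W))
        \<cdot> inverse_arr C (Assoc C (bobj U) (bobj V) (bobj W)))"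

text \<open>The unit constraints \<open>D \<otimes>\<^sub>D V \<rightarrow> V\<close> and \<open>V \<otimes>\<^sub>D D \<rightarrow> V\<close>.\<close>

definition bal_luni :: "('o, 'm) alg \<Rightarrow> ('o, 'm) bimod \<Rightarrow> 'm"
  where "bal_luni D V =
    (THE h. h \<in> Hom C (bobj (bal_tensor D (regular_bimod D) V)) (bobj V) \<and>
      h \<cdot> bal_proj D (regular_bimod D) V = lact V)"

definition bal_runi :: "('o, 'm) alg \<Rightarrow> ('o, 'm) bimod \<Rightarrow> 'm"
  where "bal_runi D V =
    (THE h. h \<in> Hom C (bobj (bal_tensor D V (regular_bimod D))) (bobj V) \<and>
      h \<cdot> bal_proj D V (regular_bimod D) = ract V)"

fun bal_pow :: "('o, 'm) alg \<Rightarrow> ('o, 'm) bimod \<Rightarrow> nat \<Rightarrow> ('o, 'm) bimod"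
  where
    "bal_pow D M 0 = regular_bimod D"
  | "bal_pow D M (Suc 0) = M"
  | "bal_pow D M (Suc (Suc n)) = bal_tensor D (bal_pow D M (Suc n)) M"

fun bal_arr_pow ::
  "('o, 'm) alg \<Rightarrow> ('o, 'm) bimod \<Rightarrow> ('o, 'm) bimod \<Rightarrow> 'm \<Rightarrow> nat \<Rightarrow> 'm"
  where
    "bal_arr_pow D M N f 0 = Ide C (aobj D)"
  | "bal_arr_pow D M N f (Suc 0) = f"
  | "bal_arr_pow D M N f (Suc (Suc n)) =
      bal_tensor_arr D (bal_pow D M (Suc n)) M (bal_pow D N (Suc n)) N
        (bal_arr_pow D M N f (Suc n)) f"


section \<open>The tensor algebra\<close>

text \<open>
  The canonical isomorphism \<open>M\<^sup>p \<otimes>\<^sub>D M\<^sup>q \<rightarrow> M\<^sup>p\<^sup>+\<^sup>q\<close> (powers over \<open>D\<close>), obtained from the unit and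
  associativity constraints of \<open>\<otimes>\<^sub>D\<close>.
\<close>

fun bal_pow_add :: "('o, 'm) alg \<Rightarrow> ('o, 'm) bimod \<Rightarrow> nat \<Rightarrow> nat \<Rightarrow> 'm"
  where
    "bal_pow_add D M p 0 = bal_runi D (bal_pow D M p)"
  | "bal_pow_add D M 0 (Suc q) = bal_luni D (bal_pow D M (Suc q))"
  | "bal_pow_add D M (Suc p) (Suc 0) = Ide C (bobj (bal_pow D M (Suc (Suc p))))"
  | "bal_pow_add D M (Suc p) (Suc (Suc q)) =
      bal_tensor_arr D (bal_tensor D (bal_pow D M (Suc p)) (bal_pow D M (Suc q))) M
        (bal_pow D M (Suc p + Suc q)) M (bal_pow_add D M (Suc p) (Suc q)) (Ide C (bobj M))
      \<cdot> bal_reassoc D (bal_pow D M (Suc p)) (bal_pow D M (Suc q)) M"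

definition tensor_mult_comp :: "('o, 'm) alg \<Rightarrow> ('o, 'm) bimod \<Rightarrow> nat \<Rightarrow> nat \<Rightarrow> 'm"
  where "tensor_mult_comp D M p q =
    bal_pow_add D M p q \<cdot> bal_proj D (bal_pow D M p) (bal_pow D M q)"

definition tensor_algebra :: "('o, 'm) alg \<Rightarrow> ('o, 'm) bimod \<Rightarrow> ('o, 'm) galg"
  where "tensor_algebra D M =
    (let X = (\<lambda>n. bobj (bal_pow D M n));
         T = coprod_obj C (UNIV :: nat set) X;
         i = coprod_inj C (UNIV :: nat set) X in
     \<lparr>gobj = T, gcomp = X, ginj = i,
      gmult = (THE m. m \<in> Hom C (T \<odot> T) T \<and>
        (\<forall>p q. m \<cdot> (i p \<otimes> i q) = i (p + q) \<cdot> tensor_mult_comp D M p q)),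
      gunit = i 0 \<cdot> aunit D\<rparr>)"


section \<open>A graded algebra over its degree zero part\<close>

definition deg_one_bimod :: "('o, 'm, 'y) galg_scheme \<Rightarrow> ('o, 'm) bimod"
  where "deg_one_bimod A = \<lparr>bobj = gcomp A 1, lact = mult_comp C A 0 1, ract = mult_comp C A 1 0\<rparr>"

definition bimod_via_deg_zero :: "('o, 'm, 'y) galg_scheme \<Rightarrow> ('o, 'm) bimod"
  where "bimod_via_deg_zero A =
    \<lparr>bobj = gobj A,
     lact = gmult A \<cdot> (ginj A 0 \<otimes> Ide C (gobj A)),
     ract = gmult A \<cdot> (Ide C (gobj A) \<otimes> ginj A 0)\<rparr>"

text \<open>The multiplication \<open>A \<otimes>\<^bsub>A\<^sub>0\<^esub> A \<rightarrow> A\<close>.\<close>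

definition bal_mult :: "('o, 'm, 'y) galg_scheme \<Rightarrow> 'm"
  where "bal_mult A =
    (let D = deg_zero_alg C A; B = bimod_via_deg_zero A in
     THE h. h \<in> Hom C (bobj (bal_tensor D B B)) (gobj A) \<and> h \<cdot> bal_proj D B B = gmult A)"

text \<open>
  \<open>bal_mult_pow A t\<close> is the multiplication of \<open>t\<close> factors, so it carries the superscript \<open>t - 1\<close>
  in the usual notation for iterated multiplications.
\<close>

fun bal_mult_pow :: "('o, 'm, 'y) galg_scheme \<Rightarrow> nat \<Rightarrow> 'm"
  where
    "bal_mult_pow A 0 = ginj A 0"
  | "bal_mult_pow A (Suc 0) = Ide C (gobj A)"
  | "bal_mult_pow A (Suc (Suc t)) =
      (let D = deg_zero_alg C A; B = bimod_via_deg_zero A in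
       bal_mult A \<cdot> bal_tensor_arr D (bal_pow D B (Suc t)) B B B
         (bal_mult_pow A (Suc t)) (Ide C (gobj A)))"

end

end

theory Submission
  imports Defs
begin

text \<open>
  All coherence arguments are reduced to the pentagon: if four of the five ways of rebracketing a product
  of four factors are associative, so is the fifth, up to an epimorphism.  Applied to the canonical
  epimorphisms \<open>V \<otimes> W \<rightarrow> V \<otimes>\<^sub>D W\<close> this gives the bimodule structure on \<open>V \<otimes>\<^sub>D W\<close>, the associativity of
  \<open>\<otimes>\<^sub>D\<close> and that of the tensor algebra.

  As \<open>T\<^sub>n \<otimes> A\<^sub>1 \<rightarrow> T\<^sub>n\<^sub>+\<^sub>1\<close> is epi, a homomorphism on \<open>T\<close> is determined in degrees \<open>0\<close> and \<open>1\<close>.  The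
  square \<open>\<phi>\<^sub>p\<^sub>+\<^sub>q m\<^sup>T\<^bsub>p,q\<^esub> = m\<^sup>A\<^bsub>p,q\<^esub> (\<phi>\<^sub>p \<otimes> \<phi>\<^sub>q)\<close> with \<open>m\<^sup>T\<^bsub>p,q\<^esub>\<close> epi relates (a), (a') and (b).  For the powers of
  \<open>A[1]\<close>, the product \<open>A[n] \<otimes> A[1] \<rightarrow> A\<close> factors through \<open>A[n+1]\<close>, by an epimorphism if (a') holds.
\<close>


text \<open>Nothing about \<open>\<otimes>\<^sub>D\<close> is given in advance: its actions, its
  associator and the identification of M^p \<otimes> M^q over D with M^(p+q) are definite
  descriptions out of chosen coequalizers, and each must be shown to denote. Right exactness
  supplies this. Tensoring preserves coequalizers, so arrows descend to the balanced product, and it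
  preserves epimorphisms, so equalities can be tested before descending. Powers are bracketed to the
  left, so multiplication by A_1 on the right needs no rebracketing. Inductions therefore peel off
  the last factor, and right linearity is the property that has to be carried along. The components
  of \<phi> are first studied without the projection, as arrows into all of A. That they are
  homogeneous follows afterwards by cancelling the same epimorphisms. For (e) implies (a'), the
  image A[1]^2 is used through a zero test: for n at least 2, an arrow out of A_n that kills the
  degree n part of all products of elements of positive degree kills A[1]^2 = A[2], hence A_n
  itself.\<close>

lemma ex1_eq: "\<exists>!x. P x \<Longrightarrow> P a \<Longrightarrow> P b \<Longrightarrow> a = b"
  by blast

section \<open>Epimorphisms, monomorphisms, isomorphisms and subobjects\<close>

context category
begin

lemma HomD:
  assumes "f \<in> Hom C a b"
  shows "f \<in> Arr C" "Dom C f = a" "Cod C f = b" "a \<in> Obj C" "b \<in> Obj C"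
  using assms Dom_Obj Cod_Obj by (auto simp: Hom_def)

lemma Hom_iff: "f \<in> Hom C a b \<longleftrightarrow> f \<in> Arr C \<and> Dom C f = a \<and> Cod C f = b"
  by (simp add: Hom_def)

lemma Ide_arr [simp]:
  assumes "a \<in> Obj C"
  shows "Ide C a \<in> Arr C" "Dom C (Ide C a) = a" "Cod C (Ide C a) = a"
  using HomD[OF Ide_Hom[OF assms]] by auto

lemma Dom_Cod_Obj [simp]: "f \<in> Arr C \<Longrightarrow> Dom C f \<in> Obj C" "f \<in> Arr C \<Longrightarrow> Cod C f \<in> Obj C"
  using Dom_Obj Cod_Obj by auto

lemma Comp_arr [simp]:
  assumes "f \<in> Arr C" "g \<in> Arr C" "Dom C g = Cod C f"
  shows "g \<cdot> f \<in> Arr C" "Dom C (g \<cdot> f) = Dom C f" "Cod C (g \<cdot> f) = Cod C g"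
  using HomD[OF Comp_Hom[of f "Dom C f" "Cod C f" g "Cod C g"]] assms by (auto simp: Hom_def)

lemma Comp_assoc' [simp]:
  "f \<in> Arr C \<Longrightarrow> g \<in> Arr C \<Longrightarrow> h \<in> Arr C \<Longrightarrow> Dom C g = Cod C f \<Longrightarrow> Dom C h = Cod C g
    \<Longrightarrow> (h \<cdot> g) \<cdot> f = h \<cdot> (g \<cdot> f)"
  by (rule Comp_assoc) (auto simp: Hom_def)

lemma Comp_Ide' [simp]: "f \<in> Arr C \<Longrightarrow> Dom C f = a \<Longrightarrow> f \<cdot> Ide C a = f"
  by (rule Comp_Ide) (auto simp: Hom_def)

lemma Ide_Comp' [simp]: "f \<in> Arr C \<Longrightarrow> Cod C f = a \<Longrightarrow> Ide C a \<cdot> f = f"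
  by (rule Ide_Comp) (auto simp: Hom_def)

lemma epi_arr: "is_epi C e \<Longrightarrow> e \<in> Arr C"
  by (simp add: is_epi_def)

lemma epi_cancel:
  assumes "is_epi C e" "f \<cdot> e = g \<cdot> e" "f \<in> Arr C" "g \<in> Arr C" "Dom C f = Cod C e" "Dom C g = Cod C e"
  shows "f = g"
proof -
  \<comment> \<open>\<open>is_epi\<close> only tests pairs with a common codomain; here it is read
    off from \<open>f \<cdot> e = g \<cdot> e\<close>.\<close>
  have "Cod C f = Cod C g"
    using assms Comp_arr(3)[of e f] Comp_arr(3)[of e g] epi_arr by auto
  then show ?thesis using assms unfolding is_epi_def by blast
qed

lemma mono_cancel:
  assumes "is_mono C e" "e \<cdot> f = e \<cdot> g" "f \<in> Arr C" "g \<in> Arr C" "Cod C f = Dom C e" "Cod C g = Dom C e"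
  shows "f = g"
proof -
  have "e \<in> Arr C" using assms by (simp add: is_mono_def)
  then have "Dom C f = Dom C g"
    using assms Comp_arr(2)[of f e] Comp_arr(2)[of g e] by auto
  then show ?thesis using assms unfolding is_mono_def by blast
qed

lemma epiI:
  assumes "e \<in> Arr C"
    "\<And>f g. f \<in> Arr C \<Longrightarrow> g \<in> Arr C \<Longrightarrow> Dom C f = Cod C e \<Longrightarrow> Dom C g = Cod C e \<Longrightarrow> Cod C f = Cod C g
      \<Longrightarrow> f \<cdot> e = g \<cdot> e \<Longrightarrow> f = g"
  shows "is_epi C e"
  using assms unfolding is_epi_def by metis

lemma monoI:
  assumes "e \<in> Arr C"
    "\<And>f g. f \<in> Arr C \<Longrightarrow> g \<in> Arr C \<Longrightarrow> Cod C f = Dom C e \<Longrightarrow> Cod C g = Dom C e \<Longrightarrow> Dom C f = Dom C g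
      \<Longrightarrow> e \<cdot> f = e \<cdot> g \<Longrightarrow> f = g"
  shows "is_mono C e"
  using assms unfolding is_mono_def by metis

lemma epi_comp:
  assumes e: "is_epi C e" and e': "is_epi C e'" and c: "Dom C e' = Cod C e"
  shows "is_epi C (e' \<cdot> e)"
proof (rule epiI)
  note [simp] = epi_arr[OF e] epi_arr[OF e'] c
  show "e' \<cdot> e \<in> Arr C" by simp
  fix f g
  assume fg [simp]: "f \<in> Arr C" "g \<in> Arr C" "Dom C f = Cod C (e' \<cdot> e)" "Dom C g = Cod C (e' \<cdot> e)"
    and eq: "f \<cdot> e' \<cdot> e = g \<cdot> e' \<cdot> e"
  have "f \<cdot> e' = g \<cdot> e'"
    by (rule epi_cancel[OF e]) (use fg eq in simp_all)
  then show "f = g"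
    by (rule epi_cancel[OF e']) (use fg in simp_all)
qed

lemma epi_of_comp:
  assumes e: "is_epi C (e' \<cdot> e)" and [simp]: "e \<in> Arr C" "e' \<in> Arr C" "Dom C e' = Cod C e"
  shows "is_epi C e'"
proof (rule epiI)
  show "e' \<in> Arr C" by simp
  fix f g
  assume fg [simp]: "f \<in> Arr C" "g \<in> Arr C" "Dom C f = Cod C e'" "Dom C g = Cod C e'"
    and eq: "f \<cdot> e' = g \<cdot> e'"
  have "f \<cdot> e' \<cdot> e = (f \<cdot> e') \<cdot> e" by simp
  also have "\<dots> = g \<cdot> e' \<cdot> e" unfolding eq by simp
  finally show "f = g"
    by (rule epi_cancel[OF e]) (use fg in simp_all)
qed

lemma split_epi:
  assumes [simp]: "e \<in> Arr C" "s \<in> Arr C" "Dom C e = Cod C s" and es: "e \<cdot> s = Ide C (Cod C e)"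
  shows "is_epi C e"
proof (rule epiI)
  show "e \<in> Arr C" by simp
  fix f g
  assume fg [simp]: "f \<in> Arr C" "g \<in> Arr C" "Dom C f = Cod C e" "Dom C g = Cod C e"
    and eq: "f \<cdot> e = g \<cdot> e"
  have "f = (f \<cdot> e) \<cdot> s" by (simp add: es)
  also have "\<dots> = g" unfolding eq by (simp add: es)
  finally show "f = g" .
qed

lemma split_mono:
  assumes [simp]: "e \<in> Arr C" "s \<in> Arr C" "Dom C s = Cod C e" and se: "s \<cdot> e = Ide C (Dom C e)"
  shows "is_mono C e"
proof (rule monoI)
  show "e \<in> Arr C" by simp
  have [simp]: "Cod C s = Dom C e" using Comp_arr(3)[of e s] se by simp
  fix f g
  assume fg [simp]: "f \<in> Arr C" "g \<in> Arr C" "Cod C f = Dom C e" "Cod C g = Dom C e"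
    and eq: "e \<cdot> f = e \<cdot> g"
  have "f = (s \<cdot> e) \<cdot> f" by (simp add: se del: Comp_assoc')
  also have "\<dots> = s \<cdot> e \<cdot> g" using eq by simp
  also have "\<dots> = (s \<cdot> e) \<cdot> g" by simp
  also have "\<dots> = g" by (simp add: se del: Comp_assoc')
  finally show "f = g" .
qed

lemma are_inverse_unique:
  assumes "are_inverse C f g" "are_inverse C f h"
  shows "g = h"
proof -
  have [simp]: "f \<in> Arr C" "g \<in> Arr C" "h \<in> Arr C" "Dom C g = Cod C f" "Cod C g = Dom C f"
    "Dom C h = Cod C f" "Cod C h = Dom C f" and e: "h \<cdot> f = Ide C (Dom C f)" "f \<cdot> g = Ide C (Cod C f)"
    using assms by (auto simp: are_inverse_def Hom_def)
  have "g = (h \<cdot> f) \<cdot> g" by (simp add: e del: Comp_assoc')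
  also have "\<dots> = h \<cdot> (f \<cdot> g)" by (rule Comp_assoc') simp_all
  also have "\<dots> = h" by (simp add: e)
  finally show ?thesis .
qed

lemma inverse_arr:
  assumes "is_iso C f"
  shows "are_inverse C f (inverse_arr C f)"
proof -
  obtain g where g: "are_inverse C f g" using assms by (auto simp: is_iso_def)
  show ?thesis unfolding inverse_arr_def by (rule theI[of "are_inverse C f"]) (use are_inverse_unique g in blast)+
qed

lemma iso_arr: "is_iso C f \<Longrightarrow> f \<in> Arr C"
  by (auto simp: is_iso_def are_inverse_def)

lemma inverse_arr_simps [simp]:
  assumes "is_iso C f"
  shows "inverse_arr C f \<in> Arr C" "Dom C (inverse_arr C f) = Cod C f" "Cod C (inverse_arr C f) = Dom C f"
    "inverse_arr C f \<cdot> f = Ide C (Dom C f)" "f \<cdot> inverse_arr C f = Ide C (Cod C f)"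
  using inverse_arr[OF assms] by (auto simp: are_inverse_def Hom_def)

lemma inverse_arr_cancel [simp]:
  assumes f: "is_iso C f" and [simp]: "g \<in> Arr C" "Cod C g = Cod C f"
  shows "f \<cdot> inverse_arr C f \<cdot> g = g"
proof -
  note [simp] = iso_arr[OF f] f
  have "f \<cdot> inverse_arr C f \<cdot> g = (f \<cdot> inverse_arr C f) \<cdot> g" by (subst Comp_assoc') simp_all
  then show ?thesis by (simp del: Comp_assoc')
qed

lemma iso_epi: "is_iso C f \<Longrightarrow> is_epi C f"
  by (rule split_epi[of _ "inverse_arr C f"]) (auto simp: iso_arr)

lemma iso_mono: "is_iso C f \<Longrightarrow> is_mono C f"
  by (rule split_mono[of _ "inverse_arr C f"]) (auto simp: iso_arr)

lemma Ide_iso [simp]: "a \<in> Obj C \<Longrightarrow> is_iso C (Ide C a)"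
  unfolding is_iso_def are_inverse_def by (rule exI[of _ "Ide C a"]) (simp add: Hom_iff)

lemma Ide_epi: "a \<in> Obj C \<Longrightarrow> is_epi C (Ide C a)"
  by (simp add: iso_epi)

text \<open>Cancelling the monomorphisms \<open>k\<close> and \<open>l\<close> on the left turns
  \<open>k \<cdot> h' \<cdot> h = k\<close> and \<open>l \<cdot> h \<cdot> h' = l\<close> into the
  statement that \<open>h\<close> and \<open>h'\<close> are mutually inverse.\<close>

lemma same_subobjectI:
  assumes k: "is_mono C k" and l: "is_mono C l" and c: "Cod C k = Cod C l"
    and h: "h \<in> Hom C (Dom C k) (Dom C l)" "l \<cdot> h = k"
    and h': "h' \<in> Hom C (Dom C l) (Dom C k)" "k \<cdot> h' = l"
  shows "same_subobject C k l"
proof -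
  have [simp]: "k \<in> Arr C" "l \<in> Arr C" using k l by (auto simp: is_mono_def)
  note [simp] = HomD[OF h(1)] HomD[OF h'(1)] c
  have "k \<cdot> h' \<cdot> h = (k \<cdot> h') \<cdot> h" by simp
  also have "\<dots> = k" using h(2) h'(2) by simp
  finally have 1: "h' \<cdot> h = Ide C (Dom C k)"
    by - (rule mono_cancel[OF k], simp_all)
  have "l \<cdot> h \<cdot> h' = (l \<cdot> h) \<cdot> h'" by simp
  also have "\<dots> = l" using h(2) h'(2) by simp
  finally have 2: "h \<cdot> h' = Ide C (Dom C l)"
    by - (rule mono_cancel[OF l], simp_all)
  have "is_iso C h" unfolding is_iso_def are_inverse_def
    by (rule exI[of _ h']) (simp add: 1 2 Hom_iff)
  then show ?thesis using k l c h unfolding same_subobject_def by blast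
qed


subsection \<open>Coproducts\<close>

lemma coproduct_Hom:
  "is_coproduct C I F P j \<Longrightarrow> k \<in> I \<Longrightarrow> j k \<in> Hom C (F k) P"
  by (simp add: is_coproduct_def)

lemma coproduct_Obj: "is_coproduct C I F P j \<Longrightarrow> P \<in> Obj C"
  by (simp add: is_coproduct_def)

lemma coproduct_ex:
  assumes "is_coproduct C I F P j" "Z \<in> Obj C" "\<And>k. k \<in> I \<Longrightarrow> g k \<in> Hom C (F k) Z"
  shows "\<exists>!h. h \<in> Hom C P Z \<and> (\<forall>k\<in>I. h \<cdot> j k = g k)"
  using assms unfolding is_coproduct_def by blast

lemma coproduct_eqI:
  assumes c: "is_coproduct C I F P j" and f: "f \<in> Hom C P Z" and g: "g \<in> Hom C P Z"
    and eq: "\<And>k. k \<in> I \<Longrightarrow> f \<cdot> j k = g \<cdot> j k"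
  shows "f = g"
proof -
  have "\<exists>!h. h \<in> Hom C P Z \<and> (\<forall>k\<in>I. h \<cdot> j k = g \<cdot> j k)"
    by (rule coproduct_ex[OF c HomD(5)[OF g]]) (rule Comp_Hom[OF coproduct_Hom[OF c] g])
  then show ?thesis using f g eq by blast
qed

text \<open>\<open>coprod\<close> is a bare choice; it has the universal property as soon as some
  coproduct exists.\<close>

lemma coprod_is_coproduct:
  assumes "is_coproduct C I F P j"
  shows "is_coproduct C I F (coprod_obj C I F) (coprod_inj C I F)"
proof -
  have "case coprod C I F of (P, j) \<Rightarrow> is_coproduct C I F P j"
    unfolding coprod_def by (rule someI[of _ "(P, j)"]) (simp add: assms)
  then show ?thesis by (auto simp: coprod_obj_def coprod_inj_def split: prod.splits)
qed

lemma copair: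
  assumes "is_coproduct C I F P j" "Z \<in> Obj C" "\<And>k. k \<in> I \<Longrightarrow> g k \<in> Hom C (F k) Z"
  shows "copair C I F Z g \<in> Hom C (coprod_obj C I F) Z"
    "\<And>k. k \<in> I \<Longrightarrow> copair C I F Z g \<cdot> coprod_inj C I F k = g k"
  using theI'[OF coproduct_ex[OF coprod_is_coproduct[OF assms(1)] assms(2,3)], simplified]
  unfolding copair_def by auto

text \<open>Serves to pass between sets of naturals, subsets of the smallness type, and the pairs
  \<open>(a, b)\<close> with \<open>a + b = n\<close>.\<close>

lemma coproduct_reindex:
  assumes c: "is_coproduct C I F P j" and b: "bij_betw f K I"
  shows "is_coproduct C K (\<lambda>k. F (f k)) P (\<lambda>k. j (f k))"
  unfolding is_coproduct_def
proof (intro conjI ballI allI impI)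
  show "P \<in> Obj C" using c by (simp add: is_coproduct_def)
  fix k assume "k \<in> K"
  then have "f k \<in> I" using b by (auto simp: bij_betw_def)
  then show "F (f k) \<in> Obj C" "j (f k) \<in> Hom C (F (f k)) P"
    using c by (auto simp: is_coproduct_def)
next
  fix Z g assume Z: "Z \<in> Obj C" and g: "\<forall>k\<in>K. g k \<in> Hom C (F (f k)) Z"
  let ?g = "\<lambda>i. g (inv_into K f i)"
  have inv: "inv_into K f i \<in> K" "f (inv_into K f i) = i" if "i \<in> I" for i
    using b that by (auto simp: bij_betw_def inv_into_into f_inv_into_f)
  have inv': "inv_into K f (f k) = k" "f k \<in> I" if "k \<in> K" for k
    using b that by (auto simp: bij_betw_def)
  have "\<exists>!h. h \<in> Hom C P Z \<and> (\<forall>i\<in>I. h \<cdot> j i = ?g i)"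
    by (rule coproduct_ex[OF c Z]) (use g inv in metis)
  moreover have "(\<forall>i\<in>I. h \<cdot> j i = ?g i) \<longleftrightarrow> (\<forall>k\<in>K. h \<cdot> j (f k) = g k)" for h
    using inv inv' by metis
  ultimately show "\<exists>!h. h \<in> Hom C P Z \<and> (\<forall>k\<in>K. h \<cdot> j (f k) = g k)" by simp
qed

lemma coproduct_cong:
  assumes "is_coproduct C I F P j" "\<And>k. k \<in> I \<Longrightarrow> F k = G k" "\<And>k. k \<in> I \<Longrightarrow> j k = l k"
  shows "is_coproduct C I G P l"
  using assms unfolding is_coproduct_def by simp

text \<open>The diagram is the discrete category on a subset of \<open>'s\<close> in bijection with \<open>I\<close>.\<close>

lemma cocomplete_coproduct:
  fixes f :: "'i \<Rightarrow> 's"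
  assumes cc: "cocomplete TYPE('s) C" and inj: "inj_on f I" and F: "\<And>k. k \<in> I \<Longrightarrow> F k \<in> Obj C"
  shows "\<exists>P j. is_coproduct C I F P j"
proof -
  \<comment> \<open>Only an arrow and itself are composable here, so returning the first argument is
    a legitimate composition.\<close>
  let ?J = "\<lparr>Obj = f ` I, Arr = f ` I, Dom = (\<lambda>x. x), Cod = (\<lambda>x. x), Ide = (\<lambda>x. x), Comp = (\<lambda>x y. x)\<rparr> :: ('s, 's) cat"
  let ?F = "\<lambda>x. F (inv_into I f x)"
  let ?A = "\<lambda>x. Ide C (?F x)"
  have inv [simp]: "inv_into I f (f k) = k" if "k \<in> I" for k
    using inj that by simp
  have FO: "?F x \<in> Obj C" if "x \<in> f ` I" for x using that F by auto
  have J: "category ?J" by unfold_locales (auto simp: Hom_def)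
  have "is_functor ?J C ?F ?A"
    unfolding is_functor_def using FO by (auto simp: Hom_iff F)
  then obtain L c where L: "is_colimit ?J C ?F ?A L c"
    using cc J unfolding cocomplete_def by blast
  have cone: "is_cocone ?J C ?F ?A Z d \<longleftrightarrow> Z \<in> Obj C \<and> (\<forall>i\<in>f ` I. d i \<in> Hom C (?F i) Z)" for Z d
    unfolding is_cocone_def by (auto simp: Hom_iff)
  have LO: "L \<in> Obj C" and LH: "\<forall>i\<in>f ` I. c i \<in> Hom C (?F i) L"
    using L unfolding is_colimit_def cone by auto
  have "is_coproduct C (f ` I) ?F L c"
    unfolding is_coproduct_def
  proof (intro conjI ballI allI impI)
    fix Z g assume "Z \<in> Obj C" "\<forall>k\<in>f ` I. g k \<in> Hom C (F (inv_into I f k)) Z"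
    then have "is_cocone ?J C ?F ?A Z g" unfolding cone by blast
    then show "\<exists>!h. h \<in> Hom C L Z \<and> (\<forall>k\<in>f ` I. h \<cdot> c k = g k)"
      using L unfolding is_colimit_def by simp
  qed (use LO LH FO in auto)
  then have "is_coproduct C I (\<lambda>k. ?F (f k)) L (\<lambda>k. c (f k))"
    by (rule coproduct_reindex) (use inj in \<open>simp add: bij_betw_def\<close>)
  then have "is_coproduct C I F L (\<lambda>k. c (f k))"
    by (rule coproduct_cong) simp_all
  then show ?thesis by blast
qed

lemma coequalizer_factor:
  assumes "is_coequalizer C f g q" "h \<in> Hom C (Dom C q) Z" "h \<cdot> f = h \<cdot> g"
  shows "\<exists>!e. e \<in> Hom C (Cod C q) Z \<and> e \<cdot> q = h"
proof -
  have "h \<in> Arr C" "Dom C h = Cod C f" "Cod C h = Z"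
    using assms by (simp_all add: is_coequalizer_def Hom_iff)
  then show ?thesis using assms(1,3) unfolding is_coequalizer_def by blast
qed

lemma coequalizer_epi:
  assumes "is_coequalizer C f g q"
  shows "is_epi C q"
proof (rule epiI)
  have [simp]: "f \<in> Arr C" "g \<in> Arr C" "q \<in> Arr C" "Dom C f = Dom C g" "Cod C f = Cod C g" "Dom C q = Cod C g"
    and fg: "q \<cdot> f = q \<cdot> g"
    and u: "\<And>h. h \<in> Arr C \<Longrightarrow> Dom C h = Cod C f \<Longrightarrow> h \<cdot> f = h \<cdot> g \<Longrightarrow> (\<exists>!e. e \<in> Hom C (Cod C q) (Cod C h) \<and> e \<cdot> q = h)"
    using assms unfolding is_coequalizer_def by auto
  show "q \<in> Arr C" by simp
  fix x y assume [simp]: "x \<in> Arr C" "y \<in> Arr C" "Dom C x = Cod C q" "Dom C y = Cod C q" "Cod C x = Cod C y"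
    and xy: "x \<cdot> q = y \<cdot> q"
  have 1: "\<exists>!e. e \<in> Hom C (Cod C q) (Cod C (x \<cdot> q)) \<and> e \<cdot> q = x \<cdot> q"
    by (rule u) (simp_all add: fg)
  show "x = y" by (rule ex1_eq[OF 1]) (simp_all add: Hom_iff xy)
qed

end

section \<open>Zero morphisms, differences, and coequalizers as cokernels\<close>

context preadditive_category
begin

lemma Zer_arr [simp]:
  assumes "a \<in> Obj C" "b \<in> Obj C"
  shows "Zer C a b \<in> Arr C" "Dom C (Zer C a b) = a" "Cod C (Zer C a b) = b"
  using HomD[OF Zer_Hom[OF assms]] by auto

lemma Add_cancel:
  assumes f: "f \<in> Hom C a b" and g: "g \<in> Hom C a b" and h: "h \<in> Hom C a b" and e: "f \<oplus> h = g \<oplus> h"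
  shows "f = g"
proof -
  obtain k where k: "k \<in> Hom C a b" "h \<oplus> k = Zer C a b" using Add_inverse[OF h] by blast
  have z: "x = x \<oplus> Zer C a b" if "x \<in> Hom C a b" for x
    using Zer_Add[OF that] Add_commute[OF that Zer_Hom] that HomD by metis
  have "f = f \<oplus> (h \<oplus> k)" using z[OF f] k by simp
  also have "\<dots> = g \<oplus> (h \<oplus> k)"
    using Add_assoc[OF f h k(1)] Add_assoc[OF g h k(1)] e by simp
  also have "\<dots> = g" using z[OF g] k by simp
  finally show ?thesis .
qed

text \<open>The signature has no subtraction; \<open>d\<close> is the difference of \<open>f\<close>
  and \<open>g\<close>, characterised by \<open>d \<oplus> g = f\<close>.\<close>

lemma sub_ex:
  assumes f: "f \<in> Hom C a b" and g: "g \<in> Hom C a b"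
  obtains d where "d \<in> Hom C a b" "d \<oplus> g = f"
proof -
  obtain k where k: "k \<in> Hom C a b" "g \<oplus> k = Zer C a b" using Add_inverse[OF g] by blast
  have "(f \<oplus> k) \<oplus> g = f \<oplus> (g \<oplus> k)"
    using Add_assoc[OF f k(1) g] Add_commute[OF k(1) g] by simp
  also have "\<dots> = f"
    using k Zer_Add[OF f] Add_commute[OF f Zer_Hom] f HomD by metis
  finally show thesis using that[OF Add_Hom[OF f k(1)]] by blast
qed

text \<open>By distributivity \<open>f \<cdot> Zer C a b\<close> is its own double, so cancellation
  in the hom-group makes it zero.\<close>

lemma Comp_Zer [simp]:
  assumes [simp]: "f \<in> Arr C" "Dom C f = b" "a \<in> Obj C"
  shows "f \<cdot> Zer C a b = Zer C a (Cod C f)"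
proof -
  have [simp]: "b \<in> Obj C" using assms Dom_Obj by blast
  have z: "Zer C a b \<in> Hom C a b" by (simp add: Hom_iff)
  have h: "f \<cdot> Zer C a b \<in> Hom C a (Cod C f)" "f \<in> Hom C b (Cod C f)" by (simp_all add: Hom_iff)
  have "f \<cdot> Zer C a b \<oplus> f \<cdot> Zer C a b = Zer C a (Cod C f) \<oplus> f \<cdot> Zer C a b"
    using Comp_Add[OF z z h(2)] Zer_Add[OF z] Zer_Add[OF h(1)] by simp
  then show ?thesis by (rule Add_cancel[OF h(1) _ h(1), rotated]) (simp add: Hom_iff)
qed

lemma Zer_Comp [simp]:
  assumes [simp]: "f \<in> Arr C" "Cod C f = a" "b \<in> Obj C"
  shows "Zer C a b \<cdot> f = Zer C (Dom C f) b"
proof -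
  have [simp]: "a \<in> Obj C" using assms Cod_Obj by blast
  have z: "Zer C a b \<in> Hom C a b" by (simp add: Hom_iff)
  have h: "Zer C a b \<cdot> f \<in> Hom C (Dom C f) b" "f \<in> Hom C (Dom C f) a" by (simp_all add: Hom_iff)
  have "Zer C a b \<cdot> f \<oplus> Zer C a b \<cdot> f = Zer C (Dom C f) b \<oplus> Zer C a b \<cdot> f"
    using Add_Comp[OF h(2) z z] Zer_Add[OF z] Zer_Add[OF h(1)] by simp
  then show ?thesis by (rule Add_cancel[OF h(1) _ h(1), rotated]) (simp add: Hom_iff)
qed

lemma sub_eq_zero:
  assumes "d \<in> Hom C a b" "g \<in> Hom C a b" "d \<oplus> g = f"
  shows "d = Zer C a b \<longleftrightarrow> f = g"
proof
  assume "d = Zer C a b" then show "f = g" using assms Zer_Add by metis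
next
  assume "f = g"
  then have "d \<oplus> g = Zer C a b \<oplus> g" using assms Zer_Add by metis
  then show "d = Zer C a b" by (rule Add_cancel[OF assms(1) _ assms(2), rotated]) (rule Zer_Hom, insert HomD[OF assms(1)])
qed

text \<open>A parallel pair equalised by \<open>e\<close> has a difference killed by
  \<open>e\<close>, so testing single arrows against zero suffices.\<close>

lemma epi_of_zero:
  assumes e [simp]: "e \<in> Arr C"
    and z: "\<And>f. f \<in> Arr C \<Longrightarrow> Dom C f = Cod C e \<Longrightarrow> f \<cdot> e = Zer C (Dom C e) (Cod C f) \<Longrightarrow> f = Zer C (Cod C e) (Cod C f)"
  shows "is_epi C e"
proof (rule epiI[OF e])
  fix f g assume [simp]: "f \<in> Arr C" "g \<in> Arr C" "Dom C f = Cod C e" "Dom C g = Cod C e" "Cod C f = Cod C g"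
    and eq: "f \<cdot> e = g \<cdot> e"
  have H: "f \<in> Hom C (Cod C e) (Cod C g)" "g \<in> Hom C (Cod C e) (Cod C g)" "e \<in> Hom C (Dom C e) (Cod C e)"
    by (simp_all add: Hom_iff)
  obtain d where d: "d \<in> Hom C (Cod C e) (Cod C g)" "d \<oplus> g = f" by (rule sub_ex[OF H(1,2)])
  note [simp] = HomD[OF d(1)]
  have "d \<cdot> e \<oplus> g \<cdot> e = f \<cdot> e" using Add_Comp[OF H(3) d(1) H(2)] d(2) by simp
  then have "d \<cdot> e = Zer C (Dom C e) (Cod C g)"
    using sub_eq_zero[of "d \<cdot> e" "Dom C e" "Cod C g" "g \<cdot> e" "f \<cdot> e"] eq by (simp add: Hom_iff)
  then have "d = Zer C (Cod C e) (Cod C g)" using z[of d] by simp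
  then show "f = g" using sub_eq_zero[OF d(1) H(2) d(2)] by simp
qed

text \<open>Identifying \<open>f\<close> with \<open>g\<close> means killing their difference. This
  bridges balanced products, which are coequalizers, and right exactness, which speaks of
  cokernels.\<close>

lemma coequalizer_cokernel:
  assumes f: "f \<in> Hom C a b" and g: "g \<in> Hom C a b" and d: "d \<in> Hom C a b" "d \<oplus> g = f"
  shows "is_coequalizer C f g q \<longleftrightarrow> is_cokernel C d q"
proof -
  note [simp] = HomD[OF f] HomD[OF g] HomD[OF d(1)]
  have eq: "h \<cdot> f = h \<cdot> g \<longleftrightarrow> h \<cdot> d = Zer C (Dom C d) (Cod C h)" if [simp]: "h \<in> Arr C" "Dom C h = b" for h
  proof -
    have h: "h \<in> Hom C b (Cod C h)" by (simp add: Hom_iff)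
    have "h \<cdot> d \<oplus> h \<cdot> g = h \<cdot> f" using Comp_Add[OF d(1) g h] d(2) by simp
    then show ?thesis
      using sub_eq_zero[of "h \<cdot> d" a "Cod C h" "h \<cdot> g" "h \<cdot> f"] by (simp add: Hom_iff)
  qed
  show ?thesis
    unfolding is_coequalizer_def is_cokernel_def using eq by auto
qed

lemma kernel_mono:
  assumes "is_kernel C f k"
  shows "is_mono C k"
proof (rule monoI)
  have [simp]: "f \<in> Arr C" "k \<in> Arr C" "Cod C k = Dom C f" and z: "f \<cdot> k = Zer C (Dom C k) (Cod C f)"
    and u: "\<And>g. g \<in> Arr C \<Longrightarrow> Cod C g = Dom C f \<Longrightarrow> f \<cdot> g = Zer C (Dom C g) (Cod C f) \<Longrightarrow>
      (\<exists>!e. e \<in> Hom C (Dom C g) (Dom C k) \<and> k \<cdot> e = g)"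
    using assms unfolding is_kernel_def by auto
  show "k \<in> Arr C" by simp
  fix x y assume [simp]: "x \<in> Arr C" "y \<in> Arr C" "Cod C x = Dom C k" "Cod C y = Dom C k" "Dom C x = Dom C y"
    and eq: "k \<cdot> x = k \<cdot> y"
  have "f \<cdot> k \<cdot> x = (f \<cdot> k) \<cdot> x" by simp
  also have "\<dots> = Zer C (Dom C x) (Cod C f)" unfolding z by simp
  finally have 1: "\<exists>!e. e \<in> Hom C (Dom C (k \<cdot> x)) (Dom C k) \<and> k \<cdot> e = k \<cdot> x"
    by (intro u) simp_all
  show "x = y" by (rule ex1_eq[OF 1]) (simp_all add: Hom_iff eq)
qed

end

section \<open>Coequalizers and images in an abelian category\<close>

context abelian_category
begin

lemma coequalizer_exists:
  assumes f: "f \<in> Hom C a b" and g: "g \<in> Hom C a b"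
  shows "\<exists>q. is_coequalizer C f g q"
proof -
  obtain d where d: "d \<in> Hom C a b" "d \<oplus> g = f" by (rule sub_ex[OF f g])
  then show ?thesis using cokernel_exists[of d] coequalizer_cokernel[OF f g d] HomD[OF d(1)] by blast
qed

lemma cokernel_epi:
  assumes "is_cokernel C f q"
  shows "is_epi C q"
proof (rule epiI)
  have [simp]: "f \<in> Arr C" "q \<in> Arr C" "Dom C q = Cod C f" and z: "q \<cdot> f = Zer C (Dom C f) (Cod C q)"
    and u: "\<And>g. g \<in> Arr C \<Longrightarrow> Dom C g = Cod C f \<Longrightarrow> g \<cdot> f = Zer C (Dom C f) (Cod C g) \<Longrightarrow>
      (\<exists>!e. e \<in> Hom C (Cod C q) (Cod C g) \<and> e \<cdot> q = g)"
    using assms unfolding is_cokernel_def by auto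
  show "q \<in> Arr C" by simp
  fix x y assume [simp]: "x \<in> Arr C" "y \<in> Arr C" "Dom C x = Cod C q" "Dom C y = Cod C q" "Cod C x = Cod C y"
    and eq: "x \<cdot> q = y \<cdot> q"
  have "(x \<cdot> q) \<cdot> f = Zer C (Dom C f) (Cod C (x \<cdot> q))" by (simp add: z)
  then have 1: "\<exists>!e. e \<in> Hom C (Cod C q) (Cod C (x \<cdot> q)) \<and> e \<cdot> q = x \<cdot> q"
    by (intro u) simp_all
  show "x = y" by (rule ex1_eq[OF 1]) (simp_all add: Hom_iff eq)
qed

lemma image_exists:
  assumes "f \<in> Arr C"
  shows "\<exists>k. is_image C f k"
proof -
  obtain q where q: "is_cokernel C f q" using cokernel_exists[OF assms] by blast
  then obtain k where "is_kernel C q k" using kernel_exists[of q] unfolding is_cokernel_def by blast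
  then show ?thesis using q unfolding is_image_def by blast
qed

text \<open>A cokernel \<open>q\<close> of \<open>k \<cdot> e\<close> kills \<open>k\<close> because
  \<open>e\<close> is epi, so \<open>k\<close> factors through the kernel \<open>l\<close> of
  \<open>q\<close>. Conversely \<open>k\<close> is itself a kernel of some \<open>f\<close>; this
  \<open>f\<close> kills \<open>k \<cdot> e\<close>, so it factors through \<open>q\<close> and
  kills \<open>l\<close>, and \<open>l\<close> factors through \<open>k\<close>.\<close>

lemma image_of_epi_mono:
  assumes k: "is_mono C k" and e: "is_epi C e" and c [simp]: "Dom C k = Cod C e"
    and l: "is_image C (k \<cdot> e) l"
  shows "same_subobject C k l"
proof -
  have [simp]: "k \<in> Arr C" "e \<in> Arr C" using k e by (auto simp: is_mono_def is_epi_def)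
  obtain q where q: "is_cokernel C (k \<cdot> e) q" and ql: "is_kernel C q l"
    using l unfolding is_image_def by blast
  have [simp]: "q \<in> Arr C" "Dom C q = Cod C k" and qz: "q \<cdot> k \<cdot> e = Zer C (Dom C e) (Cod C q)"
    and qu: "\<And>g. g \<in> Arr C \<Longrightarrow> Dom C g = Cod C k \<Longrightarrow> g \<cdot> k \<cdot> e = Zer C (Dom C e) (Cod C g) \<Longrightarrow>
      (\<exists>!x. x \<in> Hom C (Cod C q) (Cod C g) \<and> x \<cdot> q = g)"
    using q unfolding is_cokernel_def by auto
  have [simp]: "l \<in> Arr C" "Cod C l = Cod C k" and lz: "q \<cdot> l = Zer C (Dom C l) (Cod C q)"
    and lu: "\<And>g. g \<in> Arr C \<Longrightarrow> Cod C g = Dom C q \<Longrightarrow> q \<cdot> g = Zer C (Dom C g) (Cod C q) \<Longrightarrow>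
      (\<exists>!x. x \<in> Hom C (Dom C g) (Dom C l) \<and> l \<cdot> x = g)"
    using ql unfolding is_kernel_def by auto
  have qk: "q \<cdot> k = Zer C (Dom C k) (Cod C q)"
    by (rule epi_cancel[OF e]) (simp_all add: qz)
  obtain h where h: "h \<in> Hom C (Dom C k) (Dom C l)" "l \<cdot> h = k"
    using lu[of k] qk by auto
  obtain f where f: "is_kernel C f k" using mono_is_kernel[OF k] by blast
  have [simp]: "f \<in> Arr C" "Dom C f = Cod C k" and fz: "f \<cdot> k = Zer C (Dom C k) (Cod C f)"
    and fu: "\<And>g. g \<in> Arr C \<Longrightarrow> Cod C g = Dom C f \<Longrightarrow> f \<cdot> g = Zer C (Dom C g) (Cod C f) \<Longrightarrow>
      (\<exists>!x. x \<in> Hom C (Dom C g) (Dom C k) \<and> k \<cdot> x = g)"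
    using f unfolding is_kernel_def by auto
  have "f \<cdot> k \<cdot> e = (f \<cdot> k) \<cdot> e" by simp
  also have "\<dots> = Zer C (Dom C e) (Cod C f)" unfolding fz by simp
  finally obtain x where x: "x \<in> Hom C (Cod C q) (Cod C f)" "x \<cdot> q = f" using qu[of f] by auto
  note [simp] = HomD[OF x(1)]
  have "f \<cdot> l = x \<cdot> q \<cdot> l" unfolding x(2)[symmetric] by simp
  also have "\<dots> = Zer C (Dom C l) (Cod C f)" unfolding lz by simp
  finally obtain h' where h': "h' \<in> Hom C (Dom C l) (Dom C k)" "k \<cdot> h' = l" using fu[of l] by auto
  show ?thesis
    by (rule same_subobjectI[OF k kernel_mono[OF ql] _ h h']) simp
qed

text \<open>\<open>g\<close> factors through a cokernel of \<open>f\<close>, and the image is by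
  definition killed by that cokernel.\<close>

lemma zero_on_image:
  assumes l: "is_image C f l" and [simp]: "f \<in> Arr C" "g \<in> Arr C" "Dom C g = Cod C f"
    and z: "g \<cdot> f = Zer C (Dom C f) (Cod C g)"
  shows "g \<cdot> l = Zer C (Dom C l) (Cod C g)"
proof -
  obtain q where q: "is_cokernel C f q" and ql: "is_kernel C q l"
    using l unfolding is_image_def by blast
  have [simp]: "q \<in> Arr C" "Dom C q = Cod C f"
    and qu: "\<And>g. g \<in> Arr C \<Longrightarrow> Dom C g = Cod C f \<Longrightarrow> g \<cdot> f = Zer C (Dom C f) (Cod C g) \<Longrightarrow>
      (\<exists>!x. x \<in> Hom C (Cod C q) (Cod C g) \<and> x \<cdot> q = g)"
    using q unfolding is_cokernel_def by auto
  have [simp]: "l \<in> Arr C" "Cod C l = Cod C f" and lz: "q \<cdot> l = Zer C (Dom C l) (Cod C q)"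
    using ql unfolding is_kernel_def by auto
  obtain x where x: "x \<in> Hom C (Cod C q) (Cod C g)" "x \<cdot> q = g" using qu[of g] z by auto
  note [simp] = HomD[OF x(1)]
  have "g \<cdot> l = x \<cdot> q \<cdot> l" unfolding x(2)[symmetric] by simp
  also have "\<dots> = Zer C (Dom C l) (Cod C g)" unfolding lz by simp
  finally show ?thesis .
qed

end

section \<open>Naturality and coherence of the constraints\<close>

context monoidal_category
begin

lemmas TenO_Obj' [simp] = TenO_Obj
lemmas One_Obj' [simp] = One_Obj
lemmas TenA_Ide' [simp] = TenA_Ide

lemma TenA_arr [simp]:
  assumes "f \<in> Arr C" "g \<in> Arr C"
  shows "f \<otimes> g \<in> Arr C" "Dom C (f \<otimes> g) = Dom C f \<odot> Dom C g" "Cod C (f \<otimes> g) = Cod C f \<odot> Cod C g"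
  using HomD[OF TenA_Hom[of f "Dom C f" "Cod C f" g "Dom C g" "Cod C g"]] assms by (auto simp: Hom_def)

lemma interchange [simp]:
  assumes "f \<in> Arr C" "f' \<in> Arr C" "Dom C f' = Cod C f" "g \<in> Arr C" "g' \<in> Arr C" "Dom C g' = Cod C g"
  shows "(f' \<otimes> g') \<cdot> (f \<otimes> g) = (f' \<cdot> f) \<otimes> (g' \<cdot> g)"
  by (rule TenA_Comp[symmetric]) (use assms in \<open>auto simp: Hom_iff\<close>)

text \<open>Composites are kept bracketed to the right, so two tensored arrows usually meet with a
  further arrow \<open>h\<close> behind them. The naturality rules below have variants of the same
  kind.\<close>

lemma interchange_ext [simp]:
  assumes [simp]: "f \<in> Arr C" "f' \<in> Arr C" "Dom C f' = Cod C f" "g \<in> Arr C" "g' \<in> Arr C" "Dom C g' = Cod C g"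
    and [simp]: "h \<in> Arr C" "Cod C h = Dom C f \<odot> Dom C g"
  shows "(f' \<otimes> g') \<cdot> (f \<otimes> g) \<cdot> h = ((f' \<cdot> f) \<otimes> (g' \<cdot> g)) \<cdot> h"
proof -
  have "(f' \<otimes> g') \<cdot> (f \<otimes> g) \<cdot> h = ((f' \<otimes> g') \<cdot> (f \<otimes> g)) \<cdot> h" by (subst Comp_assoc') simp_all
  then show ?thesis by (simp only: interchange assms)
qed

lemma Assoc_arr [simp]:
  assumes "X \<in> Obj C" "Y \<in> Obj C" "Z \<in> Obj C"
  shows "Assoc C X Y Z \<in> Arr C" "Dom C (Assoc C X Y Z) = (X \<odot> Y) \<odot> Z"
    "Cod C (Assoc C X Y Z) = X \<odot> (Y \<odot> Z)" "is_iso C (Assoc C X Y Z)"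
  using HomD[OF Assoc_Hom[OF assms]] Assoc_iso[OF assms] by auto

lemma LUni_arr [simp]:
  assumes "X \<in> Obj C"
  shows "LUni C X \<in> Arr C" "Dom C (LUni C X) = One C \<odot> X" "Cod C (LUni C X) = X" "is_iso C (LUni C X)"
  using HomD[OF LUni_Hom[OF assms]] LUni_iso[OF assms] by auto

lemma RUni_arr [simp]:
  assumes "X \<in> Obj C"
  shows "RUni C X \<in> Arr C" "Dom C (RUni C X) = X \<odot> One C" "Cod C (RUni C X) = X" "is_iso C (RUni C X)"
  using HomD[OF RUni_Hom[OF assms]] RUni_iso[OF assms] by auto

lemma Assoc_nat [simp]:
  assumes "f \<in> Arr C" "g \<in> Arr C" "h \<in> Arr C" "Cod C f = X" "Cod C g = Y" "Cod C h = Z"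
  shows "Assoc C X Y Z \<cdot> ((f \<otimes> g) \<otimes> h) = (f \<otimes> (g \<otimes> h)) \<cdot> Assoc C (Dom C f) (Dom C g) (Dom C h)"
  by (rule Assoc_natural) (use assms in \<open>auto simp: Hom_iff\<close>)

lemma Assoc_nat_ext [simp]:
  assumes [simp]: "f \<in> Arr C" "g \<in> Arr C" "h \<in> Arr C"
    and c: "Cod C f = X" "Cod C g = Y" "Cod C h = Z"
    and [simp]: "k \<in> Arr C" "Cod C k = (Dom C f \<odot> Dom C g) \<odot> Dom C h"
  shows "Assoc C X Y Z \<cdot> ((f \<otimes> g) \<otimes> h) \<cdot> k = (f \<otimes> (g \<otimes> h)) \<cdot> Assoc C (Dom C f) (Dom C g) (Dom C h) \<cdot> k"
proof -
  have [simp]: "X \<in> Obj C" "Y \<in> Obj C" "Z \<in> Obj C" using c by auto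
  have "Assoc C X Y Z \<cdot> ((f \<otimes> g) \<otimes> h) \<cdot> k = (Assoc C X Y Z \<cdot> ((f \<otimes> g) \<otimes> h)) \<cdot> k"
    by (subst Comp_assoc') (simp_all add: c)
  also have "\<dots> = ((f \<otimes> (g \<otimes> h)) \<cdot> Assoc C (Dom C f) (Dom C g) (Dom C h)) \<cdot> k"
    by (simp only: Assoc_nat assms c)
  also have "\<dots> = (f \<otimes> (g \<otimes> h)) \<cdot> Assoc C (Dom C f) (Dom C g) (Dom C h) \<cdot> k"
    by (subst Comp_assoc') simp_all
  finally show ?thesis .
qed

text \<open>Variants for an identity on a tensor product, which \<open>TenA_Ide\<close> has already contracted.\<close>

lemma Assoc_nat_Ide [simp]:
  assumes "X \<in> Obj C" "Y \<in> Obj C" "h \<in> Arr C" "Cod C h = Z"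
  shows "Assoc C X Y Z \<cdot> (Ide C (X \<odot> Y) \<otimes> h) = (Ide C X \<otimes> (Ide C Y \<otimes> h)) \<cdot> Assoc C X Y (Dom C h)"
  using Assoc_nat[of "Ide C X" "Ide C Y" h X Y Z] assms by simp

lemma Assoc_nat_Ide_ext [simp]:
  assumes "X \<in> Obj C" "Y \<in> Obj C" "h \<in> Arr C" "Cod C h = Z"
    and "k \<in> Arr C" "Cod C k = (X \<odot> Y) \<odot> Dom C h"
  shows "Assoc C X Y Z \<cdot> (Ide C (X \<odot> Y) \<otimes> h) \<cdot> k
    = (Ide C X \<otimes> (Ide C Y \<otimes> h)) \<cdot> Assoc C X Y (Dom C h) \<cdot> k"
  using Assoc_nat_ext[of "Ide C X" "Ide C Y" h X Y Z k] assms by simp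

lemma LUni_nat [simp]:
  "f \<in> Arr C \<Longrightarrow> Cod C f = X \<Longrightarrow> LUni C X \<cdot> (Ide C (One C) \<otimes> f) = f \<cdot> LUni C (Dom C f)"
  by (rule LUni_natural) (auto simp: Hom_iff)

lemma RUni_nat [simp]:
  "f \<in> Arr C \<Longrightarrow> Cod C f = X \<Longrightarrow> RUni C X \<cdot> (f \<otimes> Ide C (One C)) = f \<cdot> RUni C (Dom C f)"
  by (rule RUni_natural) (auto simp: Hom_iff)

lemma LUni_nat_ext [simp]:
  assumes [simp]: "f \<in> Arr C" and c: "Cod C f = X" and [simp]: "k \<in> Arr C" "Cod C k = One C \<odot> Dom C f"
  shows "LUni C X \<cdot> (Ide C (One C) \<otimes> f) \<cdot> k = f \<cdot> LUni C (Dom C f) \<cdot> k"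
proof -
  have [simp]: "X \<in> Obj C" using c by auto
  have "LUni C X \<cdot> (Ide C (One C) \<otimes> f) \<cdot> k = (LUni C X \<cdot> (Ide C (One C) \<otimes> f)) \<cdot> k"
    by (subst Comp_assoc') (simp_all add: c)
  also have "\<dots> = (f \<cdot> LUni C (Dom C f)) \<cdot> k" using c by (simp only: LUni_nat assms)
  also have "\<dots> = f \<cdot> LUni C (Dom C f) \<cdot> k" by (subst Comp_assoc') simp_all
  finally show ?thesis .
qed

text \<open>By naturality of the isomorphism \<open>LUni\<close>, tensoring with the unit object is
  faithful.\<close>

lemma One_tensor_cancel:
  assumes e: "Ide C (One C) \<otimes> f = Ide C (One C) \<otimes> g"
    and [simp]: "f \<in> Arr C" "g \<in> Arr C" "Dom C f = Dom C g" "Cod C f = Cod C g"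
  shows "f = g"
proof (rule epi_cancel[OF iso_epi[of "LUni C (Dom C g)"]])
  have "f \<cdot> LUni C (Dom C g) = LUni C (Cod C g) \<cdot> (Ide C (One C) \<otimes> f)" by (subst LUni_nat) simp_all
  also have "\<dots> = g \<cdot> LUni C (Dom C g)" unfolding e by simp
  finally show "f \<cdot> LUni C (Dom C g) = g \<cdot> LUni C (Dom C g)" .
qed simp_all

lemma tensor_One_cancel:
  assumes e: "f \<otimes> Ide C (One C) = g \<otimes> Ide C (One C)"
    and [simp]: "f \<in> Arr C" "g \<in> Arr C" "Dom C f = Dom C g" "Cod C f = Cod C g"
  shows "f = g"
proof (rule epi_cancel[OF iso_epi[of "RUni C (Dom C g)"]])
  have "f \<cdot> RUni C (Dom C g) = RUni C (Cod C g) \<cdot> (f \<otimes> Ide C (One C))" by (subst RUni_nat) simp_all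
  also have "\<dots> = g \<cdot> RUni C (Dom C g)" unfolding e by simp
  finally show "f \<cdot> RUni C (Dom C g) = g \<cdot> RUni C (Dom C g)" .
qed simp_all

lemma tensor_iso:
  assumes f: "is_iso C f" and g: "is_iso C g"
  shows "is_iso C (f \<otimes> g)"
proof -
  note [simp] = f g iso_arr[OF f] iso_arr[OF g]
  show ?thesis
    unfolding is_iso_def are_inverse_def
    by (rule exI[of _ "inverse_arr C f \<otimes> inverse_arr C g"]) (simp add: Hom_iff)
qed

text \<open>Kelly's argument: after tensoring with the unit object on the left, the identity follows
  from the pentagon and two triangles, up to the isomorphism \<open>?k\<close>; the extra unit is
  then cancelled.\<close>

lemma LUni_tensor:
  assumes [simp]: "X \<in> Obj C" "Y \<in> Obj C"
  shows "LUni C (X \<odot> Y) \<cdot> Assoc C (One C) X Y = LUni C X \<otimes> Ide C Y"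
proof (rule One_tensor_cancel)
  let ?I = "One C"
  let ?k = "Assoc C ?I (?I \<odot> X) Y \<cdot> (Assoc C ?I ?I X \<otimes> Ide C Y)"
  have epi: "is_epi C ?k" by (intro epi_comp iso_epi tensor_iso) simp_all
  have "(Ide C ?I \<otimes> (LUni C (X \<odot> Y) \<cdot> Assoc C ?I X Y)) \<cdot> ?k
      = (Ide C ?I \<otimes> LUni C (X \<odot> Y)) \<cdot> ((Ide C ?I \<otimes> Assoc C ?I X Y) \<cdot> ?k)" by simp
  also have "\<dots> = (Ide C ?I \<otimes> LUni C (X \<odot> Y)) \<cdot> Assoc C ?I ?I (X \<odot> Y) \<cdot> Assoc C (?I \<odot> ?I) X Y"
    by (subst pentagon) simp_all
  also have "\<dots> = ((Ide C ?I \<otimes> LUni C (X \<odot> Y)) \<cdot> Assoc C ?I ?I (X \<odot> Y)) \<cdot> Assoc C (?I \<odot> ?I) X Y"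
    by simp
  also have "\<dots> = (RUni C ?I \<otimes> (Ide C X \<otimes> Ide C Y)) \<cdot> Assoc C (?I \<odot> ?I) X Y"
    by (subst triangle) simp_all
  also have "\<dots> = Assoc C ?I X Y \<cdot> ((RUni C ?I \<otimes> Ide C X) \<otimes> Ide C Y)"
    by (subst Assoc_nat) simp_all
  also have "\<dots> = Assoc C ?I X Y \<cdot> (((Ide C ?I \<otimes> LUni C X) \<cdot> Assoc C ?I ?I X) \<otimes> Ide C Y)"
    by (simp only: triangle assms One_Obj)
  also have "\<dots> = (Assoc C ?I X Y \<cdot> ((Ide C ?I \<otimes> LUni C X) \<otimes> Ide C Y)) \<cdot> (Assoc C ?I ?I X \<otimes> Ide C Y)"
    by (simp del: Assoc_nat Assoc_nat_ext)
  also have "\<dots> = (Ide C ?I \<otimes> (LUni C X \<otimes> Ide C Y)) \<cdot> ?k"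
    by simp
  finally show "Ide C ?I \<otimes> (LUni C (X \<odot> Y) \<cdot> Assoc C ?I X Y) = Ide C ?I \<otimes> (LUni C X \<otimes> Ide C Y)"
    by - (rule epi_cancel[OF epi], simp_all)
qed simp_all

text \<open>The mirror image of Kelly's argument: the extra unit stands on the right, and the
  isomorphism to be cancelled is postcomposed.\<close>

lemma RUni_tensor:
  assumes [simp]: "X \<in> Obj C" "Y \<in> Obj C"
  shows "(Ide C X \<otimes> RUni C Y) \<cdot> Assoc C X Y (One C) = RUni C (X \<odot> Y)"
proof (rule tensor_One_cancel)
  let ?I = "One C"
  have "Assoc C X Y ?I \<cdot> (((Ide C X \<otimes> RUni C Y) \<cdot> Assoc C X Y ?I) \<otimes> Ide C ?I)
      = (Assoc C X Y ?I \<cdot> ((Ide C X \<otimes> RUni C Y) \<otimes> Ide C ?I)) \<cdot> (Assoc C X Y ?I \<otimes> Ide C ?I)"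
    by (simp del: Assoc_nat Assoc_nat_ext)
  also have "\<dots> = (Ide C X \<otimes> (RUni C Y \<otimes> Ide C ?I)) \<cdot> Assoc C X (Y \<odot> ?I) ?I \<cdot> (Assoc C X Y ?I \<otimes> Ide C ?I)"
    by simp
  also have "\<dots> = (Ide C X \<otimes> ((Ide C Y \<otimes> LUni C ?I) \<cdot> Assoc C Y ?I ?I)) \<cdot> Assoc C X (Y \<odot> ?I) ?I \<cdot> (Assoc C X Y ?I \<otimes> Ide C ?I)"
    by (simp only: triangle assms One_Obj)
  also have "\<dots> = (Ide C X \<otimes> (Ide C Y \<otimes> LUni C ?I)) \<cdot> (Ide C X \<otimes> Assoc C Y ?I ?I) \<cdot> Assoc C X (Y \<odot> ?I) ?I \<cdot> (Assoc C X Y ?I \<otimes> Ide C ?I)"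
    by simp
  also have "\<dots> = (Ide C X \<otimes> (Ide C Y \<otimes> LUni C ?I)) \<cdot> Assoc C X Y (?I \<odot> ?I) \<cdot> Assoc C (X \<odot> Y) ?I ?I"
    by (subst pentagon) simp_all
  also have "\<dots> = Assoc C X Y ?I \<cdot> ((Ide C (X \<odot> Y) \<otimes> LUni C ?I) \<cdot> Assoc C (X \<odot> Y) ?I ?I)"
    by simp
  also have "\<dots> = Assoc C X Y ?I \<cdot> (RUni C (X \<odot> Y) \<otimes> Ide C ?I)"
    by (subst triangle) simp_all
  finally show "((Ide C X \<otimes> RUni C Y) \<cdot> Assoc C X Y ?I) \<otimes> Ide C ?I = RUni C (X \<odot> Y) \<otimes> Ide C ?I"
    by - (rule mono_cancel[OF iso_mono[of "Assoc C X Y ?I"]], simp_all)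
qed simp_all


subsection \<open>Associativity squares\<close>

text \<open>
  Reading the arrows as multiplications, this says \<open>(u v) w = u (v w)\<close>: here \<open>x\<close>, \<open>z\<close> are the
  inner products \<open>u v\<close>, \<open>v w\<close> and \<open>l\<close>, \<open>r\<close> the outer ones.
\<close>

definition assoc_square :: "'o \<Rightarrow> 'o \<Rightarrow> 'o \<Rightarrow> 'm \<Rightarrow> 'm \<Rightarrow> 'm \<Rightarrow> 'm \<Rightarrow> bool"
  where "assoc_square U V W x l z r \<longleftrightarrow> U \<in> Obj C \<and> V \<in> Obj C \<and> W \<in> Obj C \<and>
    x \<in> Arr C \<and> l \<in> Arr C \<and> z \<in> Arr C \<and> r \<in> Arr C \<and>
    Dom C x = U \<odot> V \<and> Dom C z = V \<odot> W \<and> Dom C l = Cod C x \<odot> W \<and> Dom C r = U \<odot> Cod C z \<and>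
    Cod C l = Cod C r \<and> l \<cdot> (x \<otimes> Ide C W) = r \<cdot> (Ide C U \<otimes> z) \<cdot> Assoc C U V W"

lemma assoc_squareD:
  assumes "assoc_square U V W x l z r"
  shows "U \<in> Obj C" "V \<in> Obj C" "W \<in> Obj C"
    "x \<in> Arr C" "l \<in> Arr C" "z \<in> Arr C" "r \<in> Arr C"
    "Dom C x = U \<odot> V" "Dom C z = V \<odot> W" "Dom C l = Cod C x \<odot> W" "Dom C r = U \<odot> Cod C z"
    "Cod C l = Cod C r"
  using assms by (auto simp: assoc_square_def)

lemma assoc_square_eq:
  "assoc_square U V W x l z r \<Longrightarrow> l \<cdot> (x \<otimes> Ide C W) = r \<cdot> (Ide C U \<otimes> z) \<cdot> Assoc C U V W"
  by (simp add: assoc_square_def)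

lemma assoc_squareI:
  assumes "x \<in> Hom C (U \<odot> V) P" "z \<in> Hom C (V \<odot> W) Q" "l \<in> Hom C (P \<odot> W) S" "r \<in> Hom C (U \<odot> Q) S"
    "U \<in> Obj C" "V \<in> Obj C" "W \<in> Obj C"
    "l \<cdot> (x \<otimes> Ide C W) = r \<cdot> (Ide C U \<otimes> z) \<cdot> Assoc C U V W"
  shows "assoc_square U V W x l z r"
  using assms by (auto simp: assoc_square_def Hom_iff)

text \<open>
  The arrows are named after the products \<open>u v\<close>, \<open>v w\<close>, \<open>w x\<close>, with \<open>l\<^sub>1 = (u v) w\<close>, \<open>r\<^sub>1 = u (v w)\<close>,
  \<open>l\<^sub>2 = (v w) x\<close>, \<open>r\<^sub>2 = v (w x)\<close>, \<open>s = (u v w) x\<close>, \<open>t = u (v w x)\<close> and \<open>n = (u v) (w x)\<close>.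
\<close>

context
  fixes U V W X P Q R S1 S2 Z uv vw wx l1 r1 l2 r2 s t n
  assumes O [simp]: "U \<in> Obj C" "V \<in> Obj C" "W \<in> Obj C" "X \<in> Obj C"
    and H: "uv \<in> Hom C (U \<odot> V) P" "vw \<in> Hom C (V \<odot> W) Q" "wx \<in> Hom C (W \<odot> X) R"
      "l1 \<in> Hom C (P \<odot> W) S1" "r1 \<in> Hom C (U \<odot> Q) S1"
      "l2 \<in> Hom C (Q \<odot> X) S2" "r2 \<in> Hom C (V \<odot> R) S2"
      "s \<in> Hom C (S1 \<odot> X) Z" "t \<in> Hom C (U \<odot> S2) Z" "n \<in> Hom C (P \<odot> R) Z"
begin

text \<open>The five squares are numbered (1) (uv)w = u(vw), (2) (vw)x = v(wx), (3) (u(vw))x =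
  u((vw)x), (4) ((uv)w)x = (uv)(wx), (5) (uv)(wx) = u(v(wx)). The edge lemmas rewrite (3), (4), (5)
  as equations between arrows with the common source ((UV)W)X.\<close>

lemma pentagon_edge3:
  assumes "assoc_square U Q X r1 s l2 t"
  shows "s \<cdot> ((r1 \<cdot> (Ide C U \<otimes> vw) \<cdot> Assoc C U V W) \<otimes> Ide C X)
    = t \<cdot> (Ide C U \<otimes> (l2 \<cdot> (vw \<otimes> Ide C X))) \<cdot> Assoc C U (V \<odot> W) X \<cdot> (Assoc C U V W \<otimes> Ide C X)"
proof -
  note [simp] = HomD[OF H(1)] HomD[OF H(2)] HomD[OF H(3)] HomD[OF H(4)] HomD[OF H(5)]
    HomD[OF H(6)] HomD[OF H(7)] HomD[OF H(8)] HomD[OF H(9)] HomD[OF H(10)]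
  have "s \<cdot> ((r1 \<cdot> (Ide C U \<otimes> vw) \<cdot> Assoc C U V W) \<otimes> Ide C X)
      = (s \<cdot> (r1 \<otimes> Ide C X)) \<cdot> ((Ide C U \<otimes> vw) \<otimes> Ide C X) \<cdot> (Assoc C U V W \<otimes> Ide C X)" by simp
  also have "\<dots> = t \<cdot> (Ide C U \<otimes> (l2 \<cdot> (vw \<otimes> Ide C X))) \<cdot> Assoc C U (V \<odot> W) X \<cdot> (Assoc C U V W \<otimes> Ide C X)"
    unfolding assoc_square_eq[OF assms] by (simp del: interchange interchange_ext) simp
  finally show ?thesis .
qed

lemma pentagon_edge4:
  assumes "assoc_square P W X l1 s wx n"
  shows "s \<cdot> ((l1 \<cdot> (uv \<otimes> Ide C W)) \<otimes> Ide C X) = n \<cdot> (uv \<otimes> wx) \<cdot> Assoc C (U \<odot> V) W X"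
proof -
  note [simp] = HomD[OF H(1)] HomD[OF H(2)] HomD[OF H(3)] HomD[OF H(4)] HomD[OF H(5)]
    HomD[OF H(6)] HomD[OF H(7)] HomD[OF H(8)] HomD[OF H(9)] HomD[OF H(10)]
  have "s \<cdot> ((l1 \<cdot> (uv \<otimes> Ide C W)) \<otimes> Ide C X)
      = (s \<cdot> (l1 \<otimes> Ide C X)) \<cdot> ((uv \<otimes> Ide C W) \<otimes> Ide C X)" by simp
  also have "\<dots> = n \<cdot> (uv \<otimes> wx) \<cdot> Assoc C (U \<odot> V) W X"
    unfolding assoc_square_eq[OF assms] by (simp del: interchange interchange_ext) simp
  finally show ?thesis .
qed

text \<open>The one edge that needs the pentagon axiom; for the other two naturality of the
  associator is enough.\<close>

lemma pentagon_edge5: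
  assumes "assoc_square U V R uv n r2 t"
  shows "n \<cdot> (uv \<otimes> wx) \<cdot> Assoc C (U \<odot> V) W X
    = t \<cdot> (Ide C U \<otimes> (r2 \<cdot> (Ide C V \<otimes> wx) \<cdot> Assoc C V W X))
      \<cdot> Assoc C U (V \<odot> W) X \<cdot> (Assoc C U V W \<otimes> Ide C X)"
proof -
  note [simp] = HomD[OF H(1)] HomD[OF H(2)] HomD[OF H(3)] HomD[OF H(4)] HomD[OF H(5)]
    HomD[OF H(6)] HomD[OF H(7)] HomD[OF H(8)] HomD[OF H(9)] HomD[OF H(10)]
  have "n \<cdot> (uv \<otimes> wx) \<cdot> Assoc C (U \<odot> V) W X
      = (n \<cdot> (uv \<otimes> Ide C R)) \<cdot> (Ide C (U \<odot> V) \<otimes> wx) \<cdot> Assoc C (U \<odot> V) W X" by simp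
  also have "\<dots> = t \<cdot> (Ide C U \<otimes> (r2 \<cdot> (Ide C V \<otimes> wx))) \<cdot> Assoc C U V (W \<odot> X) \<cdot> Assoc C (U \<odot> V) W X"
    unfolding assoc_square_eq[OF assms] by (simp del: interchange interchange_ext) simp
  also have "\<dots> = t \<cdot> (Ide C U \<otimes> (r2 \<cdot> (Ide C V \<otimes> wx))) \<cdot> (Ide C U \<otimes> Assoc C V W X)
      \<cdot> Assoc C U (V \<odot> W) X \<cdot> (Assoc C U V W \<otimes> Ide C X)"
    by (subst pentagon) simp_all
  finally show ?thesis by simp
qed

end

text \<open>As \<open>s\<close> need not be mono, square (1) comes out only under the outer product
  with \<open>x\<close>. This is the form in which a coequalizer tensored on the right asks for
  balancedness.\<close>

lemma pentagon1_weak: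
  assumes A2: "assoc_square V W X vw l2 wx r2" and A3: "assoc_square U Q X r1 s l2 t"
    and A4: "assoc_square P W X l1 s wx n" and A5: "assoc_square U V R uv n r2 t"
    and c: "Cod C uv = P" "Cod C vw = Q" "Cod C wx = R" "Cod C l1 = Cod C r1"
  shows "s \<cdot> ((l1 \<cdot> (uv \<otimes> Ide C W)) \<otimes> Ide C X) = s \<cdot> ((r1 \<cdot> (Ide C U \<otimes> vw) \<cdot> Assoc C U V W) \<otimes> Ide C X)"
proof -
  note [simp] = c assoc_squareD[OF A2] assoc_squareD[OF A3] assoc_squareD[OF A4] assoc_squareD[OF A5]
  have H: "uv \<in> Hom C (U \<odot> V) P" "vw \<in> Hom C (V \<odot> W) Q" "wx \<in> Hom C (W \<odot> X) R"
    "l1 \<in> Hom C (P \<odot> W) (Cod C r1)" "r1 \<in> Hom C (U \<odot> Q) (Cod C r1)"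
    "l2 \<in> Hom C (Q \<odot> X) (Cod C r2)" "r2 \<in> Hom C (V \<odot> R) (Cod C r2)"
    "s \<in> Hom C (Cod C r1 \<odot> X) (Cod C t)" "t \<in> Hom C (U \<odot> Cod C r2) (Cod C t)" "n \<in> Hom C (P \<odot> R) (Cod C t)"
    by (simp_all add: Hom_iff)
  note [simp] = HomD(5)[OF H(1)] HomD(5)[OF H(2)] HomD(5)[OF H(3)]
  show ?thesis
    using pentagon_edge3[OF _ _ _ _ H A3] pentagon_edge4[OF _ _ _ _ H A4] pentagon_edge5[OF _ _ _ _ H A5]
      assoc_square_eq[OF A2] by simp
qed

text \<open>The counterpart for a coequalizer tensored on the left. The two sides are compared after
  the isomorphism from ((UV)W)X to U((VW)X).\<close>

lemma pentagon2_weak: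
  assumes A1: "assoc_square U V W uv l1 vw r1" and A3: "assoc_square U Q X r1 s l2 t"
    and A4: "assoc_square P W X l1 s wx n" and A5: "assoc_square U V R uv n r2 t"
    and c: "Cod C uv = P" "Cod C vw = Q" "Cod C wx = R" "Cod C l2 = Cod C r2"
  shows "t \<cdot> (Ide C U \<otimes> (l2 \<cdot> (vw \<otimes> Ide C X))) = t \<cdot> (Ide C U \<otimes> (r2 \<cdot> (Ide C V \<otimes> wx) \<cdot> Assoc C V W X))"
proof -
  note [simp] = c assoc_squareD[OF A1] assoc_squareD[OF A3] assoc_squareD[OF A4] assoc_squareD[OF A5]
  have H: "uv \<in> Hom C (U \<odot> V) P" "vw \<in> Hom C (V \<odot> W) Q" "wx \<in> Hom C (W \<odot> X) R"
    "l1 \<in> Hom C (P \<odot> W) (Cod C r1)" "r1 \<in> Hom C (U \<odot> Q) (Cod C r1)"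
    "l2 \<in> Hom C (Q \<odot> X) (Cod C r2)" "r2 \<in> Hom C (V \<odot> R) (Cod C r2)"
    "s \<in> Hom C (Cod C r1 \<odot> X) (Cod C t)" "t \<in> Hom C (U \<odot> Cod C r2) (Cod C t)" "n \<in> Hom C (P \<odot> R) (Cod C t)"
    by (simp_all add: Hom_iff)
  note [simp] = HomD(5)[OF H(1)] HomD(5)[OF H(2)] HomD(5)[OF H(3)]
  have epi: "is_epi C (Assoc C U (V \<odot> W) X \<cdot> (Assoc C U V W \<otimes> Ide C X))"
    by (intro epi_comp iso_epi tensor_iso) simp_all
  show ?thesis
    by (rule epi_cancel[OF epi])
      (use pentagon_edge3[OF _ _ _ _ H A3] pentagon_edge4[OF _ _ _ _ H A4] pentagon_edge5[OF _ _ _ _ H A5]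
        assoc_square_eq[OF A1] in simp_all)
qed

text \<open>Square (3) has vw as a single factor, whereas the other edges start from V and W;
  \<open>e\<close> cancels the passage from V \<otimes> W to \<open>Q\<close>.\<close>

lemma pentagon3:
  assumes A1: "assoc_square U V W uv l1 vw r1" and A2: "assoc_square V W X vw l2 wx r2"
    and A4: "assoc_square P W X l1 s wx n" and A5: "assoc_square U V R uv n r2 t"
    and c: "Cod C uv = P" "Cod C vw = Q" "Cod C wx = R"
    and e: "is_epi C ((Ide C U \<otimes> vw) \<otimes> Ide C X)"
  shows "assoc_square U Q X r1 s l2 t"
proof -
  note [simp] = c assoc_squareD[OF A1] assoc_squareD[OF A2] assoc_squareD[OF A4] assoc_squareD[OF A5]
  have H: "uv \<in> Hom C (U \<odot> V) P" "vw \<in> Hom C (V \<odot> W) Q" "wx \<in> Hom C (W \<odot> X) R"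
    "l1 \<in> Hom C (P \<odot> W) (Cod C r1)" "r1 \<in> Hom C (U \<odot> Q) (Cod C r1)"
    "l2 \<in> Hom C (Q \<odot> X) (Cod C r2)" "r2 \<in> Hom C (V \<odot> R) (Cod C r2)"
    "s \<in> Hom C (Cod C r1 \<odot> X) (Cod C t)" "t \<in> Hom C (U \<odot> Cod C r2) (Cod C t)" "n \<in> Hom C (P \<odot> R) (Cod C t)"
    by (simp_all add: Hom_iff)
  note [simp] = HomD(5)[OF H(1)] HomD(5)[OF H(2)] HomD(5)[OF H(3)]
  have epi: "is_epi C (((Ide C U \<otimes> vw) \<otimes> Ide C X) \<cdot> (Assoc C U V W \<otimes> Ide C X))"
    by (intro epi_comp[OF _ e] iso_epi tensor_iso) simp_all
  have "s \<cdot> ((r1 \<cdot> (Ide C U \<otimes> vw) \<cdot> Assoc C U V W) \<otimes> Ide C X)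
      = t \<cdot> (Ide C U \<otimes> (l2 \<cdot> (vw \<otimes> Ide C X))) \<cdot> Assoc C U (V \<odot> W) X \<cdot> (Assoc C U V W \<otimes> Ide C X)"
    using pentagon_edge4[OF _ _ _ _ H A4] pentagon_edge5[OF _ _ _ _ H A5] assoc_square_eq[OF A1] assoc_square_eq[OF A2] by simp
  also have "\<dots> = t \<cdot> (Ide C U \<otimes> l2) \<cdot> (Ide C U \<otimes> (vw \<otimes> Ide C X)) \<cdot> Assoc C U (V \<odot> W) X
      \<cdot> (Assoc C U V W \<otimes> Ide C X)" by simp
  also have "\<dots> = t \<cdot> (Ide C U \<otimes> l2) \<cdot> Assoc C U Q X \<cdot> ((Ide C U \<otimes> vw) \<otimes> Ide C X) \<cdot> (Assoc C U V W \<otimes> Ide C X)"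
    by (subst Assoc_nat_ext) simp_all
  finally have "s \<cdot> (r1 \<otimes> Ide C X) = t \<cdot> (Ide C U \<otimes> l2) \<cdot> Assoc C U Q X"
    by - (rule epi_cancel[OF epi], simp_all del: Assoc_nat Assoc_nat_ext)
  then show ?thesis by (simp add: assoc_square_def)
qed

lemma pentagon4:
  assumes A1: "assoc_square U V W uv l1 vw r1" and A2: "assoc_square V W X vw l2 wx r2"
    and A3: "assoc_square U Q X r1 s l2 t" and A5: "assoc_square U V R uv n r2 t"
    and c: "Cod C uv = P" "Cod C vw = Q" "Cod C wx = R"
    and e: "is_epi C ((uv \<otimes> Ide C W) \<otimes> Ide C X)"
  shows "assoc_square P W X l1 s wx n"
proof -
  note [simp] = c assoc_squareD[OF A1] assoc_squareD[OF A2] assoc_squareD[OF A3] assoc_squareD[OF A5]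
  have H: "uv \<in> Hom C (U \<odot> V) P" "vw \<in> Hom C (V \<odot> W) Q" "wx \<in> Hom C (W \<odot> X) R"
    "l1 \<in> Hom C (P \<odot> W) (Cod C r1)" "r1 \<in> Hom C (U \<odot> Q) (Cod C r1)"
    "l2 \<in> Hom C (Q \<odot> X) (Cod C r2)" "r2 \<in> Hom C (V \<odot> R) (Cod C r2)"
    "s \<in> Hom C (Cod C r1 \<odot> X) (Cod C t)" "t \<in> Hom C (U \<odot> Cod C r2) (Cod C t)" "n \<in> Hom C (P \<odot> R) (Cod C t)"
    by (simp_all add: Hom_iff)
  note [simp] = HomD(5)[OF H(1)] HomD(5)[OF H(2)] HomD(5)[OF H(3)]
  have "s \<cdot> ((l1 \<cdot> (uv \<otimes> Ide C W)) \<otimes> Ide C X) = n \<cdot> (uv \<otimes> wx) \<cdot> Assoc C (U \<odot> V) W X"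
    using pentagon_edge3[OF _ _ _ _ H A3] pentagon_edge5[OF _ _ _ _ H A5] assoc_square_eq[OF A1] assoc_square_eq[OF A2] by simp
  also have "\<dots> = n \<cdot> (Ide C P \<otimes> wx) \<cdot> (uv \<otimes> (Ide C W \<otimes> Ide C X)) \<cdot> Assoc C (U \<odot> V) W X" by simp
  also have "\<dots> = n \<cdot> (Ide C P \<otimes> wx) \<cdot> Assoc C P W X \<cdot> ((uv \<otimes> Ide C W) \<otimes> Ide C X)"
    by (subst Assoc_nat) simp_all
  finally have "s \<cdot> (l1 \<otimes> Ide C X) = n \<cdot> (Ide C P \<otimes> wx) \<cdot> Assoc C P W X"
    by - (rule epi_cancel[OF e], simp_all del: Assoc_nat Assoc_nat_ext)
  then show ?thesis by (simp add: assoc_square_def)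
qed

text \<open>The pentagon axiom is applied directly: it replaces three associators by two, and the
  last of these together with \<open>Ide C (U \<odot> V) \<otimes> wx\<close> is the epimorphism to
  be cancelled.\<close>

lemma pentagon5:
  assumes A1: "assoc_square U V W uv l1 vw r1" and A2: "assoc_square V W X vw l2 wx r2"
    and A3: "assoc_square U Q X r1 s l2 t" and A4: "assoc_square P W X l1 s wx n"
    and c: "Cod C uv = P" "Cod C vw = Q" "Cod C wx = R"
    and e: "is_epi C (Ide C (U \<odot> V) \<otimes> wx)"
  shows "assoc_square U V R uv n r2 t"
proof -
  note [simp] = c assoc_squareD[OF A1] assoc_squareD[OF A2] assoc_squareD[OF A3] assoc_squareD[OF A4]
  have [simp]: "Cod C n = Cod C t" using assoc_squareD(12)[OF A3] assoc_squareD(12)[OF A4] by simp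
  have H: "uv \<in> Hom C (U \<odot> V) P" "vw \<in> Hom C (V \<odot> W) Q" "wx \<in> Hom C (W \<odot> X) R"
    "l1 \<in> Hom C (P \<odot> W) (Cod C r1)" "r1 \<in> Hom C (U \<odot> Q) (Cod C r1)"
    "l2 \<in> Hom C (Q \<odot> X) (Cod C r2)" "r2 \<in> Hom C (V \<odot> R) (Cod C r2)"
    "s \<in> Hom C (Cod C r1 \<odot> X) (Cod C t)" "t \<in> Hom C (U \<odot> Cod C r2) (Cod C t)" "n \<in> Hom C (P \<odot> R) (Cod C t)"
    by (simp_all add: Hom_iff)
  note [simp] = HomD(5)[OF H(1)] HomD(5)[OF H(2)] HomD(5)[OF H(3)]
  have epi: "is_epi C ((Ide C (U \<odot> V) \<otimes> wx) \<cdot> Assoc C (U \<odot> V) W X)"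
    by (intro epi_comp[OF _ e] iso_epi) simp_all
  have "n \<cdot> (uv \<otimes> wx) \<cdot> Assoc C (U \<odot> V) W X
    = t \<cdot> (Ide C U \<otimes> (r2 \<cdot> (Ide C V \<otimes> wx) \<cdot> Assoc C V W X))
      \<cdot> Assoc C U (V \<odot> W) X \<cdot> (Assoc C U V W \<otimes> Ide C X)"
    using pentagon_edge3[OF _ _ _ _ H A3] pentagon_edge4[OF _ _ _ _ H A4] assoc_square_eq[OF A1] assoc_square_eq[OF A2] by simp
  also have "\<dots> = t \<cdot> (Ide C U \<otimes> (r2 \<cdot> (Ide C V \<otimes> wx))) \<cdot> (Ide C U \<otimes> Assoc C V W X)
      \<cdot> Assoc C U (V \<odot> W) X \<cdot> (Assoc C U V W \<otimes> Ide C X)"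
    by simp
  also have "\<dots> = t \<cdot> (Ide C U \<otimes> (r2 \<cdot> (Ide C V \<otimes> wx))) \<cdot> Assoc C U V (W \<odot> X) \<cdot> Assoc C (U \<odot> V) W X"
    by (subst pentagon) simp_all
  finally have "n \<cdot> (uv \<otimes> Ide C R) = t \<cdot> (Ide C U \<otimes> r2) \<cdot> Assoc C U V R"
    by - (rule epi_cancel[OF epi], simp_all)
  then show ?thesis by (simp add: assoc_square_def)
qed

end

section \<open>Tensor products of coequalizers, epimorphisms and zero morphisms\<close>

context abelian_monoidal_category
begin

text \<open>Additivity carries the difference of \<open>f\<close> and \<open>g\<close> to the
  difference of the tensored arrows, and right exactness preserves its cokernel.\<close>

lemma tensor_coequalizer:
  assumes q: "is_coequalizer C f g q" and X: "X \<in> Obj C"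
  shows "is_coequalizer C (Ide C X \<otimes> f) (Ide C X \<otimes> g) (Ide C X \<otimes> q)"
    "is_coequalizer C (f \<otimes> Ide C X) (g \<otimes> Ide C X) (q \<otimes> Ide C X)"
proof -
  define a b where "a = Dom C g" and "b = Cod C g"
  have f: "f \<in> Hom C a b" and g: "g \<in> Hom C a b"
    using q by (auto simp: is_coequalizer_def Hom_iff a_def b_def)
  obtain d where d: "d \<in> Hom C a b" "d \<oplus> g = f" by (rule sub_ex[OF f g])
  note [simp] = X HomD[OF f] HomD[OF g] HomD[OF d(1)]
  have k: "is_cokernel C d q" using coequalizer_cokernel[OF f g d] q by simp
  have L: "Ide C X \<otimes> d \<oplus> Ide C X \<otimes> g = Ide C X \<otimes> f"
    using left_additive[OF X] d g unfolding additive_functor_def by metis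
  have R: "d \<otimes> Ide C X \<oplus> g \<otimes> Ide C X = f \<otimes> Ide C X"
    using right_additive[OF X] d g unfolding additive_functor_def by metis
  show "is_coequalizer C (Ide C X \<otimes> f) (Ide C X \<otimes> g) (Ide C X \<otimes> q)"
    using coequalizer_cokernel[of "Ide C X \<otimes> f" "X \<odot> a" "X \<odot> b" "Ide C X \<otimes> g" "Ide C X \<otimes> d"] L
      left_right_exact[OF X] k by (simp add: Hom_iff right_exact_def)
  show "is_coequalizer C (f \<otimes> Ide C X) (g \<otimes> Ide C X) (q \<otimes> Ide C X)"
    using coequalizer_cokernel[of "f \<otimes> Ide C X" "a \<odot> X" "b \<odot> X" "g \<otimes> Ide C X" "d \<otimes> Ide C X"] R
      right_right_exact[OF X] k by (simp add: Hom_iff right_exact_def)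
qed

text \<open>Epimorphisms are cokernels here, so right exactness preserves them in each variable;
  \<open>e \<otimes> f\<close> is a composite of the two one-sided cases.\<close>

lemma tensor_epi:
  assumes e: "is_epi C e" and f: "is_epi C f"
  shows "is_epi C (e \<otimes> f)"
proof -
  note [simp] = epi_arr[OF e] epi_arr[OF f]
  obtain a b where ab: "is_cokernel C a e" "is_cokernel C b f"
    using epi_is_cokernel[OF e] epi_is_cokernel[OF f] by blast
  have "is_cokernel C (a \<otimes> Ide C (Dom C f)) (e \<otimes> Ide C (Dom C f))"
    using right_right_exact[of "Dom C f"] ab by (simp add: right_exact_def)
  moreover have "is_cokernel C (Ide C (Cod C e) \<otimes> b) (Ide C (Cod C e) \<otimes> f)"
    using left_right_exact[of "Cod C e"] ab by (simp add: right_exact_def)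
  ultimately have "is_epi C ((Ide C (Cod C e) \<otimes> f) \<cdot> (e \<otimes> Ide C (Dom C f)))"
    by (intro epi_comp cokernel_epi) simp_all
  then show ?thesis by simp
qed

lemma tensor_Zer [simp]:
  assumes [simp]: "X \<in> Obj C" "a \<in> Obj C" "b \<in> Obj C"
  shows "Ide C X \<otimes> Zer C a b = Zer C (X \<odot> a) (X \<odot> b)" "Zer C a b \<otimes> Ide C X = Zer C (a \<odot> X) (b \<odot> X)"
proof -
  have z: "Zer C a b \<in> Hom C a b" by (rule Zer_Hom) simp_all
  have "Ide C X \<otimes> (Zer C a b \<oplus> Zer C a b) = Ide C X \<otimes> Zer C a b \<oplus> Ide C X \<otimes> Zer C a b"
    "(Zer C a b \<oplus> Zer C a b) \<otimes> Ide C X = Zer C a b \<otimes> Ide C X \<oplus> Zer C a b \<otimes> Ide C X"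
    using left_additive[of X] right_additive[of X] z unfolding additive_functor_def by auto
  moreover have "Zer C a b \<oplus> Zer C a b = Zer C a b" by (rule Zer_Add[OF z])
  ultimately show "Ide C X \<otimes> Zer C a b = Zer C (X \<odot> a) (X \<odot> b)" "Zer C a b \<otimes> Ide C X = Zer C (a \<odot> X) (b \<odot> X)"
    using sub_eq_zero[of "Ide C X \<otimes> Zer C a b" "X \<odot> a" "X \<odot> b" "Ide C X \<otimes> Zer C a b"]
      sub_eq_zero[of "Zer C a b \<otimes> Ide C X" "a \<odot> X" "b \<odot> X" "Zer C a b \<otimes> Ide C X"] by (simp_all add: Hom_iff)
qed

lemma Zer_tensor [simp]:
  assumes [simp]: "a \<in> Obj C" "b \<in> Obj C" "f \<in> Arr C"
  shows "Zer C a b \<otimes> f = Zer C (a \<odot> Dom C f) (b \<odot> Cod C f)" "f \<otimes> Zer C a b = Zer C (Dom C f \<odot> a) (Cod C f \<odot> b)"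
proof -
  have "Zer C a b \<otimes> f = (Zer C a b \<otimes> Ide C (Cod C f)) \<cdot> (Ide C a \<otimes> f)" by (subst interchange) simp_all
  also have "\<dots> = Zer C (a \<odot> Dom C f) (b \<odot> Cod C f)" by (subst tensor_Zer) simp_all
  finally show "Zer C a b \<otimes> f = Zer C (a \<odot> Dom C f) (b \<odot> Cod C f)" .
  have "f \<otimes> Zer C a b = (Ide C (Cod C f) \<otimes> Zer C a b) \<cdot> (f \<otimes> Ide C a)" by (subst interchange) simp_all
  also have "\<dots> = Zer C (Dom C f \<odot> a) (Cod C f \<odot> b)" by (subst tensor_Zer) simp_all
  finally show "f \<otimes> Zer C a b = Zer C (Dom C f \<odot> a) (Cod C f \<odot> b)" .
qed

end

section \<open>Bimodules over an algebra\<close>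

locale algebra_in_category = abelian_monoidal_category C
  for C :: "('o, 'm, 'z) moncat_scheme" (structure) +
  fixes D :: "('o, 'm) alg"
  assumes algebra: "algebra C D"
begin

lemma algebra_simps' [simp]:
  shows "aobj D \<in> Obj C" "amult D \<in> Arr C" "Dom C (amult D) = aobj D \<odot> aobj D" "Cod C (amult D) = aobj D"
    "aunit D \<in> Arr C" "Dom C (aunit D) = One C" "Cod C (aunit D) = aobj D"
    "amult D \<cdot> (aunit D \<otimes> Ide C (aobj D)) = LUni C (aobj D)"
    "amult D \<cdot> (Ide C (aobj D) \<otimes> aunit D) = RUni C (aobj D)"
  using algebra by (auto simp: algebra_def Hom_iff)

lemma amult_assoc:
  "assoc_square (aobj D) (aobj D) (aobj D) (amult D) (amult D) (amult D) (amult D)"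
  using algebra by (auto simp: algebra_def assoc_square_def)

definition bimodule :: "('o, 'm) bimod \<Rightarrow> bool"
  where "bimodule V \<longleftrightarrow> bobj V \<in> Obj C \<and>
    lact V \<in> Hom C (aobj D \<odot> bobj V) (bobj V) \<and> ract V \<in> Hom C (bobj V \<odot> aobj D) (bobj V) \<and>
    assoc_square (aobj D) (aobj D) (bobj V) (amult D) (lact V) (lact V) (lact V) \<and>
    assoc_square (aobj D) (bobj V) (aobj D) (lact V) (ract V) (ract V) (lact V) \<and>
    assoc_square (bobj V) (aobj D) (aobj D) (ract V) (ract V) (amult D) (ract V) \<and>
    lact V \<cdot> (aunit D \<otimes> Ide C (bobj V)) = LUni C (bobj V) \<and>
    ract V \<cdot> (Ide C (bobj V) \<otimes> aunit D) = RUni C (bobj V)"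

lemma bimodule_simps:
  assumes "bimodule V"
  shows "bobj V \<in> Obj C"
    "lact V \<in> Arr C" "Dom C (lact V) = aobj D \<odot> bobj V" "Cod C (lact V) = bobj V"
    "ract V \<in> Arr C" "Dom C (ract V) = bobj V \<odot> aobj D" "Cod C (ract V) = bobj V"
    "lact V \<cdot> (aunit D \<otimes> Ide C (bobj V)) = LUni C (bobj V)"
    "ract V \<cdot> (Ide C (bobj V) \<otimes> aunit D) = RUni C (bobj V)"
  using assms by (auto simp: bimodule_def Hom_iff)

lemma bimodule_squares:
  assumes "bimodule V"
  shows "assoc_square (aobj D) (aobj D) (bobj V) (amult D) (lact V) (lact V) (lact V)"
    "assoc_square (aobj D) (bobj V) (aobj D) (lact V) (ract V) (ract V) (lact V)"
    "assoc_square (bobj V) (aobj D) (aobj D) (ract V) (ract V) (amult D) (ract V)"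
  using assms by (auto simp: bimodule_def)

text \<open>The unit law factors the isomorphism \<open>LUni\<close> through the action.\<close>

lemma lact_epi:
  assumes "bimodule V" shows "is_epi C (lact V)"
proof -
  note [simp] = bimodule_simps[OF assms]
  have "is_epi C (lact V \<cdot> (aunit D \<otimes> Ide C (bobj V)))" by (simp add: iso_epi)
  then show ?thesis by (rule epi_of_comp) simp_all
qed

lemma ract_epi:
  assumes "bimodule V" shows "is_epi C (ract V)"
proof -
  note [simp] = bimodule_simps[OF assms]
  have "is_epi C (ract V \<cdot> (Ide C (bobj V) \<otimes> aunit D))" by (simp add: iso_epi)
  then show ?thesis by (rule epi_of_comp) simp_all
qed

lemma regular_simps [simp]:
  "bobj (regular_bimod D) = aobj D" "lact (regular_bimod D) = amult D" "ract (regular_bimod D) = amult D"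
  by (simp_all add: regular_bimod_def)

lemma regular_bimodule: "bimodule (regular_bimod D)"
  unfolding bimodule_def using amult_assoc by (simp add: Hom_iff)


subsection \<open>The balanced tensor product\<close>

abbreviation bal (infixl "\<boxtimes>" 75) where "V \<boxtimes> W \<equiv> bal_tensor C D V W"

abbreviation pr where "pr V W \<equiv> bal_proj C D V W"

lemma bobj_bal: "bobj (V \<boxtimes> W) = Cod C (pr V W)"
  by (simp add: bal_tensor_def Let_def)

lemma lact_bal_The:
  "lact (V \<boxtimes> W) = (THE l. l \<in> Hom C (aobj D \<odot> bobj (V \<boxtimes> W)) (bobj (V \<boxtimes> W)) \<and>
    l \<cdot> (Ide C (aobj D) \<otimes> pr V W) =
      pr V W \<cdot> (lact V \<otimes> Ide C (bobj W)) \<cdot> inverse_arr C (Assoc C (aobj D) (bobj V) (bobj W)))"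
  by (simp add: bal_tensor_def Let_def)

lemma ract_bal_The:
  "ract (V \<boxtimes> W) = (THE r. r \<in> Hom C (bobj (V \<boxtimes> W) \<odot> aobj D) (bobj (V \<boxtimes> W)) \<and>
    r \<cdot> (pr V W \<otimes> Ide C (aobj D)) =
      pr V W \<cdot> (Ide C (bobj V) \<otimes> ract W) \<cdot> Assoc C (bobj V) (bobj W) (aobj D))"
  by (simp add: bal_tensor_def Let_def)

context
  fixes V W
  assumes V: "bimodule V" and W: "bimodule W"
begin

lemmas VW = bimodule_simps[OF V] bimodule_simps[OF W]

lemma pr_coequalizer:
  "is_coequalizer C (ract V \<otimes> Ide C (bobj W))
    ((Ide C (bobj V) \<otimes> lact W) \<cdot> Assoc C (bobj V) (aobj D) (bobj W)) (pr V W)"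
proof -
  note [simp] = VW
  show ?thesis
    unfolding bal_proj_def
    by (rule someI_ex, rule coequalizer_exists[of _ "(bobj V \<odot> aobj D) \<odot> bobj W" "bobj V \<odot> bobj W"])
      (simp_all add: Hom_iff)
qed

lemma pr_Hom: "pr V W \<in> Hom C (bobj V \<odot> bobj W) (bobj (V \<boxtimes> W))"
proof -
  note [simp] = VW
  show ?thesis
    using pr_coequalizer by (auto simp: is_coequalizer_def Hom_iff bobj_bal)
qed

lemma pr_epi: "is_epi C (pr V W)"
  by (rule coequalizer_epi[OF pr_coequalizer])

text \<open>The coequalizer condition (vd)w = v(dw), put as an associativity square whose two outer
  products are both \<open>pr V W\<close>, so that it can enter the pentagon lemmas.\<close>

lemma pr_balanced:
  "assoc_square (bobj V) (aobj D) (bobj W) (ract V) (pr V W) (lact W) (pr V W)"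
  using pr_coequalizer VW HomD[OF pr_Hom] by (auto simp: is_coequalizer_def assoc_square_def)

lemma bal_factor:
  assumes h: "h \<in> Hom C (bobj V \<odot> bobj W) Z"
    and b: "assoc_square (bobj V) (aobj D) (bobj W) (ract V) h (lact W) h"
  shows "\<exists>!e. e \<in> Hom C (bobj (V \<boxtimes> W)) Z \<and> e \<cdot> pr V W = h"
proof -
  note [simp] = VW HomD[OF h] HomD[OF pr_Hom]
  show ?thesis
    unfolding bobj_bal
    by (rule coequalizer_factor[OF pr_coequalizer]) (use h assoc_square_eq[OF b] in simp_all)
qed

text \<open>\<open>Ide C X \<otimes> pr V W\<close> is again a coequalizer, which makes descent
  available with a further factor on the left.\<close>

lemma tensor_pr_factor:
  assumes X: "X \<in> Obj C" and h: "h \<in> Hom C (X \<odot> (bobj V \<odot> bobj W)) Z"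
    and b: "h \<cdot> (Ide C X \<otimes> (ract V \<otimes> Ide C (bobj W)))
      = h \<cdot> (Ide C X \<otimes> ((Ide C (bobj V) \<otimes> lact W) \<cdot> Assoc C (bobj V) (aobj D) (bobj W)))"
  shows "\<exists>!e. e \<in> Hom C (X \<odot> bobj (V \<boxtimes> W)) Z \<and> e \<cdot> (Ide C X \<otimes> pr V W) = h"
proof -
  note [simp] = VW HomD[OF h] X HomD[OF pr_Hom]
  show ?thesis
    using coequalizer_factor[OF tensor_coequalizer(1)[OF pr_coequalizer X], of h Z] h b by simp
qed

lemma pr_tensor_factor:
  assumes X: "X \<in> Obj C" and h: "h \<in> Hom C ((bobj V \<odot> bobj W) \<odot> X) Z"
    and b: "h \<cdot> ((ract V \<otimes> Ide C (bobj W)) \<otimes> Ide C X)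
      = h \<cdot> (((Ide C (bobj V) \<otimes> lact W) \<cdot> Assoc C (bobj V) (aobj D) (bobj W)) \<otimes> Ide C X)"
  shows "\<exists>!e. e \<in> Hom C (bobj (V \<boxtimes> W) \<odot> X) Z \<and> e \<cdot> (pr V W \<otimes> Ide C X) = h"
proof -
  note [simp] = VW HomD[OF h] X HomD[OF pr_Hom]
  show ?thesis
    using coequalizer_factor[OF tensor_coequalizer(2)[OF pr_coequalizer X], of h Z] h b by simp
qed

lemma lact_bal:
  "lact (V \<boxtimes> W) \<in> Hom C (aobj D \<odot> bobj (V \<boxtimes> W)) (bobj (V \<boxtimes> W))"
  "assoc_square (aobj D) (bobj V) (bobj W) (lact V) (pr V W) (pr V W) (lact (V \<boxtimes> W))"
proof -
  note [simp] = VW HomD[OF pr_Hom]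
  let ?D = "aobj D" and ?V = "bobj V" and ?W = "bobj W"
  let ?h = "pr V W \<cdot> (lact V \<otimes> Ide C ?W) \<cdot> inverse_arr C (Assoc C ?D ?V ?W)"
  have h: "?h \<in> Hom C (?D \<odot> (?V \<odot> ?W)) (bobj (V \<boxtimes> W))" by (simp add: Hom_iff)
  \<comment> \<open>The identity of \<open>?V \<odot> ?W\<close> stands for the product of V and W
    before balancing, so that \<open>?h\<close> becomes an outer product. The pentagon for the
    factors D, V, D, W then says that \<open>?h\<close> respects balancing.\<close>
  have sq: "assoc_square ?D ?V ?W (lact V) (pr V W) (Ide C (?V \<odot> ?W)) ?h"
    by (simp add: assoc_square_def)
  have "?h \<cdot> (Ide C ?D \<otimes> (Ide C (?V \<odot> ?W) \<cdot> (ract V \<otimes> Ide C ?W)))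
      = ?h \<cdot> (Ide C ?D \<otimes> (Ide C (?V \<odot> ?W) \<cdot> (Ide C ?V \<otimes> lact W) \<cdot> Assoc C ?V ?D ?W))"
    by (rule pentagon2_weak[OF bimodule_squares(2)[OF V] sq pr_balanced sq])
      (simp_all add: Hom_iff)
  then have b: "?h \<cdot> (Ide C ?D \<otimes> (ract V \<otimes> Ide C ?W)) = ?h \<cdot> (Ide C ?D \<otimes> ((Ide C ?V \<otimes> lact W) \<cdot> Assoc C ?V ?D ?W))"
    by simp
  have l: "lact (V \<boxtimes> W) \<in> Hom C (?D \<odot> bobj (V \<boxtimes> W)) (bobj (V \<boxtimes> W)) \<and> lact (V \<boxtimes> W) \<cdot> (Ide C ?D \<otimes> pr V W) = ?h"
    using theI'[OF tensor_pr_factor[OF _ h b]] unfolding lact_bal_The by simp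
  then show "lact (V \<boxtimes> W) \<in> Hom C (?D \<odot> bobj (V \<boxtimes> W)) (bobj (V \<boxtimes> W))" by simp
  note [simp] = HomD[OF this]
  have "lact (V \<boxtimes> W) \<cdot> (Ide C ?D \<otimes> pr V W) \<cdot> Assoc C ?D ?V ?W = (lact (V \<boxtimes> W) \<cdot> (Ide C ?D \<otimes> pr V W)) \<cdot> Assoc C ?D ?V ?W"
    by simp
  also have "\<dots> = pr V W \<cdot> (lact V \<otimes> Ide C ?W)" using l by simp
  finally show "assoc_square ?D ?V ?W (lact V) (pr V W) (pr V W) (lact (V \<boxtimes> W))"
    by (simp add: assoc_square_def)
qed

lemma ract_bal:
  "ract (V \<boxtimes> W) \<in> Hom C (bobj (V \<boxtimes> W) \<odot> aobj D) (bobj (V \<boxtimes> W))"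
  "assoc_square (bobj V) (bobj W) (aobj D) (pr V W) (ract (V \<boxtimes> W)) (ract W) (pr V W)"
proof -
  note [simp] = VW HomD[OF pr_Hom]
  let ?D = "aobj D" and ?V = "bobj V" and ?W = "bobj W"
  let ?h = "pr V W \<cdot> (Ide C ?V \<otimes> ract W) \<cdot> Assoc C ?V ?W ?D"
  have h: "?h \<in> Hom C ((?V \<odot> ?W) \<odot> ?D) (bobj (V \<boxtimes> W))" by (simp add: Hom_iff)
  \<comment> \<open>The same device, for the factors V, D, W, D.\<close>
  have sq: "assoc_square ?V ?W ?D (Ide C (?V \<odot> ?W)) ?h (ract W) (pr V W)"
    by (simp add: assoc_square_def)
  have "?h \<cdot> ((Ide C (?V \<odot> ?W) \<cdot> (ract V \<otimes> Ide C ?W)) \<otimes> Ide C ?D)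
      = ?h \<cdot> ((Ide C (?V \<odot> ?W) \<cdot> (Ide C ?V \<otimes> lact W) \<cdot> Assoc C ?V ?D ?W) \<otimes> Ide C ?D)"
    by (rule pentagon1_weak[OF bimodule_squares(2)[OF W] sq sq pr_balanced])
      (simp_all add: Hom_iff)
  then have b: "?h \<cdot> ((ract V \<otimes> Ide C ?W) \<otimes> Ide C ?D) = ?h \<cdot> (((Ide C ?V \<otimes> lact W) \<cdot> Assoc C ?V ?D ?W) \<otimes> Ide C ?D)"
    by simp
  have l: "ract (V \<boxtimes> W) \<in> Hom C (bobj (V \<boxtimes> W) \<odot> ?D) (bobj (V \<boxtimes> W)) \<and> ract (V \<boxtimes> W) \<cdot> (pr V W \<otimes> Ide C ?D) = ?h"
    using theI'[OF pr_tensor_factor[OF _ h b]] unfolding ract_bal_The by simp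
  then show "ract (V \<boxtimes> W) \<in> Hom C (bobj (V \<boxtimes> W) \<odot> ?D) (bobj (V \<boxtimes> W))" by simp
  note [simp] = HomD[OF this]
  show "assoc_square ?V ?W ?D (pr V W) (ract (V \<boxtimes> W)) (ract W) (pr V W)"
    using l by (simp add: assoc_square_def)
qed

lemma bimodule_bal: "bimodule (V \<boxtimes> W)"
proof -
  note [simp] = VW HomD[OF pr_Hom] HomD[OF lact_bal(1)] HomD[OF ract_bal(1)]
  let ?D = "aobj D" and ?V = "bobj V" and ?W = "bobj W" and ?q = "pr V W" and ?Q = "bobj (V \<boxtimes> W)"
    and ?l = "lact (V \<boxtimes> W)" and ?r = "ract (V \<boxtimes> W)"
  \<comment> \<open>The three action laws are the missing squares in the pentagons for D, D, V, W,
    then D, V, W, D, then V, W, D, D.\<close>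
  have 1: "assoc_square ?D ?D ?Q (amult D) ?l ?l ?l"
    by (rule pentagon5[OF bimodule_squares(1)[OF V] lact_bal(2) lact_bal(2) lact_bal(2)])
      (auto simp: Hom_iff intro!: tensor_epi pr_epi Ide_epi)
  have 2: "assoc_square ?D ?Q ?D ?l ?r ?r ?l"
    by (rule pentagon3[OF lact_bal(2) ract_bal(2) ract_bal(2) lact_bal(2)])
      (auto simp: Hom_iff intro!: tensor_epi pr_epi Ide_epi)
  have 3: "assoc_square ?Q ?D ?D ?r ?r (amult D) ?r"
    by (rule pentagon4[OF ract_bal(2) bimodule_squares(3)[OF W] ract_bal(2) ract_bal(2)])
      (auto simp: Hom_iff intro!: tensor_epi pr_epi Ide_epi)
  \<comment> \<open>For the unit laws, D acts on one factor of V \<otimes> W only;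
    \<open>LUni_tensor\<close> and \<open>RUni_tensor\<close> identify the unit constraint of that
    factor with the one of the product.\<close>
  let ?I = "One C"
  have e4: "is_epi C ((Ide C ?I \<otimes> ?q) \<cdot> Assoc C ?I ?V ?W)"
    by (intro epi_comp tensor_epi pr_epi Ide_epi iso_epi) simp_all
  have "?l \<cdot> (aunit D \<otimes> Ide C ?Q) \<cdot> (Ide C ?I \<otimes> ?q) \<cdot> Assoc C ?I ?V ?W
      = ?l \<cdot> (Ide C ?D \<otimes> ?q) \<cdot> (aunit D \<otimes> (Ide C ?V \<otimes> Ide C ?W)) \<cdot> Assoc C ?I ?V ?W" by simp
  also have "\<dots> = ?l \<cdot> (Ide C ?D \<otimes> ?q) \<cdot> Assoc C ?D ?V ?W \<cdot> ((aunit D \<otimes> Ide C ?V) \<otimes> Ide C ?W)"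
    by (subst Assoc_nat) simp_all
  also have "\<dots> = (?l \<cdot> (Ide C ?D \<otimes> ?q) \<cdot> Assoc C ?D ?V ?W) \<cdot> ((aunit D \<otimes> Ide C ?V) \<otimes> Ide C ?W)"
    by (simp del: Assoc_nat Assoc_nat_ext)
  also have "\<dots> = ?q \<cdot> (LUni C ?V \<otimes> Ide C ?W)"
    unfolding assoc_square_eq[OF lact_bal(2), symmetric] by simp
  also have "\<dots> = ?q \<cdot> LUni C (?V \<odot> ?W) \<cdot> Assoc C ?I ?V ?W" by (subst LUni_tensor) simp_all
  also have "\<dots> = (LUni C ?Q \<cdot> (Ide C ?I \<otimes> ?q)) \<cdot> Assoc C ?I ?V ?W" by simp
  finally have 4: "?l \<cdot> (aunit D \<otimes> Ide C ?Q) = LUni C ?Q"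
    by - (rule epi_cancel[OF e4], simp_all)
  have e5: "is_epi C (?q \<otimes> Ide C ?I)"
    by (intro tensor_epi pr_epi Ide_epi) simp_all
  have "?r \<cdot> (Ide C ?Q \<otimes> aunit D) \<cdot> (?q \<otimes> Ide C ?I) = (?r \<cdot> (?q \<otimes> Ide C ?D)) \<cdot> (Ide C (?V \<odot> ?W) \<otimes> aunit D)"
    by simp
  also have "\<dots> = ?q \<cdot> (Ide C ?V \<otimes> RUni C ?W) \<cdot> Assoc C ?V ?W ?I"
    unfolding assoc_square_eq[OF ract_bal(2)] by (simp del: interchange interchange_ext) simp
  also have "\<dots> = RUni C ?Q \<cdot> (?q \<otimes> Ide C ?I)" by (subst RUni_tensor) simp_all
  finally have 5: "?r \<cdot> (Ide C ?Q \<otimes> aunit D) = RUni C ?Q"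
    by - (rule epi_cancel[OF e5], simp_all)
  show ?thesis unfolding bimodule_def using 1 2 3 4 5 by (simp add: Hom_iff)
qed

end

definition right_linear :: "('o, 'm) bimod \<Rightarrow> ('o, 'm) bimod \<Rightarrow> 'm \<Rightarrow> bool"
  where "right_linear V W f \<longleftrightarrow> f \<in> Hom C (bobj V) (bobj W) \<and>
    f \<cdot> ract V = ract W \<cdot> (f \<otimes> Ide C (aobj D))"

definition left_linear :: "('o, 'm) bimod \<Rightarrow> ('o, 'm) bimod \<Rightarrow> 'm \<Rightarrow> bool"
  where "left_linear V W f \<longleftrightarrow> f \<in> Hom C (bobj V) (bobj W) \<and>
    f \<cdot> lact V = lact W \<cdot> (Ide C (aobj D) \<otimes> f)"

lemma Ide_linear:
  assumes "bimodule V"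
  shows "right_linear V V (Ide C (bobj V))" "left_linear V V (Ide C (bobj V))"
  using bimodule_simps[OF assms] by (simp_all add: right_linear_def left_linear_def Hom_iff)

lemma right_linear_comp:
  assumes "right_linear U V f" "right_linear V W g" and b: "bimodule U" "bimodule V" "bimodule W"
  shows "right_linear U W (g \<cdot> f)"
proof -
  have [simp]: "f \<in> Arr C" "Dom C f = bobj U" "Cod C f = bobj V" "g \<in> Arr C" "Dom C g = bobj V" "Cod C g = bobj W"
    and f: "f \<cdot> ract U = ract V \<cdot> (f \<otimes> Ide C (aobj D))" and g: "g \<cdot> ract V = ract W \<cdot> (g \<otimes> Ide C (aobj D))"
    using assms by (auto simp: right_linear_def Hom_iff)
  note [simp] = b[THEN bimodule_simps(1)] b[THEN bimodule_simps(5)] b[THEN bimodule_simps(6)] b[THEN bimodule_simps(7)]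
  have "(g \<cdot> f) \<cdot> ract U = (g \<cdot> ract V) \<cdot> (f \<otimes> Ide C (aobj D))" by (simp add: f)
  then show ?thesis by (simp add: g right_linear_def Hom_iff)
qed

text \<open>Only the inner actions are balanced, so descent asks for right linearity of
  \<open>f\<close> and left linearity of \<open>g\<close>.\<close>

lemma bal_arr:
  assumes b: "bimodule V" "bimodule W" "bimodule V'" "bimodule W'"
    and f: "right_linear V V' f" and g: "left_linear W W' g"
  shows "bal_tensor_arr C D V W V' W' f g \<in> Hom C (bobj (V \<boxtimes> W)) (bobj (V' \<boxtimes> W'))"
    "bal_tensor_arr C D V W V' W' f g \<cdot> pr V W = pr V' W' \<cdot> (f \<otimes> g)"
proof -
  note [simp] = bimodule_simps[OF b(1)] bimodule_simps[OF b(2)] bimodule_simps[OF b(3)] bimodule_simps[OF b(4)]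
    HomD[OF pr_Hom[OF b(1,2)]] HomD[OF pr_Hom[OF b(3,4)]]
  have [simp]: "f \<in> Arr C" "Dom C f = bobj V" "Cod C f = bobj V'" "g \<in> Arr C" "Dom C g = bobj W" "Cod C g = bobj W'"
    and f': "f \<cdot> ract V = ract V' \<cdot> (f \<otimes> Ide C (aobj D))" and g': "g \<cdot> lact W = lact W' \<cdot> (Ide C (aobj D) \<otimes> g)"
    using f g by (auto simp: right_linear_def left_linear_def Hom_iff)
  let ?h = "pr V' W' \<cdot> (f \<otimes> g)"
  have h: "?h \<in> Hom C (bobj V \<odot> bobj W) (bobj (V' \<boxtimes> W'))" by (simp add: Hom_iff)
  have "?h \<cdot> (ract V \<otimes> Ide C (bobj W)) = (pr V' W' \<cdot> (ract V' \<otimes> Ide C (bobj W'))) \<cdot> ((f \<otimes> Ide C (aobj D)) \<otimes> g)"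
    by (simp add: f')
  also have "\<dots> = pr V' W' \<cdot> (f \<otimes> (g \<cdot> lact W)) \<cdot> Assoc C (bobj V) (aobj D) (bobj W)"
    unfolding assoc_square_eq[OF pr_balanced[OF b(3,4)]] g' by (simp del: interchange interchange_ext) simp
  finally have "assoc_square (bobj V) (aobj D) (bobj W) (ract V) ?h (lact W) ?h"
    by (simp add: assoc_square_def)
  from theI'[OF bal_factor[OF b(1,2) h this]]
  show "bal_tensor_arr C D V W V' W' f g \<in> Hom C (bobj (V \<boxtimes> W)) (bobj (V' \<boxtimes> W'))"
    "bal_tensor_arr C D V W V' W' f g \<cdot> pr V W = pr V' W' \<cdot> (f \<otimes> g)"
    by (simp_all add: bal_tensor_arr_def)
qed

text \<open>The outer right action comes from the second factor, hence the extra hypothesis on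
  \<open>g\<close>. The result can serve as first factor of the next balanced product, as
  left-bracketed powers require.\<close>

lemma bal_arr_right_linear:
  assumes b: "bimodule V" "bimodule W" "bimodule V'" "bimodule W'"
    and f: "right_linear V V' f" and g: "left_linear W W' g" and gr: "right_linear W W' g"
  shows "right_linear (V \<boxtimes> W) (V' \<boxtimes> W') (bal_tensor_arr C D V W V' W' f g)"
proof -
  note [simp] = bimodule_simps[OF b(1)] bimodule_simps[OF b(2)] bimodule_simps[OF b(3)] bimodule_simps[OF b(4)]
    bimodule_simps[OF bimodule_bal[OF b(1,2)]] bimodule_simps[OF bimodule_bal[OF b(3,4)]]
    HomD[OF pr_Hom[OF b(1,2)]] HomD[OF pr_Hom[OF b(3,4)]] HomD[OF bal_arr(1)[OF b f g]]
  have [simp]: "f \<in> Arr C" "Dom C f = bobj V" "Cod C f = bobj V'" "g \<in> Arr C" "Dom C g = bobj W" "Cod C g = bobj W'"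
    and g': "g \<cdot> ract W = ract W' \<cdot> (g \<otimes> Ide C (aobj D))"
    using f gr by (auto simp: right_linear_def left_linear_def Hom_iff)
  let ?h = "bal_tensor_arr C D V W V' W' f g" and ?D = "aobj D"
  note hq = bal_arr(2)[OF b f g]
  have e: "is_epi C (pr V W \<otimes> Ide C ?D)" by (intro tensor_epi pr_epi Ide_epi b) simp
  have "(?h \<cdot> ract (V \<boxtimes> W)) \<cdot> (pr V W \<otimes> Ide C ?D) = ?h \<cdot> (ract (V \<boxtimes> W) \<cdot> (pr V W \<otimes> Ide C ?D))" by simp
  also have "\<dots> = (?h \<cdot> pr V W) \<cdot> (Ide C (bobj V) \<otimes> ract W) \<cdot> Assoc C (bobj V) (bobj W) ?D"
    unfolding assoc_square_eq[OF ract_bal(2)[OF b(1,2)]] by simp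
  also have "\<dots> = pr V' W' \<cdot> (f \<otimes> (g \<cdot> ract W)) \<cdot> Assoc C (bobj V) (bobj W) ?D" unfolding hq by simp
  also have "\<dots> = (pr V' W' \<cdot> (Ide C (bobj V') \<otimes> ract W') \<cdot> Assoc C (bobj V') (bobj W') ?D) \<cdot> ((f \<otimes> g) \<otimes> Ide C ?D)"
    unfolding g' by simp
  also have "\<dots> = ract (V' \<boxtimes> W') \<cdot> ((pr V' W' \<cdot> (f \<otimes> g)) \<otimes> Ide C ?D)"
    unfolding assoc_square_eq[OF ract_bal(2)[OF b(3,4)], symmetric] by simp
  also have "\<dots> = (ract (V' \<boxtimes> W') \<cdot> (?h \<otimes> Ide C ?D)) \<cdot> (pr V W \<otimes> Ide C ?D)"
    unfolding hq[symmetric] by simp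
  finally have "?h \<cdot> ract (V \<boxtimes> W) = ract (V' \<boxtimes> W') \<cdot> (?h \<otimes> Ide C ?D)"
    by - (rule epi_cancel[OF e], simp_all)
  then show ?thesis by (simp add: right_linear_def Hom_iff)
qed

lemma bal_luni:
  assumes V: "bimodule V"
  shows "bal_luni C D V \<in> Hom C (bobj (regular_bimod D \<boxtimes> V)) (bobj V)"
    "bal_luni C D V \<cdot> pr (regular_bimod D) V = lact V"
proof -
  note [simp] = bimodule_simps[OF V]
  have "\<exists>!e. e \<in> Hom C (bobj (regular_bimod D \<boxtimes> V)) (bobj V) \<and> e \<cdot> pr (regular_bimod D) V = lact V"
    by (rule bal_factor[OF regular_bimodule V]) (use bimodule_squares(1)[OF V] in \<open>simp_all add: Hom_iff\<close>)
  from theI'[OF this] show "bal_luni C D V \<in> Hom C (bobj (regular_bimod D \<boxtimes> V)) (bobj V)"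
    "bal_luni C D V \<cdot> pr (regular_bimod D) V = lact V"
    by (simp_all add: bal_luni_def)
qed

lemma bal_runi:
  assumes V: "bimodule V"
  shows "bal_runi C D V \<in> Hom C (bobj (V \<boxtimes> regular_bimod D)) (bobj V)"
    "bal_runi C D V \<cdot> pr V (regular_bimod D) = ract V"
proof -
  note [simp] = bimodule_simps[OF V]
  have "\<exists>!e. e \<in> Hom C (bobj (V \<boxtimes> regular_bimod D)) (bobj V) \<and> e \<cdot> pr V (regular_bimod D) = ract V"
    by (rule bal_factor[OF V regular_bimodule]) (use bimodule_squares(3)[OF V] in \<open>simp_all add: Hom_iff\<close>)
  from theI'[OF this] show "bal_runi C D V \<in> Hom C (bobj (V \<boxtimes> regular_bimod D)) (bobj V)"
    "bal_runi C D V \<cdot> pr V (regular_bimod D) = ract V"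
    by (simp_all add: bal_runi_def)
qed

text \<open>The arrow descends twice: first along \<open>pr V W\<close> tensored with U, giving
  \<open>h\<close>, then along \<open>pr U (V \<boxtimes> W)\<close>, giving
  \<open>r\<close>.\<close>

lemma bal_reassoc:
  assumes U: "bimodule U" and V: "bimodule V" and W: "bimodule W"
  shows "right_linear (U \<boxtimes> (V \<boxtimes> W)) ((U \<boxtimes> V) \<boxtimes> W) (bal_reassoc C D U V W)"
    "assoc_square (bobj U) (bobj V) (bobj W) (pr U V) (pr (U \<boxtimes> V) W) (pr V W)
      (bal_reassoc C D U V W \<cdot> pr U (V \<boxtimes> W))"
proof -
  note UV = bimodule_bal[OF U V] and VW = bimodule_bal[OF V W]
  note UVW = bimodule_bal[OF UV W] and UVW' = bimodule_bal[OF U VW]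
  note [simp] = bimodule_simps[OF U] bimodule_simps[OF V] bimodule_simps[OF W] bimodule_simps[OF UV]
    bimodule_simps[OF VW] bimodule_simps[OF UVW] bimodule_simps[OF UVW']
    HomD[OF pr_Hom[OF U V]] HomD[OF pr_Hom[OF V W]] HomD[OF pr_Hom[OF UV W]] HomD[OF pr_Hom[OF U VW]]
  let ?D = "aobj D" and ?U = "bobj U" and ?V = "bobj V" and ?W = "bobj W" and ?Z = "bobj ((U \<boxtimes> V) \<boxtimes> W)"
  let ?q = "pr (U \<boxtimes> V) W"
  let ?k = "?q \<cdot> (pr U V \<otimes> Ide C ?W) \<cdot> inverse_arr C (Assoc C ?U ?V ?W)"
  have k: "?k \<in> Hom C (?U \<odot> (?V \<odot> ?W)) ?Z" by (simp add: Hom_iff)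
  have sq: "assoc_square ?U ?V ?W (pr U V) ?q (Ide C (?V \<odot> ?W)) ?k"
    by (simp add: assoc_square_def)
  \<comment> \<open>First descent: the pentagon for U, V, D, W.\<close>
  have "?k \<cdot> (Ide C ?U \<otimes> (Ide C (?V \<odot> ?W) \<cdot> (ract V \<otimes> Ide C ?W)))
      = ?k \<cdot> (Ide C ?U \<otimes> (Ide C (?V \<odot> ?W) \<cdot> (Ide C ?V \<otimes> lact W) \<cdot> Assoc C ?V ?D ?W))"
    by (rule pentagon2_weak[OF ract_bal(2)[OF U V] sq pr_balanced[OF UV W] sq])
      (simp_all add: Hom_iff)
  then have "\<exists>!e. e \<in> Hom C (?U \<odot> bobj (V \<boxtimes> W)) ?Z \<and> e \<cdot> (Ide C ?U \<otimes> pr V W) = ?k"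
    by (intro tensor_pr_factor[OF V W _ k]) simp_all
  then obtain h where h: "h \<in> Hom C (?U \<odot> bobj (V \<boxtimes> W)) ?Z" and hk: "h \<cdot> (Ide C ?U \<otimes> pr V W) = ?k" by blast
  note [simp] = HomD[OF h]
  have "h \<cdot> (Ide C ?U \<otimes> pr V W) \<cdot> Assoc C ?U ?V ?W = (h \<cdot> (Ide C ?U \<otimes> pr V W)) \<cdot> Assoc C ?U ?V ?W" by simp
  also have "\<dots> = ?q \<cdot> (pr U V \<otimes> Ide C ?W)" unfolding hk by simp
  finally have hsq: "assoc_square ?U ?V ?W (pr U V) ?q (pr V W) h" by (simp add: assoc_square_def)
  \<comment> \<open>Second descent: the pentagon for U, D, V, W.\<close>
  have bal: "assoc_square ?U ?D (bobj (V \<boxtimes> W)) (ract U) h (lact (V \<boxtimes> W)) h"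
    by (rule pentagon5[OF pr_balanced[OF U V] lact_bal(2)[OF V W] hsq hsq])
      (auto simp: Hom_iff intro!: tensor_epi pr_epi Ide_epi V W)
  obtain r where r: "r \<in> Hom C (bobj (U \<boxtimes> (V \<boxtimes> W))) ?Z" and rh: "r \<cdot> pr U (V \<boxtimes> W) = h"
    using bal_factor[OF U VW h bal] by blast
  note [simp] = HomD[OF r]
  \<comment> \<open>Both projections are epi, so the defining equation of \<open>bal_reassoc\<close>
    has at most one solution.\<close>
  have e: "is_epi C (pr U (V \<boxtimes> W) \<cdot> (Ide C ?U \<otimes> pr V W))"
    by (intro epi_comp tensor_epi pr_epi Ide_epi U V W VW) simp_all
  have "bal_reassoc C D U V W = r"
    unfolding bal_reassoc_def
  proof (rule the_equality)
    have "r \<cdot> pr U (V \<boxtimes> W) \<cdot> (Ide C ?U \<otimes> pr V W) = (r \<cdot> pr U (V \<boxtimes> W)) \<cdot> (Ide C ?U \<otimes> pr V W)" by simp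
    also have "\<dots> = ?k" unfolding rh hk ..
    finally have rk: "r \<cdot> pr U (V \<boxtimes> W) \<cdot> (Ide C ?U \<otimes> pr V W) = ?k" .
    then show "r \<in> Hom C (bobj (U \<boxtimes> (V \<boxtimes> W))) ?Z \<and> r \<cdot> pr U (V \<boxtimes> W) \<cdot> (Ide C ?U \<otimes> pr V W) = ?k"
      using r by simp
    fix r' assume r': "r' \<in> Hom C (bobj (U \<boxtimes> (V \<boxtimes> W))) ?Z \<and> r' \<cdot> pr U (V \<boxtimes> W) \<cdot> (Ide C ?U \<otimes> pr V W) = ?k"
    then have [simp]: "r' \<in> Arr C" "Dom C r' = bobj (U \<boxtimes> (V \<boxtimes> W))" "Cod C r' = ?Z" by (auto simp: Hom_iff)
    show "r' = r" by (rule epi_cancel[OF e]) (use r' rk in simp_all)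
  qed
  then have R: "bal_reassoc C D U V W \<cdot> pr U (V \<boxtimes> W) = h" "bal_reassoc C D U V W = r" using rh by simp_all
  show "assoc_square ?U ?V ?W (pr U V) (pr (U \<boxtimes> V) W) (pr V W) (bal_reassoc C D U V W \<cdot> pr U (V \<boxtimes> W))"
    unfolding R(1) by (rule hsq)
  \<comment> \<open>Right linearity of \<open>h\<close> is a square of the pentagon for U, V, W, D;
    it passes to \<open>r\<close> by cancelling \<open>e'\<close>.\<close>
  have lin: "assoc_square ?U (bobj (V \<boxtimes> W)) ?D h (ract ((U \<boxtimes> V) \<boxtimes> W)) (ract (V \<boxtimes> W)) h"
    by (rule pentagon3[OF hsq ract_bal(2)[OF V W] ract_bal(2)[OF UV W] hsq])
      (auto simp: Hom_iff intro!: tensor_epi pr_epi Ide_epi V W)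
  have e': "is_epi C (pr U (V \<boxtimes> W) \<otimes> Ide C ?D)" by (intro tensor_epi pr_epi Ide_epi U VW) simp
  have "(r \<cdot> ract (U \<boxtimes> (V \<boxtimes> W))) \<cdot> (pr U (V \<boxtimes> W) \<otimes> Ide C ?D)
    = r \<cdot> (ract (U \<boxtimes> (V \<boxtimes> W)) \<cdot> (pr U (V \<boxtimes> W) \<otimes> Ide C ?D))" by simp
  also have "\<dots> = (r \<cdot> pr U (V \<boxtimes> W)) \<cdot> (Ide C ?U \<otimes> ract (V \<boxtimes> W)) \<cdot> Assoc C ?U (bobj (V \<boxtimes> W)) ?D"
    unfolding assoc_square_eq[OF ract_bal(2)[OF U VW]] by simp
  also have "\<dots> = ract ((U \<boxtimes> V) \<boxtimes> W) \<cdot> (h \<otimes> Ide C ?D)"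
    unfolding rh assoc_square_eq[OF lin] ..
  also have "\<dots> = (ract ((U \<boxtimes> V) \<boxtimes> W) \<cdot> (r \<otimes> Ide C ?D)) \<cdot> (pr U (V \<boxtimes> W) \<otimes> Ide C ?D)"
    unfolding rh[symmetric] by simp
  finally have "r \<cdot> ract (U \<boxtimes> (V \<boxtimes> W)) = ract ((U \<boxtimes> V) \<boxtimes> W) \<cdot> (r \<otimes> Ide C ?D)"
    by - (rule epi_cancel[OF e'], simp_all)
  then show "right_linear (U \<boxtimes> (V \<boxtimes> W)) ((U \<boxtimes> V) \<boxtimes> W) (bal_reassoc C D U V W)"
    unfolding R(2) by (simp add: right_linear_def Hom_iff)
qed

end

section \<open>Powers of a bimodule and their multiplication\<close>

locale bimodule_in_category = algebra_in_category C D
  for C :: "('o, 'm, 'z) moncat_scheme" (structure) and D :: "('o, 'm) alg" +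
  fixes M :: "('o, 'm) bimod"
  assumes bimodule_M: "bimodule M"
begin

abbreviation pw where "pw \<equiv> bal_pow C D M"
abbreviation X where "X n \<equiv> bobj (pw n)"
abbreviation tm where "tm \<equiv> tensor_mult_comp C D M"

lemmas M_simps [simp] = bimodule_simps[OF bimodule_M]

lemma bimodule_pow: "bimodule (pw n)"
proof (induction n)
  case 0 then show ?case by (simp add: regular_bimodule)
next
  case (Suc n) then show ?case by (cases n) (simp_all add: bimodule_M bimodule_bal)
qed

lemmas pow_simps [simp] = bimodule_simps[OF bimodule_pow]

lemma pow_Suc [simp]: "bal_tensor C D (pw (Suc n)) M = pw (Suc (Suc n))"
  by simp

declare bal_pow.simps(3) [simp del]

text \<open>The recursion for \<open>bal_pow_add\<close> tensors the previous isomorphism with the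
  identity of M over D, which is meaningful only if that isomorphism is right linear.\<close>

lemma pow_add_linear:
  "right_linear (pw (Suc p) \<boxtimes> pw (Suc q)) (pw (Suc p + Suc q)) (bal_pow_add C D M (Suc p) (Suc q))"
proof (induction q)
  case 0 then show ?case using Ide_linear(1)[OF bimodule_pow[of "Suc (Suc p)"]] by simp
next
  case (Suc q)
  let ?P = "pw (Suc p)" and ?Q = "pw (Suc q)" and ?S = "pw (Suc p + Suc q)"
  note b = bimodule_pow bimodule_bal bimodule_M
  have 1: "right_linear (?P \<boxtimes> (?Q \<boxtimes> M)) ((?P \<boxtimes> ?Q) \<boxtimes> M) (bal_reassoc C D ?P ?Q M)"
    by (intro bal_reassoc b)
  have 2: "right_linear ((?P \<boxtimes> ?Q) \<boxtimes> M) (?S \<boxtimes> M)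
      (bal_tensor_arr C D (?P \<boxtimes> ?Q) M ?S M (bal_pow_add C D M (Suc p) (Suc q)) (Ide C (bobj M)))"
    by (intro bal_arr_right_linear b Suc Ide_linear)
  show ?case
    using right_linear_comp[OF 1 2] b by (simp del: bal_pow_add.simps(1,2,3) add: b)
qed

lemma tm_0_right: "tm p 0 = ract (pw p)"
  using bal_runi(2)[OF bimodule_pow[of p]] by (simp add: tensor_mult_comp_def)

lemma tm_0_left: "tm 0 q = lact (pw q)"
proof (cases q)
  case 0 then show ?thesis using tm_0_right[of 0] by simp
next
  case (Suc q') then show ?thesis
    using bal_luni(2)[OF bimodule_pow[of q]] by (simp add: tensor_mult_comp_def)
qed

text \<open>By left bracketing the balanced product of a positive power with M is the next power on
  the nose, so only the projection remains.\<close>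

lemma tm_1: "tm (Suc p) (Suc 0) = pr (pw (Suc p)) M"
  using HomD[OF pr_Hom[OF bimodule_pow[of "Suc p"] bimodule_M]] by (simp add: tensor_mult_comp_def)

lemma tm_Hom: "tm p q \<in> Hom C (X p \<odot> X q) (X (p + q))"
proof -
  consider "p = 0" | "q = 0" | p' q' where "p = Suc p'" "q = Suc q'" by (cases p; cases q) auto
  then show ?thesis
  proof cases
    case 1 then show ?thesis by (simp add: tm_0_left Hom_iff)
  next
    case 2 then show ?thesis by (simp add: tm_0_right Hom_iff)
  next
    case 3
    then have "bal_pow_add C D M p q \<in> Hom C (bobj (pw p \<boxtimes> pw q)) (X (p + q))"
      using pow_add_linear[of p' q'] by (simp only: right_linear_def)
    from Comp_Hom[OF pr_Hom[OF bimodule_pow bimodule_pow] this]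
    show ?thesis by (simp only: tensor_mult_comp_def)
  qed
qed

lemmas tm_simps [simp] = HomD(1-3)[OF tm_Hom]

lemma tm_1_epi: "is_epi C (tm p (Suc 0))"
  by (cases p) (auto simp: tm_0_left tm_1 intro: lact_epi pr_epi bimodule_M bimodule_pow)

lemma tm_right_linear_1:
  "assoc_square (X n) (bobj M) (aobj D) (tm n (Suc 0)) (ract (pw (Suc n))) (ract M) (tm n (Suc 0))"
proof (cases n)
  case 0 then show ?thesis using bimodule_squares(2)[OF bimodule_M] by (simp add: tm_0_left)
next
  case (Suc n') then show ?thesis
    using ract_bal(2)[OF bimodule_pow[of n] bimodule_M] by (simp add: tm_1)
qed

text \<open>For positive exponents this is the defining property of the reassociator fed into the
  recursion for \<open>bal_pow_add\<close>. If an exponent vanishes it becomes, according to the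
  case, the left module law of M, balancedness, or the definition of the left action on a balanced
  product.\<close>

lemma tm_Suc:
  "assoc_square (X p) (X q) (bobj M) (tm p q) (tm (p + q) (Suc 0)) (tm q (Suc 0)) (tm p (Suc q))"
proof (cases q)
  case 0
  show ?thesis
  proof (cases p)
    case 0 then show ?thesis using \<open>q = 0\<close> bimodule_squares(1)[OF bimodule_M] by (simp add: tm_0_left)
  next
    case (Suc p') then show ?thesis
      using \<open>q = 0\<close> pr_balanced[OF bimodule_pow[of p] bimodule_M] by (simp add: tm_0_left tm_0_right tm_1)
  qed
next
  case (Suc q')
  show ?thesis
  proof (cases p)
    case 0 then show ?thesis
      using Suc lact_bal(2)[OF bimodule_pow[of q] bimodule_M] by (simp add: tm_0_left tm_1)
  next
    case p: (Suc p')
    let ?P = "pw p" and ?Q = "pw q" and ?S = "pw (p + q)" and ?b = "bal_pow_add C D M p q"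
    note b = bimodule_pow bimodule_bal bimodule_M
    let ?h = "bal_tensor_arr C D (?P \<boxtimes> ?Q) M ?S M ?b (Ide C (bobj M))"
    have lin: "right_linear (?P \<boxtimes> ?Q) ?S ?b" using pow_add_linear[of p' q'] Suc p by (simp only:)
    have h: "?h \<in> Hom C (bobj ((?P \<boxtimes> ?Q) \<boxtimes> M)) (bobj (?S \<boxtimes> M))"
      "?h \<cdot> pr (?P \<boxtimes> ?Q) M = pr ?S M \<cdot> (?b \<otimes> Ide C (bobj M))"
      by (intro bal_arr lin b Ide_linear)+
    have sq: "assoc_square (X p) (X q) (bobj M) (pr ?P ?Q) (pr (?P \<boxtimes> ?Q) M) (pr ?Q M)
        (bal_reassoc C D ?P ?Q M \<cdot> pr ?P (?Q \<boxtimes> M))"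
      by (intro bal_reassoc b)
    have bH: "?b \<in> Hom C (bobj (?P \<boxtimes> ?Q)) (bobj ?S)" using lin by (simp add: right_linear_def)
    have rH: "bal_reassoc C D ?P ?Q M \<in> Hom C (bobj (?P \<boxtimes> (?Q \<boxtimes> M))) (bobj ((?P \<boxtimes> ?Q) \<boxtimes> M))"
      using bal_reassoc(1)[OF bimodule_pow[of p] bimodule_pow[of q] bimodule_M] by (simp add: right_linear_def)
    have tS: "tm (p + q) (Suc 0) = pr ?S M" using tm_1[of "p' + Suc q'"] p Suc by simp
    have tq: "tm q (Suc 0) = pr ?Q M" using tm_1 Suc by simp
    have t1: "tm p q = ?b \<cdot> pr ?P ?Q" by (simp add: tensor_mult_comp_def)
    have QM: "?Q \<boxtimes> M = pw (Suc q)" using Suc by simp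
    have SM: "?S \<boxtimes> M = pw (Suc (p + q))" using Suc p by simp
    note H = pr_Hom[OF bimodule_pow[of p] bimodule_pow[of q]] pr_Hom[OF bimodule_bal[OF bimodule_pow[of p] bimodule_pow[of q]] bimodule_M]
      pr_Hom[OF bimodule_pow[of p] bimodule_bal[OF bimodule_pow[of q] bimodule_M]] pr_Hom[OF bimodule_pow[of q] bimodule_M]
      pr_Hom[OF bimodule_pow[of "p + q"] bimodule_M]
    note [simp] = HomD[OF h(1)] HomD[OF bH] HomD[OF rH] HomD[OF H(1)] HomD[OF H(2)] HomD[OF H(3)] HomD[OF H(4)] HomD[OF H(5)]
    have t2: "tm p (Suc q) = ?h \<cdot> bal_reassoc C D ?P ?Q M \<cdot> pr ?P (?Q \<boxtimes> M)"
    proof -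
      have "tm p (Suc q) = bal_pow_add C D M p (Suc q) \<cdot> pr ?P (pw (Suc q))"
        by (simp add: tensor_mult_comp_def)
      also have "bal_pow_add C D M p (Suc q) = ?h \<cdot> bal_reassoc C D ?P ?Q M"
        by (simp only: p Suc bal_pow_add.simps)
      finally show ?thesis unfolding QM[symmetric] by simp
    qed
    have "tm (p + q) (Suc 0) \<cdot> (tm p q \<otimes> Ide C (bobj M)) = (pr ?S M \<cdot> (?b \<otimes> Ide C (bobj M))) \<cdot> (pr ?P ?Q \<otimes> Ide C (bobj M))"
      unfolding tS t1 by simp
    also have "\<dots> = ?h \<cdot> (pr (?P \<boxtimes> ?Q) M \<cdot> (pr ?P ?Q \<otimes> Ide C (bobj M)))"
      unfolding h(2)[symmetric] by simp
    also have "\<dots> = tm p (Suc q) \<cdot> (Ide C (X p) \<otimes> tm q (Suc 0)) \<cdot> Assoc C (X p) (X q) (bobj M)"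
      unfolding assoc_square_eq[OF sq] t2 tq by simp
    finally show ?thesis by (intro assoc_squareI[where P = "X (p + q)" and Q = "X (q + 1)" and S = "X (p + q + 1)"])
      (use tm_Hom[of p "Suc q"] tm_Hom[of q "Suc 0"] tm_Hom[of "p + q" "Suc 0"] in \<open>simp_all add: Hom_iff\<close>)
  qed
qed

text \<open>Induction by the pentagon for M^p, M^q, M, D. It is the case of a third factor of degree
  zero in \<open>tm_assoc\<close>.\<close>

lemma tm_right_linear: "assoc_square (X p) (X q) (aobj D) (tm p q) (ract (pw (p + q))) (ract (pw q)) (tm p q)"
proof (induction q)
  case 0 then show ?case using bimodule_squares(3)[OF bimodule_pow[of p]] by (simp add: tm_0_right)
next
  case (Suc q)
  have "assoc_square (X p) (X (Suc q)) (aobj D) (tm p (Suc q)) (ract (pw (Suc (p + q)))) (ract (pw (Suc q))) (tm p (Suc q))"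
    by (rule pentagon3[OF tm_Suc tm_right_linear_1 tm_right_linear_1 tm_Suc])
      (use tm_simps(3)[of q "Suc 0"] in \<open>auto intro!: tensor_epi Ide_epi tm_1_epi\<close>)
  then show ?case by simp
qed

text \<open>Induction on the last exponent by the pentagon for M^p, M^q, M^r, M: the known squares
  are the induction hypothesis and three instances of \<open>tm_Suc\<close>.\<close>

lemma tm_assoc: "assoc_square (X p) (X q) (X r) (tm p q) (tm (p + q) r) (tm q r) (tm p (q + r))"
proof (induction r)
  case 0 then show ?case using tm_right_linear by (simp add: tm_0_right)
next
  case (Suc r)
  have A3: "assoc_square (X p) (X (q + r)) (bobj M) (tm p (q + r)) (tm (p + q + r) (Suc 0)) (tm (q + r) (Suc 0)) (tm p (Suc (q + r)))"
    using tm_Suc[of p "q + r"] by (simp only: add.assoc)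
  have "assoc_square (X p) (X q) (X (Suc r)) (tm p q) (tm (p + q) (Suc r)) (tm q (Suc r)) (tm p (Suc (q + r)))"
    by (rule pentagon5[OF Suc tm_Suc A3 tm_Suc])
      (use tm_simps(3)[of r "Suc 0"] in \<open>auto intro!: tensor_epi Ide_epi tm_1_epi\<close>)
  then show ?case by simp
qed

text \<open>Multiplying by the last copy of M separately is epi by induction, and by
  \<open>tm_Suc\<close> that composite factors through \<open>tm p (Suc q)\<close>.\<close>

lemma tm_epi: "is_epi C (tm p q)"
proof (induction q)
  case 0 then show ?case by (simp add: tm_0_right ract_epi bimodule_pow)
next
  case (Suc q)
  have "is_epi C (tm (p + q) (Suc 0) \<cdot> (tm p q \<otimes> Ide C (bobj M)))"
    by (intro epi_comp tensor_epi Suc Ide_epi tm_1_epi) simp_all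
  then show ?case unfolding assoc_square_eq[OF tm_Suc]
    by (rule epi_of_comp) (use assoc_squareD[OF tm_Suc[of p q]] in simp_all)
qed

end

text \<open>All direct sums in the argument can be indexed by sets of naturals. This isolates what
  is used of cocompleteness and keeps the smallness type out of the main part.\<close>

locale sequential_monoidal_category = abelian_monoidal_category C
  for C :: "('o, 'm, 'z) moncat_scheme" (structure) +
  assumes sequential_coproduct: "(\<And>k. k \<in> I \<Longrightarrow> F k \<in> Obj C) \<Longrightarrow> \<exists>P j. is_coproduct C (I :: nat set) F P j"
    and tensor_sequential_coproduct: "is_coproduct C (I :: nat set) F P j \<Longrightarrow> X \<in> Obj C \<Longrightarrow>
      is_coproduct C I (\<lambda>k. X \<odot> F k) (X \<odot> P) (\<lambda>k. Ide C X \<otimes> j k) \<and>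
      is_coproduct C I (\<lambda>k. F k \<odot> X) (P \<odot> X) (\<lambda>k. j k \<otimes> Ide C X)"
begin

lemma chosen_coproduct:
  fixes I :: "nat set"
  assumes "\<And>k. k \<in> I \<Longrightarrow> F k \<in> Obj C"
  shows "is_coproduct C I F (coprod_obj C I F) (coprod_inj C I F)"
proof -
  have "\<exists>P j. is_coproduct C I F P j" by (rule sequential_coproduct[OF assms])
  then obtain P j where "is_coproduct C I F P j" by blast
  then show ?thesis by (rule coprod_is_coproduct)
qed

lemma tensor_coproduct_eqI:
  fixes I J :: "nat set"
  assumes P: "is_coproduct C I F P j" and Q: "is_coproduct C J G Q l"
    and f: "f \<in> Hom C (P \<odot> Q) Z" and g: "g \<in> Hom C (P \<odot> Q) Z"
    and eq: "\<And>a b. a \<in> I \<Longrightarrow> b \<in> J \<Longrightarrow> f \<cdot> (j a \<otimes> l b) = g \<cdot> (j a \<otimes> l b)"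
  shows "f = g"
proof (rule coproduct_eqI[OF tensor_sequential_coproduct[OF Q coproduct_Obj[OF P], THEN conjunct1] f g])
  note [simp] = coproduct_Obj[OF P] coproduct_Obj[OF Q] HomD[OF f] HomD[OF g]
  fix b assume b: "b \<in> J"
  note [simp] = HomD[OF coproduct_Hom[OF Q b]]
  show "f \<cdot> (Ide C P \<otimes> l b) = g \<cdot> (Ide C P \<otimes> l b)"
  proof (rule coproduct_eqI[OF tensor_sequential_coproduct[OF P, of "G b", THEN conjunct2]])
    fix a assume a: "a \<in> I"
    note [simp] = HomD[OF coproduct_Hom[OF P a]]
    show "(f \<cdot> (Ide C P \<otimes> l b)) \<cdot> (j a \<otimes> Ide C (G b)) = (g \<cdot> (Ide C P \<otimes> l b)) \<cdot> (j a \<otimes> Ide C (G b))"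
      using eq[OF a b] by simp
  qed (simp_all add: Hom_iff)
qed

lemma tensor_coproduct_ex:
  fixes I J :: "nat set"
  assumes P: "is_coproduct C I F P j" and Q: "is_coproduct C J G Q l" and Z [simp]: "Z \<in> Obj C"
    and h: "\<And>a b. a \<in> I \<Longrightarrow> b \<in> J \<Longrightarrow> h a b \<in> Hom C (F a \<odot> G b) Z"
  shows "\<exists>!m. m \<in> Hom C (P \<odot> Q) Z \<and> (\<forall>a\<in>I. \<forall>b\<in>J. m \<cdot> (j a \<otimes> l b) = h a b)"
proof -
  note [simp] = coproduct_Obj[OF P] coproduct_Obj[OF Q]
  \<comment> \<open>The sum over \<open>a\<close> is assembled first, for each fixed
    \<open>b\<close>; the resulting arrows \<open>k b\<close> are then assembled over
    \<open>b\<close>.\<close>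
  have "\<exists>k. k \<in> Hom C (P \<odot> G b) Z \<and> (\<forall>a\<in>I. k \<cdot> (j a \<otimes> Ide C (G b)) = h a b)" if b: "b \<in> J" for b
  proof -
    note [simp] = HomD[OF coproduct_Hom[OF Q b]]
    have "\<exists>!k. k \<in> Hom C (P \<odot> G b) Z \<and> (\<forall>a\<in>I. k \<cdot> (j a \<otimes> Ide C (G b)) = h a b)"
      by (rule coproduct_ex[OF tensor_sequential_coproduct[OF P, of "G b", THEN conjunct2] Z h[OF _ b]]) simp_all
    then show ?thesis by blast
  qed
  then obtain k where k: "\<And>b. b \<in> J \<Longrightarrow> k b \<in> Hom C (P \<odot> G b) Z"
    "\<And>a b. a \<in> I \<Longrightarrow> b \<in> J \<Longrightarrow> k b \<cdot> (j a \<otimes> Ide C (G b)) = h a b" by metis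
  have "\<exists>!m. m \<in> Hom C (P \<odot> Q) Z \<and> (\<forall>b\<in>J. m \<cdot> (Ide C P \<otimes> l b) = k b)"
    by (rule coproduct_ex[OF tensor_sequential_coproduct[OF Q, of P, THEN conjunct1] Z k(1)]) simp_all
  then obtain m where m: "m \<in> Hom C (P \<odot> Q) Z" "\<And>b. b \<in> J \<Longrightarrow> m \<cdot> (Ide C P \<otimes> l b) = k b" by blast
  note [simp] = HomD[OF m(1)]
  have mh: "m \<cdot> (j a \<otimes> l b) = h a b" if a: "a \<in> I" and b: "b \<in> J" for a b
  proof -
    note [simp] = HomD[OF coproduct_Hom[OF P a]] HomD[OF coproduct_Hom[OF Q b]]
    have "m \<cdot> (j a \<otimes> l b) = (m \<cdot> (Ide C P \<otimes> l b)) \<cdot> (j a \<otimes> Ide C (G b))" by simp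
    then show ?thesis using m(2) k(2) a b by simp
  qed
  show ?thesis
  proof (rule ex1I[of _ m])
    fix m' assume "m' \<in> Hom C (P \<odot> Q) Z \<and> (\<forall>a\<in>I. \<forall>b\<in>J. m' \<cdot> (j a \<otimes> l b) = h a b)"
    then show "m' = m" using mh m(1) by - (rule tensor_coproduct_eqI[OF P Q, of m' Z m], simp_all)
  qed (use m(1) mh in auto)
qed

lemma tensor_coproduct_eqI3:
  fixes I J K :: "nat set"
  assumes P: "is_coproduct C I F P j" and Q: "is_coproduct C J G Q l" and R: "is_coproduct C K H R n"
    and f: "f \<in> Hom C ((P \<odot> Q) \<odot> R) Z" and g: "g \<in> Hom C ((P \<odot> Q) \<odot> R) Z"
    and eq: "\<And>a b c. a \<in> I \<Longrightarrow> b \<in> J \<Longrightarrow> c \<in> K \<Longrightarrow> f \<cdot> ((j a \<otimes> l b) \<otimes> n c) = g \<cdot> ((j a \<otimes> l b) \<otimes> n c)"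
  shows "f = g"
proof (rule coproduct_eqI[OF tensor_sequential_coproduct[OF R, of "P \<odot> Q", THEN conjunct1] f g])
  note [simp] = coproduct_Obj[OF P] coproduct_Obj[OF Q] coproduct_Obj[OF R] HomD[OF f] HomD[OF g]
  show "P \<odot> Q \<in> Obj C" by simp
  fix c assume c: "c \<in> K"
  note [simp] = HomD[OF coproduct_Hom[OF R c]]
  show "f \<cdot> (Ide C (P \<odot> Q) \<otimes> n c) = g \<cdot> (Ide C (P \<odot> Q) \<otimes> n c)"
  proof (rule tensor_coproduct_eqI[OF tensor_sequential_coproduct[OF P, of Q, THEN conjunct2], of _ _ _ _ _ ])
    \<comment> \<open>The object \<open>H c\<close> is regarded as a sum with one term, so that the
      criterion for two sums also applies with a single object on the right.\<close>
    have "is_coproduct C {0::nat} (\<lambda>_. H c) (H c) (\<lambda>_. Ide C (H c))"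
      unfolding is_coproduct_def
    proof (intro conjI ballI allI impI)
      fix Z and g :: "nat \<Rightarrow> 'm" assume g: "\<forall>k\<in>{0}. g k \<in> Hom C (H c) Z"
      show "\<exists>!h. h \<in> Hom C (H c) Z \<and> (\<forall>k\<in>{0}. h \<cdot> Ide C (H c) = g k)"
        by (rule ex1I[of _ "g 0"]) (use g in \<open>auto simp: Hom_iff\<close>)
    qed (simp_all add: Hom_iff)
    then show "is_coproduct C {0::nat} (\<lambda>_. H c) (H c) (\<lambda>_. Ide C (H c))" .
    fix a :: nat assume a: "a \<in> I"
    note [simp] = HomD[OF coproduct_Hom[OF P a]]
    show "(f \<cdot> (Ide C (P \<odot> Q) \<otimes> n c)) \<cdot> ((j a \<otimes> Ide C Q) \<otimes> Ide C (H c))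
      = (g \<cdot> (Ide C (P \<odot> Q) \<otimes> n c)) \<cdot> ((j a \<otimes> Ide C Q) \<otimes> Ide C (H c))"
    proof (rule coproduct_eqI)
      show "is_coproduct C J (\<lambda>b. (F a \<odot> G b) \<odot> H c) ((F a \<odot> Q) \<odot> H c) (\<lambda>b. (Ide C (F a) \<otimes> l b) \<otimes> Ide C (H c))"
        using tensor_sequential_coproduct[OF tensor_sequential_coproduct[OF Q, of "F a", THEN conjunct1], of "H c", THEN conjunct2]
        by simp
      fix b assume b: "b \<in> J"
      note [simp] = HomD[OF coproduct_Hom[OF Q b]]
      show "((f \<cdot> (Ide C (P \<odot> Q) \<otimes> n c)) \<cdot> ((j a \<otimes> Ide C Q) \<otimes> Ide C (H c))) \<cdot> ((Ide C (F a) \<otimes> l b) \<otimes> Ide C (H c))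
        = ((g \<cdot> (Ide C (P \<odot> Q) \<otimes> n c)) \<cdot> ((j a \<otimes> Ide C Q) \<otimes> Ide C (H c))) \<cdot> ((Ide C (F a) \<otimes> l b) \<otimes> Ide C (H c))"
        using eq[OF a b c] by simp
    qed (simp_all add: Hom_iff)
  qed (simp_all add: Hom_iff)
qed


subsection \<open>Graded objects\<close>

context
  fixes X :: "('o, 'm, 'y) graded_scheme"
  assumes X: "graded_object C X"
begin

lemma graded_coproduct: "is_coproduct C UNIV (gcomp X) (gobj X) (ginj X)"
  using X by (simp add: graded_object_def)

lemma graded_Obj: "gobj X \<in> Obj C" "gcomp X n \<in> Obj C"
  using coproduct_Obj[OF graded_coproduct] HomD(4)[OF coproduct_Hom[OF graded_coproduct, of n]] by auto

lemma ginj_Hom: "ginj X n \<in> Hom C (gcomp X n) (gobj X)"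
  using coproduct_Hom[OF graded_coproduct] by simp

lemma graded_eqI:
  "f \<in> Hom C (gobj X) Z \<Longrightarrow> g \<in> Hom C (gobj X) Z \<Longrightarrow> (\<And>n. f \<cdot> ginj X n = g \<cdot> ginj X n) \<Longrightarrow> f = g"
  by (rule coproduct_eqI[OF graded_coproduct]) auto

lemma gproj:
  "gproj C X n \<in> Hom C (gobj X) (gcomp X n)"
  "gproj C X n \<cdot> ginj X k = (if k = n then Ide C (gcomp X n) else Zer C (gcomp X k) (gcomp X n))"
proof -
  have "\<exists>!p. p \<in> Hom C (gobj X) (gcomp X n) \<and>
    (\<forall>k\<in>UNIV. p \<cdot> ginj X k = (if k = n then Ide C (gcomp X n) else Zer C (gcomp X k) (gcomp X n)))"
    by (rule coproduct_ex[OF graded_coproduct]) (auto simp: graded_Obj Hom_iff)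
  from theI'[OF this[simplified]]
  show "gproj C X n \<in> Hom C (gobj X) (gcomp X n)"
    "gproj C X n \<cdot> ginj X k = (if k = n then Ide C (gcomp X n) else Zer C (gcomp X k) (gcomp X n))"
    unfolding gproj_def by auto
qed

lemma ginj_mono: "is_mono C (ginj X n)"
  by (rule split_mono[of _ "gproj C X n"]) (use HomD[OF ginj_Hom] HomD[OF gproj(1)] gproj(2) in auto)

lemma gproj_epi: "is_epi C (gproj C X n)"
  by (rule split_epi[of _ "ginj X n"]) (use HomD[OF ginj_Hom] HomD[OF gproj(1)] gproj(2) in auto)

lemma ginj_cancel:
  assumes "f \<in> Hom C Z (gcomp X n)" "g \<in> Hom C Z (gcomp X n)" "ginj X n \<cdot> f = ginj X n \<cdot> g"
  shows "f = g"
  by (rule mono_cancel[OF ginj_mono]) (use assms HomD[OF ginj_Hom] in \<open>auto simp: Hom_iff\<close>)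

text \<open>Injections of a graded object are split mono, so homogeneous components are unique and
  the descriptions \<open>mult_comp\<close> and \<open>gmor_comp\<close> denote.\<close>

lemma the_graded_factor:
  assumes "h \<in> Hom C Z (gcomp X n)" "f = ginj X n \<cdot> h"
  shows "(THE h. h \<in> Hom C Z (gcomp X n) \<and> f = ginj X n \<cdot> h) = h"
  by (rule the_equality) (use assms ginj_cancel in auto)

end

lemma gmor_compI:
  assumes "graded_object C X" "graded_object C Y" "h \<in> Hom C (gcomp X n) (gcomp Y n)" "f \<cdot> ginj X n = ginj Y n \<cdot> h"
  shows "gmor_comp C X Y f n = h"
  unfolding gmor_comp_def assms(4) by (rule the_graded_factor[OF assms(2,3)]) simp

text \<open>The first coordinate identifies the pairs of sum \<open>n\<close> with
  \<open>{..n}\<close>, which brings the index set back into the naturals.\<close>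

lemma graded_tensor_coproduct:
  assumes X: "graded_object C X" and Y: "graded_object C Y"
  shows "\<exists>P j. is_coproduct C {(a, b). a + b = n} (\<lambda>(a, b). gcomp X a \<odot> gcomp Y b) P j"
proof -
  obtain P j where "is_coproduct C {..n} (\<lambda>a. gcomp X a \<odot> gcomp Y (n - a)) P j"
    using sequential_coproduct[of "{..n}" "\<lambda>a. gcomp X a \<odot> gcomp Y (n - a)"]
      graded_Obj(2)[OF X] graded_Obj(2)[OF Y] by auto
  then have "is_coproduct C {(a, b). a + b = n} (\<lambda>p. gcomp X (fst p) \<odot> gcomp Y (n - fst p)) P (\<lambda>p. j (fst p))"
    by (rule coproduct_reindex)
      (rule bij_betw_byWitness[where f' = "\<lambda>a. (a, n - a)"]; auto)
  then have "is_coproduct C {(a, b). a + b = n} (\<lambda>(a, b). gcomp X a \<odot> gcomp Y b) P (\<lambda>p. j (fst p))"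
    by (rule coproduct_cong) auto
  then show ?thesis by blast
qed

text \<open>Replaces the chosen sums inside \<open>graded_tensor\<close> by a condition on the
  individual pairs of degrees.\<close>

lemma graded_morphism_tensor_iff:
  fixes Z :: "('o, 'm, 'y) graded_scheme"
  assumes X: "graded_object C X" and Y: "graded_object C Y" and Z: "graded_object C Z"
  shows "graded_morphism C (graded_tensor C X Y) Z m \<longleftrightarrow> m \<in> Hom C (gobj X \<odot> gobj Y) (gobj Z) \<and>
    (\<forall>a b. \<exists>h \<in> Hom C (gcomp X a \<odot> gcomp Y b) (gcomp Z (a + b)).
      m \<cdot> (ginj X a \<otimes> ginj Y b) = ginj Z (a + b) \<cdot> h)" (is "?L \<longleftrightarrow> ?R")
proof -
  let ?I = "\<lambda>n :: nat. {(a, b). a + b = n}" and ?F = "\<lambda>(a, b). gcomp X a \<odot> gcomp Y b"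
  let ?P = "\<lambda>n. coprod_obj C (?I n) ?F" and ?j = "\<lambda>n. coprod_inj C (?I n) ?F"
  let ?g = "\<lambda>n. copair C (?I n) ?F (gobj X \<odot> gobj Y) (\<lambda>(a, b). ginj X a \<otimes> ginj Y b)"
  note [simp] = graded_Obj[OF X] graded_Obj[OF Y] graded_Obj[OF Z] HomD[OF ginj_Hom[OF X]]
    HomD[OF ginj_Hom[OF Y]] HomD[OF ginj_Hom[OF Z]]
  have c: "is_coproduct C (?I n) ?F (?P n) (?j n)" for n
    using graded_tensor_coproduct[OF X Y] coprod_is_coproduct by blast
  have g: "?g n \<in> Hom C (?P n) (gobj X \<odot> gobj Y)" "\<And>a b. a + b = n \<Longrightarrow> ?g n \<cdot> ?j n (a, b) = ginj X a \<otimes> ginj Y b" for n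
    using copair[OF c, of "gobj X \<odot> gobj Y" n "\<lambda>(a, b). ginj X a \<otimes> ginj Y b"]
    by (auto simp: Hom_iff)
  have j: "?j (a + b) (a, b) \<in> Hom C (gcomp X a \<odot> gcomp Y b) (?P (a + b))" for a b
    using coproduct_Hom[OF c, of "(a, b)" "a + b"] by simp
  show ?thesis
  proof
    assume ?L
    then obtain fn where m: "m \<in> Hom C (gobj X \<odot> gobj Y) (gobj Z)"
      and fn: "\<And>n. fn n \<in> Hom C (?P n) (gcomp Z n)" "\<And>n. m \<cdot> ?g n = ginj Z n \<cdot> fn n"
      unfolding graded_morphism_def graded_tensor_def by auto
    show ?R
    proof (intro conjI allI)
      fix a b
      note [simp] = HomD[OF m] HomD[OF fn(1)[of "a + b"]] HomD[OF g(1)[of "a + b"]] HomD[OF j[of a b]]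
      have "m \<cdot> (ginj X a \<otimes> ginj Y b) = (m \<cdot> ?g (a + b)) \<cdot> ?j (a + b) (a, b)" by (simp add: g(2)[of a b "a + b"])
      also have "\<dots> = ginj Z (a + b) \<cdot> (fn (a + b) \<cdot> ?j (a + b) (a, b))" unfolding fn(2) by simp
      finally show "\<exists>h \<in> Hom C (gcomp X a \<odot> gcomp Y b) (gcomp Z (a + b)).
          m \<cdot> (ginj X a \<otimes> ginj Y b) = ginj Z (a + b) \<cdot> h"
        by (rule bexI) (simp add: Hom_iff)
    qed (rule m)
  next
    assume R: ?R
    then have m: "m \<in> Hom C (gobj X \<odot> gobj Y) (gobj Z)" by blast
    obtain h where h: "\<And>a b. h a b \<in> Hom C (gcomp X a \<odot> gcomp Y b) (gcomp Z (a + b))"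
      "\<And>a b. m \<cdot> (ginj X a \<otimes> ginj Y b) = ginj Z (a + b) \<cdot> h a b"
      using R by metis
    note [simp] = HomD[OF m] HomD[OF g(1)]
    have "\<exists>f. f \<in> Hom C (?P n) (gcomp Z n) \<and> m \<cdot> ?g n = ginj Z n \<cdot> f" for n
    proof -
      have "\<exists>!f. f \<in> Hom C (?P n) (gcomp Z n) \<and> (\<forall>p\<in>?I n. f \<cdot> ?j n p = (\<lambda>(a, b). h a b) p)"
        by (rule coproduct_ex[OF c]) (use h(1) in auto)
      then obtain f where f: "f \<in> Hom C (?P n) (gcomp Z n)" "\<And>a b. a + b = n \<Longrightarrow> f \<cdot> ?j n (a, b) = h a b" by auto
      note [simp] = HomD[OF f(1)]
      have "m \<cdot> ?g n = ginj Z n \<cdot> f"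
      proof (rule coproduct_eqI[OF c])
        fix p assume "p \<in> ?I n"
        then obtain a b where p: "p = (a, b)" "a + b = n" by auto
        note [simp] = HomD[OF j[of a b, unfolded p(2)]]
        show "(m \<cdot> ?g n) \<cdot> ?j n p = (ginj Z n \<cdot> f) \<cdot> ?j n p"
          using h(2)[of a b] p by (simp add: g(2) f(2))
      qed (simp_all add: Hom_iff)
      then show ?thesis using f by blast
    qed
    then obtain fn where "\<And>n. fn n \<in> Hom C (?P n) (gcomp Z n) \<and> m \<cdot> ?g n = ginj Z n \<cdot> fn n" by metis
    then show ?L using m unfolding graded_morphism_def graded_tensor_def by auto
  qed
qed

end

section \<open>The tensor algebra is a graded algebra\<close>

locale tensor_algebra_in_category =
  sequential_monoidal_category C + bimodule_in_category C D M
  for C :: "('o, 'm, 'z) moncat_scheme" (structure) and D :: "('o, 'm) alg" and M :: "('o, 'm) bimod"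
begin

abbreviation T where "T \<equiv> tensor_algebra C D M"

lemma T_sel:
  "gobj T = coprod_obj C UNIV (\<lambda>n. X n)" "gcomp T n = X n" "ginj T = coprod_inj C UNIV (\<lambda>n. X n)"
  "gunit T = ginj T 0 \<cdot> aunit D"
  "gmult T = (THE m. m \<in> Hom C (gobj T \<odot> gobj T) (gobj T) \<and>
    (\<forall>p q. m \<cdot> (ginj T p \<otimes> ginj T q) = ginj T (p + q) \<cdot> tm p q))"
  by (simp_all add: tensor_algebra_def Let_def)

lemma T_coproduct: "is_coproduct C UNIV (\<lambda>n. X n) (gobj T) (ginj T)"
  unfolding T_sel(1,3) by (rule chosen_coproduct) simp

lemma graded_T: "graded_object C T"
  using T_coproduct by (simp add: graded_object_def T_sel(2)[abs_def])

lemmas T_simps [simp] = T_sel(2,4) graded_Obj(1)[OF graded_T]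
  HomD(1-3)[OF ginj_Hom[OF graded_T], unfolded T_sel(2)]

lemma gmult_T:
  "gmult T \<in> Hom C (gobj T \<odot> gobj T) (gobj T)"
  "gmult T \<cdot> (ginj T p \<otimes> ginj T q) = ginj T (p + q) \<cdot> tm p q"
proof -
  have "\<exists>!m. m \<in> Hom C (gobj T \<odot> gobj T) (gobj T) \<and>
    (\<forall>p\<in>UNIV. \<forall>q\<in>UNIV. m \<cdot> (ginj T p \<otimes> ginj T q) = ginj T (p + q) \<cdot> tm p q)"
    by (rule tensor_coproduct_ex[OF T_coproduct T_coproduct]) (simp_all add: Hom_iff)
  from theI'[OF this[simplified ball_UNIV]] T_sel(5)
  show "gmult T \<in> Hom C (gobj T \<odot> gobj T) (gobj T)"
    "gmult T \<cdot> (ginj T p \<otimes> ginj T q) = ginj T (p + q) \<cdot> tm p q" by simp_all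
qed

lemmas gmult_T_simps [simp] = HomD(1-3)[OF gmult_T(1)]

text \<open>Each axiom is tested on summands, where it becomes \<open>tm_assoc\<close> or a unit law
  of the bimodule \<open>pw n\<close>.\<close>

lemma algebra_T: "Defs.algebra C (alg_of T)"
proof -
  let ?T = "gobj T" and ?m = "gmult T" and ?i = "ginj T" and ?u = "gunit T"
  have assoc: "?m \<cdot> (?m \<otimes> Ide C ?T) = ?m \<cdot> (Ide C ?T \<otimes> ?m) \<cdot> Assoc C ?T ?T ?T"
  proof (rule tensor_coproduct_eqI3[OF T_coproduct T_coproduct T_coproduct])
    fix p q r
    have "(?m \<cdot> (?m \<otimes> Ide C ?T)) \<cdot> ((?i p \<otimes> ?i q) \<otimes> ?i r) = ?m \<cdot> ((?m \<cdot> (?i p \<otimes> ?i q)) \<otimes> ?i r)" by simp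
    also have "\<dots> = ?m \<cdot> ((?i (p + q) \<cdot> tm p q) \<otimes> ?i r)" unfolding gmult_T(2) ..
    also have "\<dots> = (?m \<cdot> (?i (p + q) \<otimes> ?i r)) \<cdot> (tm p q \<otimes> Ide C (X r))" by simp
    also have "\<dots> = ?i (p + q + r) \<cdot> (tm (p + q) r \<cdot> (tm p q \<otimes> Ide C (X r)))" unfolding gmult_T(2) by simp
    also have "\<dots> = (?i (p + (q + r)) \<cdot> tm p (q + r)) \<cdot> (Ide C (X p) \<otimes> tm q r) \<cdot> Assoc C (X p) (X q) (X r)"
      unfolding assoc_square_eq[OF tm_assoc] by (simp add: add.assoc)
    also have "\<dots> = (?m \<cdot> (?i p \<otimes> ?i (q + r))) \<cdot> (Ide C (X p) \<otimes> tm q r) \<cdot> Assoc C (X p) (X q) (X r)"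
      unfolding gmult_T(2)[symmetric] ..
    also have "\<dots> = ?m \<cdot> (?i p \<otimes> (?i (q + r) \<cdot> tm q r)) \<cdot> Assoc C (X p) (X q) (X r)" by simp
    also have "\<dots> = (?m \<cdot> (Ide C ?T \<otimes> ?m) \<cdot> Assoc C ?T ?T ?T) \<cdot> ((?i p \<otimes> ?i q) \<otimes> ?i r)"
      unfolding gmult_T(2)[symmetric] by simp
    finally show "(?m \<cdot> (?m \<otimes> Ide C ?T)) \<cdot> ((?i p \<otimes> ?i q) \<otimes> ?i r)
      = (?m \<cdot> (Ide C ?T \<otimes> ?m) \<cdot> Assoc C ?T ?T ?T) \<cdot> ((?i p \<otimes> ?i q) \<otimes> ?i r)" .
  qed (simp_all add: Hom_iff)
  have left: "?m \<cdot> (?u \<otimes> Ide C ?T) = LUni C ?T"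
  proof (rule coproduct_eqI[OF tensor_sequential_coproduct[OF T_coproduct, of "One C", THEN conjunct1]])
    fix n
    have "(?m \<cdot> (?u \<otimes> Ide C ?T)) \<cdot> (Ide C (One C) \<otimes> ?i n) = (?m \<cdot> (?i 0 \<otimes> ?i n)) \<cdot> (aunit D \<otimes> Ide C (X n))"
      by simp
    also have "\<dots> = ?i n \<cdot> LUni C (X n)"
      unfolding gmult_T(2) by (simp add: tm_0_left)
    finally show "(?m \<cdot> (?u \<otimes> Ide C ?T)) \<cdot> (Ide C (One C) \<otimes> ?i n) = LUni C ?T \<cdot> (Ide C (One C) \<otimes> ?i n)" by simp
  qed (simp_all add: Hom_iff)
  have right: "?m \<cdot> (Ide C ?T \<otimes> ?u) = RUni C ?T"
  proof (rule coproduct_eqI[OF tensor_sequential_coproduct[OF T_coproduct, of "One C", THEN conjunct2]])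
    fix n
    have "(?m \<cdot> (Ide C ?T \<otimes> ?u)) \<cdot> (?i n \<otimes> Ide C (One C)) = (?m \<cdot> (?i n \<otimes> ?i 0)) \<cdot> (Ide C (X n) \<otimes> aunit D)"
      by simp
    also have "\<dots> = ?i n \<cdot> RUni C (X n)"
      unfolding gmult_T(2) by (simp add: tm_0_right)
    finally show "(?m \<cdot> (Ide C ?T \<otimes> ?u)) \<cdot> (?i n \<otimes> Ide C (One C)) = RUni C ?T \<cdot> (?i n \<otimes> Ide C (One C))" by simp
  qed (simp_all add: Hom_iff)
  show ?thesis using assoc left right by (simp add: algebra_def alg_of_def Hom_iff)
qed

lemma graded_algebra_T: "graded_algebra C T"
proof -
  have "graded_morphism C (graded_tensor C T T) T (gmult T)"
    unfolding graded_morphism_tensor_iff[OF graded_T graded_T graded_T]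
    using gmult_T tm_Hom by auto
  then show ?thesis using algebra_T graded_T by (simp add: graded_algebra_def)
qed

end

section \<open>A graded algebra and its degree zero part\<close>

locale graded_algebra_in_category = sequential_monoidal_category C
  for C :: "('o, 'm, 'z) moncat_scheme" (structure) +
  fixes A :: "('o, 'm) galg"
  assumes graded_algebra: "graded_algebra C A"
begin

lemma graded_A: "graded_object C A"
  using graded_algebra by (simp add: graded_algebra_def)

abbreviation "\<iota> n \<equiv> ginj A n"
abbreviation "\<pi> n \<equiv> gproj C A n"
abbreviation "m \<equiv> gmult A"
abbreviation "u \<equiv> gunit A"
abbreviation "mc \<equiv> mult_comp C A"
abbreviation "D \<equiv> deg_zero_alg C A"
abbreviation "M \<equiv> deg_one_bimod C A"
abbreviation "B \<equiv> bimod_via_deg_zero C A"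

lemmas A_simps [simp] = graded_Obj[OF graded_A] HomD(1-3)[OF ginj_Hom[OF graded_A]] HomD(1-3)[OF gproj(1)[OF graded_A]]

lemma proj_inj [simp]: "\<pi> n \<cdot> \<iota> n = Ide C (gcomp A n)"
  using gproj(2)[OF graded_A] by simp

lemma proj_inj_ext [simp]:
  assumes [simp]: "f \<in> Arr C" "Cod C f = gcomp A n"
  shows "\<pi> n \<cdot> \<iota> n \<cdot> f = f"
proof -
  have "\<pi> n \<cdot> \<iota> n \<cdot> f = (\<pi> n \<cdot> \<iota> n) \<cdot> f" by (subst Comp_assoc') simp_all
  then show ?thesis by (simp only: proj_inj) simp
qed

lemma algebra_A: "Defs.algebra C (alg_of A)"
  using graded_algebra by (simp add: graded_algebra_def)

lemma alg_of_simps [simp]: "aobj (alg_of A) = gobj A" "amult (alg_of A) = m" "aunit (alg_of A) = u"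
  by (simp_all add: alg_of_def)

lemma mult_simps [simp]:
  "m \<in> Arr C" "Dom C m = gobj A \<odot> gobj A" "Cod C m = gobj A"
  "u \<in> Arr C" "Dom C u = One C" "Cod C u = gobj A"
  "m \<cdot> (u \<otimes> Ide C (gobj A)) = LUni C (gobj A)"
  "m \<cdot> (Ide C (gobj A) \<otimes> u) = RUni C (gobj A)"
  using algebra_A by (auto simp: algebra_def alg_of_def Hom_iff)

lemma mult_assoc:
  "m \<cdot> (m \<otimes> Ide C (gobj A)) = m \<cdot> (Ide C (gobj A) \<otimes> m) \<cdot> Assoc C (gobj A) (gobj A) (gobj A)"
  using algebra_A by (auto simp: algebra_def alg_of_def Hom_iff)

text \<open>Associativity for generalised elements \<open>f\<close>, \<open>g\<close>,
  \<open>h\<close> of A.\<close>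

lemma mult_assoc_arr:
  assumes [simp]: "f \<in> Arr C" "g \<in> Arr C" "h \<in> Arr C" "Cod C f = gobj A" "Cod C g = gobj A" "Cod C h = gobj A"
  shows "m \<cdot> ((m \<cdot> (f \<otimes> g)) \<otimes> h) = m \<cdot> (f \<otimes> (m \<cdot> (g \<otimes> h))) \<cdot> Assoc C (Dom C f) (Dom C g) (Dom C h)"
proof -
  have "m \<cdot> ((m \<cdot> (f \<otimes> g)) \<otimes> h) = (m \<cdot> (m \<otimes> Ide C (gobj A))) \<cdot> ((f \<otimes> g) \<otimes> h)" by simp
  then show ?thesis unfolding mult_assoc by simp
qed

lemma mc:
  "mc a b \<in> Hom C (gcomp A a \<odot> gcomp A b) (gcomp A (a + b))"
  "m \<cdot> (\<iota> a \<otimes> \<iota> b) = \<iota> (a + b) \<cdot> mc a b"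
proof -
  have "graded_morphism C (graded_tensor C A A) A m"
    using graded_algebra by (simp add: graded_algebra_def)
  then obtain h where h: "h \<in> Hom C (gcomp A a \<odot> gcomp A b) (gcomp A (a + b))" "m \<cdot> (\<iota> a \<otimes> \<iota> b) = \<iota> (a + b) \<cdot> h"
    unfolding graded_morphism_tensor_iff[OF graded_A graded_A graded_A] by blast
  have "mc a b = h"
    unfolding mult_comp_def by (rule the_graded_factor[OF graded_A h])
  then show "mc a b \<in> Hom C (gcomp A a \<odot> gcomp A b) (gcomp A (a + b))" "m \<cdot> (\<iota> a \<otimes> \<iota> b) = \<iota> (a + b) \<cdot> mc a b"
    using h by simp_all
qed

lemmas mc_simps [simp] = HomD(1-3)[OF mc(1)]

lemma mc_assoc:
  "assoc_square (gcomp A a) (gcomp A b) (gcomp A c) (mc a b) (mc (a + b) c) (mc b c) (mc a (b + c))"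
proof (rule assoc_squareI[where S = "gcomp A (a + b + c)"])
  show "mc (a + b) c \<cdot> (mc a b \<otimes> Ide C (gcomp A c))
    = mc a (b + c) \<cdot> (Ide C (gcomp A a) \<otimes> mc b c) \<cdot> Assoc C (gcomp A a) (gcomp A b) (gcomp A c)"
  proof (rule ginj_cancel[OF graded_A, of _ _ "a + b + c"])
    have "\<iota> (a + b + c) \<cdot> mc (a + b) c \<cdot> (mc a b \<otimes> Ide C (gcomp A c)) = (\<iota> (a + b + c) \<cdot> mc (a + b) c) \<cdot> (mc a b \<otimes> Ide C (gcomp A c))" by simp
    also have "\<dots> = m \<cdot> ((\<iota> (a + b) \<cdot> mc a b) \<otimes> \<iota> c)" unfolding mc(2)[of "a + b" c, symmetric] by simp
    also have "\<dots> = m \<cdot> (\<iota> a \<otimes> (m \<cdot> (\<iota> b \<otimes> \<iota> c))) \<cdot> Assoc C (gcomp A a) (gcomp A b) (gcomp A c)"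
      unfolding mc(2)[symmetric] by (subst mult_assoc_arr) simp_all
    also have "\<dots> = m \<cdot> (\<iota> a \<otimes> (\<iota> (b + c) \<cdot> mc b c)) \<cdot> Assoc C (gcomp A a) (gcomp A b) (gcomp A c)"
      unfolding mc(2) ..
    also have "\<dots> = (m \<cdot> (\<iota> a \<otimes> \<iota> (b + c))) \<cdot> (Ide C (gcomp A a) \<otimes> mc b c) \<cdot> Assoc C (gcomp A a) (gcomp A b) (gcomp A c)"
      by simp
    also have "\<dots> = \<iota> (a + b + c) \<cdot> mc a (b + c) \<cdot> (Ide C (gcomp A a) \<otimes> mc b c) \<cdot> Assoc C (gcomp A a) (gcomp A b) (gcomp A c)"
      unfolding mc(2) by (simp add: add.assoc)
    finally show "\<iota> (a + b + c) \<cdot> mc (a + b) c \<cdot> (mc a b \<otimes> Ide C (gcomp A c))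
      = \<iota> (a + b + c) \<cdot> mc a (b + c) \<cdot> (Ide C (gcomp A a) \<otimes> mc b c) \<cdot> Assoc C (gcomp A a) (gcomp A b) (gcomp A c)" .
  qed (simp_all add: Hom_iff add.assoc)
qed (simp_all add: Hom_iff add.assoc)

text \<open>In the degree n part of a product x a with a in A_n only the degree zero part of x
  counts: on the summand \<open>k\<close>, the degree \<open>k + n\<close> equals \<open>n\<close>
  only for \<open>k = 0\<close>.\<close>

lemma degree_zero_left:
  "\<pi> n \<cdot> m \<cdot> (Ide C (gobj A) \<otimes> \<iota> n) = mc 0 n \<cdot> (\<pi> 0 \<otimes> Ide C (gcomp A n))"
proof (rule coproduct_eqI[OF tensor_sequential_coproduct[OF graded_coproduct[OF graded_A], of "gcomp A n", THEN conjunct2]])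
  fix k
  have "(\<pi> n \<cdot> m \<cdot> (Ide C (gobj A) \<otimes> \<iota> n)) \<cdot> (\<iota> k \<otimes> Ide C (gcomp A n)) = \<pi> n \<cdot> (m \<cdot> (\<iota> k \<otimes> \<iota> n))" by simp
  also have "\<dots> = (\<pi> n \<cdot> \<iota> (k + n)) \<cdot> mc k n" unfolding mc(2) by simp
  also have "\<dots> = mc 0 n \<cdot> ((\<pi> 0 \<cdot> \<iota> k) \<otimes> Ide C (gcomp A n))"
    by (cases "k = 0") (simp_all add: gproj(2)[OF graded_A])
  finally show "(\<pi> n \<cdot> m \<cdot> (Ide C (gobj A) \<otimes> \<iota> n)) \<cdot> (\<iota> k \<otimes> Ide C (gcomp A n))
    = (mc 0 n \<cdot> (\<pi> 0 \<otimes> Ide C (gcomp A n))) \<cdot> (\<iota> k \<otimes> Ide C (gcomp A n))" by simp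
qed (simp_all add: Hom_iff)

lemma degree_zero_right:
  "\<pi> n \<cdot> m \<cdot> (\<iota> n \<otimes> Ide C (gobj A)) = mc n 0 \<cdot> (Ide C (gcomp A n) \<otimes> \<pi> 0)"
proof (rule coproduct_eqI[OF tensor_sequential_coproduct[OF graded_coproduct[OF graded_A], of "gcomp A n", THEN conjunct1]])
  fix k
  have "(\<pi> n \<cdot> m \<cdot> (\<iota> n \<otimes> Ide C (gobj A))) \<cdot> (Ide C (gcomp A n) \<otimes> \<iota> k) = \<pi> n \<cdot> (m \<cdot> (\<iota> n \<otimes> \<iota> k))" by simp
  also have "\<dots> = (\<pi> n \<cdot> \<iota> (n + k)) \<cdot> mc n k" unfolding mc(2) by simp
  also have "\<dots> = mc n 0 \<cdot> (Ide C (gcomp A n) \<otimes> (\<pi> 0 \<cdot> \<iota> k))"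
    by (cases "k = 0") (simp_all add: gproj(2)[OF graded_A])
  finally show "(\<pi> n \<cdot> m \<cdot> (\<iota> n \<otimes> Ide C (gobj A))) \<cdot> (Ide C (gcomp A n) \<otimes> \<iota> k)
    = (mc n 0 \<cdot> (Ide C (gcomp A n) \<otimes> \<pi> 0)) \<cdot> (Ide C (gcomp A n) \<otimes> \<iota> k)" by simp
qed (simp_all add: Hom_iff)

text \<open>\<open>degree_zero_left\<close> evaluated at x = 1. No homogeneity of the unit is
  presupposed; that is derived from this lemma.\<close>

lemma mc_unit_left: "mc 0 n \<cdot> ((\<pi> 0 \<cdot> u) \<otimes> Ide C (gcomp A n)) = LUni C (gcomp A n)"
proof -
  have "mc 0 n \<cdot> ((\<pi> 0 \<cdot> u) \<otimes> Ide C (gcomp A n)) = (mc 0 n \<cdot> (\<pi> 0 \<otimes> Ide C (gcomp A n))) \<cdot> (u \<otimes> Ide C (gcomp A n))" by simp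
  also have "\<dots> = \<pi> n \<cdot> (m \<cdot> (u \<otimes> Ide C (gobj A))) \<cdot> (Ide C (One C) \<otimes> \<iota> n)"
    unfolding degree_zero_left[symmetric] by (simp del: mult_simps(7,8))
  finally show ?thesis by simp
qed

lemma mc_unit_right: "mc n 0 \<cdot> (Ide C (gcomp A n) \<otimes> (\<pi> 0 \<cdot> u)) = RUni C (gcomp A n)"
proof -
  have "mc n 0 \<cdot> (Ide C (gcomp A n) \<otimes> (\<pi> 0 \<cdot> u)) = (mc n 0 \<cdot> (Ide C (gcomp A n) \<otimes> \<pi> 0)) \<cdot> (Ide C (gcomp A n) \<otimes> u)" by simp
  also have "\<dots> = \<pi> n \<cdot> (m \<cdot> (Ide C (gobj A) \<otimes> u)) \<cdot> (\<iota> n \<otimes> Ide C (One C))"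
    unfolding degree_zero_right[symmetric] by (simp del: mult_simps(7,8))
  finally show ?thesis by simp
qed

text \<open>The degree zero part \<open>e\<close> of the unit is a left unit, so that \<open>e = e 1 = 1\<close>.\<close>

lemma unit_degree_zero: "\<iota> 0 \<cdot> \<pi> 0 \<cdot> u = u"
proof -
  let ?A = "gobj A" and ?I = "One C"
  let ?e = "\<iota> 0 \<cdot> \<pi> 0 \<cdot> u"
  have e: "m \<cdot> (?e \<otimes> Ide C ?A) = LUni C ?A"
  proof (rule coproduct_eqI[OF tensor_sequential_coproduct[OF graded_coproduct[OF graded_A], of ?I, THEN conjunct1]])
    fix n
    have "(m \<cdot> (?e \<otimes> Ide C ?A)) \<cdot> (Ide C ?I \<otimes> \<iota> n) = (m \<cdot> (\<iota> 0 \<otimes> \<iota> n)) \<cdot> ((\<pi> 0 \<cdot> u) \<otimes> Ide C (gcomp A n))" by simp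
    also have "\<dots> = \<iota> n \<cdot> (mc 0 n \<cdot> ((\<pi> 0 \<cdot> u) \<otimes> Ide C (gcomp A n)))" unfolding mc(2) by simp
    also have "\<dots> = LUni C ?A \<cdot> (Ide C ?I \<otimes> \<iota> n)" unfolding mc_unit_left by simp
    finally show "(m \<cdot> (?e \<otimes> Ide C ?A)) \<cdot> (Ide C ?I \<otimes> \<iota> n) = LUni C ?A \<cdot> (Ide C ?I \<otimes> \<iota> n)" .
  qed (simp_all add: Hom_iff)
  \<comment> \<open>The product x 1 computed in two ways, for a left unit x.\<close>
  have eu: "x \<cdot> RUni C ?I = u \<cdot> LUni C ?I"
    if x: "m \<cdot> (x \<otimes> Ide C ?A) = LUni C ?A" and [simp]: "x \<in> Arr C" "Dom C x = ?I" "Cod C x = ?A" for x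
  proof -
    have "x \<cdot> RUni C ?I = (m \<cdot> (Ide C ?A \<otimes> u)) \<cdot> (x \<otimes> Ide C ?I)" by simp
    also have "\<dots> = (m \<cdot> (x \<otimes> Ide C ?A)) \<cdot> (Ide C ?I \<otimes> u)" by (simp del: mult_simps(7,8))
    also have "\<dots> = u \<cdot> LUni C ?I" unfolding x by simp
    finally show ?thesis .
  qed
  \<comment> \<open>Comparing with the instance for \<open>u\<close> itself avoids identifying
    \<open>LUni C ?I\<close> with \<open>RUni C ?I\<close>.\<close>
  have "?e \<cdot> RUni C ?I = u \<cdot> RUni C ?I" using eu[OF e] eu[of u] by simp
  then show ?thesis by (rule epi_cancel[OF iso_epi, rotated]) simp_all
qed

lemma D_simps [simp]: "aobj D = gcomp A 0" "amult D = mc 0 0" "aunit D = \<pi> 0 \<cdot> u"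
  by (simp_all add: deg_zero_alg_def)

lemma M_sel [simp]: "bobj M = gcomp A (Suc 0)" "lact M = mc 0 (Suc 0)" "ract M = mc (Suc 0) 0"
  by (simp_all add: deg_one_bimod_def)

lemma B_sel [simp]: "bobj B = gobj A" "lact B = m \<cdot> (\<iota> 0 \<otimes> Ide C (gobj A))" "ract B = m \<cdot> (Ide C (gobj A) \<otimes> \<iota> 0)"
  by (simp_all add: bimod_via_deg_zero_def)

lemma algebra_D: "Defs.algebra C D"
  using assoc_square_eq[OF mc_assoc[of 0 0 0]] mc_unit_left[of 0] mc_unit_right[of 0]
  by (simp add: algebra_def Hom_iff)

end

sublocale graded_algebra_in_category \<subseteq> algebra_in_category C "deg_zero_alg C A"
  by unfold_locales (rule algebra_D)

context graded_algebra_in_category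
begin

lemma bimodule_deg_one: "bimodule M"
  using mc_assoc[of 0 0 "Suc 0"] mc_assoc[of 0 "Suc 0" 0] mc_assoc[of "Suc 0" 0 0]
    mc_unit_left[of "Suc 0"] mc_unit_right[of "Suc 0"]
  by (simp add: bimodule_def Hom_iff)

text \<open>The unit of \<open>D\<close> is the projection of \<open>u\<close> to degree zero, so
  the unit laws rest on \<open>unit_degree_zero\<close>; the squares restrict associativity of
  \<open>m\<close>.\<close>

lemma bimodule_B: "bimodule B"
proof -
  let ?A = "gobj A"
  have 1: "assoc_square (gcomp A 0) (gcomp A 0) ?A (mc 0 0) (lact B) (lact B) (lact B)"
  proof (rule assoc_squareI)
    have "lact B \<cdot> (mc 0 0 \<otimes> Ide C ?A) = m \<cdot> ((\<iota> (0 + 0) \<cdot> mc 0 0) \<otimes> Ide C ?A)" by simp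
    also have "\<dots> = lact B \<cdot> (Ide C (gcomp A 0) \<otimes> lact B) \<cdot> Assoc C (gcomp A 0) (gcomp A 0) ?A"
      unfolding mc(2)[symmetric] by (subst mult_assoc_arr) simp_all
    finally show "lact B \<cdot> (mc 0 0 \<otimes> Ide C ?A) = lact B \<cdot> (Ide C (gcomp A 0) \<otimes> lact B) \<cdot> Assoc C (gcomp A 0) (gcomp A 0) ?A" .
  qed (simp_all add: Hom_iff)
  have 2: "assoc_square (gcomp A 0) ?A (gcomp A 0) (lact B) (ract B) (ract B) (lact B)"
  proof (rule assoc_squareI)
    have "ract B \<cdot> (lact B \<otimes> Ide C (gcomp A 0)) = m \<cdot> ((m \<cdot> (\<iota> 0 \<otimes> Ide C ?A)) \<otimes> \<iota> 0)" by simp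
    also have "\<dots> = lact B \<cdot> (Ide C (gcomp A 0) \<otimes> ract B) \<cdot> Assoc C (gcomp A 0) ?A (gcomp A 0)"
      by (subst mult_assoc_arr) simp_all
    finally show "ract B \<cdot> (lact B \<otimes> Ide C (gcomp A 0)) = lact B \<cdot> (Ide C (gcomp A 0) \<otimes> ract B) \<cdot> Assoc C (gcomp A 0) ?A (gcomp A 0)" .
  qed (simp_all add: Hom_iff)
  have 3: "assoc_square ?A (gcomp A 0) (gcomp A 0) (ract B) (ract B) (mc 0 0) (ract B)"
  proof (rule assoc_squareI)
    have "ract B \<cdot> (ract B \<otimes> Ide C (gcomp A 0)) = m \<cdot> ((m \<cdot> (Ide C ?A \<otimes> \<iota> 0)) \<otimes> \<iota> 0)" by simp
    also have "\<dots> = m \<cdot> (Ide C ?A \<otimes> (m \<cdot> (\<iota> 0 \<otimes> \<iota> 0))) \<cdot> Assoc C ?A (gcomp A 0) (gcomp A 0)"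
      by (subst mult_assoc_arr) simp_all
    also have "\<dots> = ract B \<cdot> (Ide C ?A \<otimes> mc 0 0) \<cdot> Assoc C ?A (gcomp A 0) (gcomp A 0)"
      unfolding mc(2) by simp
    finally show "ract B \<cdot> (ract B \<otimes> Ide C (gcomp A 0)) = ract B \<cdot> (Ide C ?A \<otimes> mc 0 0) \<cdot> Assoc C ?A (gcomp A 0) (gcomp A 0)" .
  qed (simp_all add: Hom_iff)
  show ?thesis unfolding bimodule_def
    using 1 2 3 by (simp add: Hom_iff unit_degree_zero)
qed

end

sublocale graded_algebra_in_category \<subseteq> tensor_algebra_in_category C "deg_zero_alg C A" "deg_one_bimod C A"
  by unfold_locales (rule bimodule_deg_one)

section \<open>The canonical homomorphism from the tensor algebra\<close>

context graded_algebra_in_category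
begin

abbreviation bal_zero (infixl "\<boxtimes>" 75) where "V \<boxtimes> W \<equiv> bal_tensor C D V W"
abbreviation "pwB \<equiv> bal_pow C D B"
abbreviation "ap \<equiv> bal_arr_pow C D M B (\<iota> (Suc 0))"
abbreviation "mp \<equiv> bal_mult_pow C A"

lemma bimodule_pwB: "bimodule (pwB n)"
  by (rule bimodule_in_category.bimodule_pow) (unfold_locales, rule bimodule_B)

lemma pwB_Suc [simp]: "bal_tensor C D (pwB (Suc n)) B = pwB (Suc (Suc n))"
  by (rule bal_pow.simps(3)[symmetric])

text \<open>Left linearity lets this arrow be the second factor of a balanced product; right
  linearity lets the powers be continued.\<close>

lemma inj_1_linear: "right_linear M B (\<iota> (Suc 0))" "left_linear M B (\<iota> (Suc 0))"
  using mc(2)[of "Suc 0" 0] mc(2)[of 0 "Suc 0"] by (simp_all add: right_linear_def left_linear_def Hom_iff)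

lemma ap_right_linear: "right_linear (pw n) (pwB n) (ap n)"
proof (induction n rule: induct_nat_012)
  case 0 then show ?case using Ide_linear(1)[OF regular_bimodule] by simp
next
  case 1 then show ?case using inj_1_linear by simp
next
  case (ge2 n)
  have "right_linear (pw (Suc n) \<boxtimes> M) (pwB (Suc n) \<boxtimes> B) (bal_tensor_arr C D (pw (Suc n)) M (pwB (Suc n)) B (ap (Suc n)) (\<iota> (Suc 0)))"
    by (intro bal_arr_right_linear bimodule_pow bimodule_pwB bimodule_B bimodule_deg_one ge2 inj_1_linear)
  then show ?case by simp
qed

lemma bal_mult: "bal_mult C A \<in> Hom C (bobj (B \<boxtimes> B)) (gobj A)" "bal_mult C A \<cdot> pr B B = m"
proof -
  let ?A = "gobj A"
  have "assoc_square ?A (gcomp A 0) ?A (ract B) m (lact B) m"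
  proof (rule assoc_squareI)
    have "m \<cdot> (ract B \<otimes> Ide C ?A) = m \<cdot> ((m \<cdot> (Ide C ?A \<otimes> \<iota> 0)) \<otimes> Ide C ?A)" by simp
    also have "\<dots> = m \<cdot> (Ide C ?A \<otimes> lact B) \<cdot> Assoc C ?A (gcomp A 0) ?A"
      by (subst mult_assoc_arr) simp_all
    finally show "m \<cdot> (ract B \<otimes> Ide C ?A) = m \<cdot> (Ide C ?A \<otimes> lact B) \<cdot> Assoc C ?A (gcomp A 0) ?A" .
  qed (simp_all add: Hom_iff)
  then have "\<exists>!e. e \<in> Hom C (bobj (B \<boxtimes> B)) ?A \<and> e \<cdot> pr B B = m"
    by (intro bal_factor[OF bimodule_B bimodule_B]) (simp_all add: Hom_iff)
  from theI'[OF this] show "bal_mult C A \<in> Hom C (bobj (B \<boxtimes> B)) (gobj A)" "bal_mult C A \<cdot> pr B B = m"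
    by (simp_all add: bal_mult_def Let_def)
qed

text \<open>Associativity of \<open>m\<close>, tested before balancing. It keeps the iterated
  multiplications right linear, without which the next one would not be defined.\<close>

lemma bal_mult_right_linear: "right_linear (B \<boxtimes> B) B (bal_mult C A)"
proof -
  let ?A = "gobj A" and ?D = "gcomp A 0" and ?b = "bal_mult C A"
  note [simp] = HomD[OF bal_mult(1)] HomD[OF pr_Hom[OF bimodule_B bimodule_B], simplified]
    bimodule_simps[OF bimodule_bal[OF bimodule_B bimodule_B], simplified]
  have e: "is_epi C (pr B B \<otimes> Ide C ?D)"
    by (intro tensor_epi pr_epi bimodule_B Ide_epi) simp
  have "(?b \<cdot> ract (B \<boxtimes> B)) \<cdot> (pr B B \<otimes> Ide C ?D) = ?b \<cdot> (ract (B \<boxtimes> B) \<cdot> (pr B B \<otimes> Ide C ?D))" by simp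
  also have "\<dots> = (?b \<cdot> pr B B) \<cdot> (Ide C ?A \<otimes> ract B) \<cdot> Assoc C ?A ?A ?D"
    using assoc_square_eq[OF ract_bal(2)[OF bimodule_B bimodule_B]] by simp
  also have "\<dots> = m \<cdot> (Ide C ?A \<otimes> (m \<cdot> (Ide C ?A \<otimes> \<iota> 0))) \<cdot> Assoc C ?A ?A ?D"
    unfolding bal_mult(2) by simp
  also have "\<dots> = m \<cdot> ((m \<cdot> (Ide C ?A \<otimes> Ide C ?A)) \<otimes> \<iota> 0)"
    by (subst mult_assoc_arr) simp_all
  also have "\<dots> = m \<cdot> ((?b \<cdot> pr B B) \<otimes> \<iota> 0)" unfolding bal_mult(2) by simp
  also have "\<dots> = (ract B \<cdot> (?b \<otimes> Ide C ?D)) \<cdot> (pr B B \<otimes> Ide C ?D)" by simp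
  finally have "?b \<cdot> ract (B \<boxtimes> B) = ract B \<cdot> (?b \<otimes> Ide C ?D)"
    by - (rule epi_cancel[OF e], simp_all)
  then show ?thesis by (simp add: right_linear_def Hom_iff)
qed

lemma mp_right_linear: "right_linear (pwB n) B (mp n)"
proof (induction n rule: induct_nat_012)
  case 0 then show ?case using mc(2)[of 0 0] by (simp add: right_linear_def Hom_iff)
next
  case 1 then show ?case using Ide_linear(1)[OF bimodule_B] by simp
next
  case (ge2 n)
  have "right_linear (pwB (Suc n) \<boxtimes> B) (B \<boxtimes> B) (bal_tensor_arr C D (pwB (Suc n)) B B B (mp (Suc n)) (Ide C (bobj B)))"
    by (intro bal_arr_right_linear bimodule_pwB bimodule_B ge2 Ide_linear)
  from right_linear_comp[OF this bal_mult_right_linear]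
  show ?case by (simp add: Let_def bimodule_bal bimodule_pwB bimodule_B)
qed

text \<open>The formula for \<phi> in degree \<open>n\<close> before projection. With values in all
  of A, multiplicativity is an identity for \<open>m\<close> and can be proved before
  homogeneity.\<close>

definition "\<psi> n = mp n \<cdot> ap n"

lemma psi_right_linear: "right_linear (pw n) B (\<psi> n)"
  unfolding \<psi>_def by (intro right_linear_comp[OF ap_right_linear mp_right_linear] bimodule_pow bimodule_pwB bimodule_B)

lemma psi_Hom: "\<psi> n \<in> Hom C (X n) (gobj A)"
  using psi_right_linear[of n] by (simp add: right_linear_def)

lemmas psi_simps [simp] = HomD(1-3)[OF psi_Hom]

lemma psi_0: "\<psi> 0 = \<iota> 0"
  by (simp add: \<psi>_def)

lemma psi_1: "\<psi> (Suc 0) = \<iota> (Suc 0)"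
  by (simp add: \<psi>_def)

text \<open>Unwinds the balanced products: moving the canonical projections through the two induced
  arrows leaves the ordinary multiplication by A_1.\<close>

lemma psi_Suc: "\<psi> (Suc n) \<cdot> tm n (Suc 0) = m \<cdot> (\<psi> n \<otimes> \<iota> (Suc 0))"
proof (cases n)
  case 0 then show ?thesis using mc(2)[of 0 "Suc 0"] by (simp add: tm_0_left psi_0 psi_1)
next
  case (Suc k)
  let ?I = "Ide C (gobj A)"
  let ?F = "bal_tensor_arr C D (pw n) M (pwB n) B (ap n) (\<iota> (Suc 0))"
  let ?G = "bal_tensor_arr C D (pwB n) B B B (mp n) ?I"
  have F: "?F \<in> Hom C (bobj (pw n \<boxtimes> M)) (bobj (pwB n \<boxtimes> B))" "?F \<cdot> pr (pw n) M = pr (pwB n) B \<cdot> (ap n \<otimes> \<iota> (Suc 0))"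
    by (intro bal_arr bimodule_pow bimodule_pwB bimodule_B bimodule_deg_one ap_right_linear inj_1_linear)+
  have G: "?G \<in> Hom C (bobj (pwB n \<boxtimes> B)) (bobj (B \<boxtimes> B))" "?G \<cdot> pr (pwB n) B = pr B B \<cdot> (mp n \<otimes> ?I)"
    using bal_arr[OF bimodule_pwB[of n] bimodule_B bimodule_B bimodule_B mp_right_linear Ide_linear(2)[OF bimodule_B]] by simp_all
  have aH: "ap n \<in> Hom C (X n) (bobj (pwB n))" using ap_right_linear[of n] by (simp add: right_linear_def)
  have mH: "mp n \<in> Hom C (bobj (pwB n)) (gobj A)" using mp_right_linear[of n] by (simp add: right_linear_def)
  note [simp] = HomD[OF F(1)] HomD[OF G(1)] HomD[OF aH] HomD[OF mH] HomD[OF bal_mult(1)]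
    HomD[OF pr_Hom[OF bimodule_pow[of n] bimodule_deg_one], simplified] HomD[OF pr_Hom[OF bimodule_pwB[of n] bimodule_B], simplified]
    HomD[OF pr_Hom[OF bimodule_B bimodule_B], simplified]
  have "\<psi> (Suc n) = bal_mult C A \<cdot> ?G \<cdot> ?F"
    using Suc HomD[OF F(1)] HomD[OF G(1)] by (simp add: \<psi>_def Let_def)
  moreover have "tm n (Suc 0) = pr (pw n) M" using Suc tm_1 by simp
  ultimately have "\<psi> (Suc n) \<cdot> tm n (Suc 0) = bal_mult C A \<cdot> ?G \<cdot> (?F \<cdot> pr (pw n) M)" by simp
  also have "\<dots> = bal_mult C A \<cdot> (?G \<cdot> pr (pwB n) B) \<cdot> (ap n \<otimes> \<iota> (Suc 0))" unfolding F(2) by simp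
  also have "\<dots> = (bal_mult C A \<cdot> pr B B) \<cdot> ((mp n \<cdot> ap n) \<otimes> \<iota> (Suc 0))" unfolding G(2) by simp
  also have "\<dots> = m \<cdot> (\<psi> n \<otimes> \<iota> (Suc 0))" unfolding bal_mult(2) \<psi>_def ..
  finally show ?thesis .
qed

text \<open>Induction on \<open>q\<close>: the last factor A_1 is split off by \<open>tm_Suc\<close>
  in T and by associativity in A, and then the epimorphism that splits it off is cancelled.\<close>

lemma psi_mult: "\<psi> (p + q) \<cdot> tm p q = m \<cdot> (\<psi> p \<otimes> \<psi> q)"
proof (induction q)
  case 0 then show ?case using psi_right_linear[of p] by (simp add: tm_0_right right_linear_def psi_0)
next
  case (Suc q)
  let ?A1 = "gcomp A (Suc 0)"
  have e: "is_epi C ((Ide C (X p) \<otimes> tm q (Suc 0)) \<cdot> Assoc C (X p) (X q) ?A1)"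
    by (intro epi_comp[OF iso_epi] tensor_epi tm_1_epi Ide_epi) simp_all
  have [simp]: "tm (p + q) (Suc 0) \<in> Arr C" "Cod C (tm (p + q) (Suc 0)) = X (Suc (p + q))" "Cod C (tm q (Suc 0)) = X (Suc q)"
    "Cod C (tm p (Suc q)) = X (Suc (p + q))"
    using tm_simps(3)[of "p + q" "Suc 0"] tm_simps(3)[of q "Suc 0"] tm_simps(3)[of p "Suc q"] by simp_all
  have "(\<psi> (Suc (p + q)) \<cdot> tm p (Suc q)) \<cdot> ((Ide C (X p) \<otimes> tm q (Suc 0)) \<cdot> Assoc C (X p) (X q) ?A1)
      = \<psi> (Suc (p + q)) \<cdot> (tm p (Suc q) \<cdot> (Ide C (X p) \<otimes> tm q (Suc 0)) \<cdot> Assoc C (X p) (X q) ?A1)" by simp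
  also have "\<dots> = (\<psi> (Suc (p + q)) \<cdot> tm (p + q) (Suc 0)) \<cdot> (tm p q \<otimes> Ide C ?A1)"
    using assoc_square_eq[OF tm_Suc[of p q]] by simp
  also have "\<dots> = m \<cdot> ((\<psi> (p + q) \<cdot> tm p q) \<otimes> \<iota> (Suc 0))" unfolding psi_Suc by simp
  also have "\<dots> = m \<cdot> (\<psi> p \<otimes> (m \<cdot> (\<psi> q \<otimes> \<iota> (Suc 0)))) \<cdot> Assoc C (X p) (X q) ?A1"
    unfolding Suc by (subst mult_assoc_arr) simp_all
  also have "\<dots> = (m \<cdot> (\<psi> p \<otimes> \<psi> (Suc q))) \<cdot> ((Ide C (X p) \<otimes> tm q (Suc 0)) \<cdot> Assoc C (X p) (X q) ?A1)"
    unfolding psi_Suc[symmetric] by simp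
  finally have "\<psi> (Suc (p + q)) \<cdot> tm p (Suc q) = m \<cdot> (\<psi> p \<otimes> \<psi> (Suc q))"
    by - (rule epi_cancel[OF e], simp_all)
  then show ?case by simp
qed

definition "\<phi> n = \<pi> n \<cdot> \<psi> n"

lemma phi_Hom: "\<phi> n \<in> Hom C (X n) (gcomp A n)"
  by (simp add: \<phi>_def Hom_iff)

lemmas phi_simps [simp] = HomD(1-3)[OF phi_Hom]

text \<open>Homogeneity: by \<open>psi_Suc\<close> and the grading of \<open>m\<close>, the
  composite with the epimorphism \<open>tm n (Suc 0)\<close> factors through
  \<open>\<iota> (Suc n)\<close>, where \<open>\<iota> (Suc n) \<cdot> \<pi> (Suc n)\<close> acts as
  identity.\<close>

lemma psi_phi: "\<psi> n = \<iota> n \<cdot> \<phi> n"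
proof (induction n)
  case 0 then show ?case by (simp add: \<phi>_def psi_0)
next
  case (Suc n)
  have [simp]: "Cod C (tm n (Suc 0)) = X (Suc n)" using tm_simps(3)[of n "Suc 0"] by simp
  have mcC [simp]: "Cod C (mc n (Suc 0)) = gcomp A (Suc n)" using mc_simps(3)[of n "Suc 0"] by simp
  have s: "\<psi> (Suc n) \<cdot> tm n (Suc 0) = \<iota> (Suc n) \<cdot> mc n (Suc 0) \<cdot> (\<phi> n \<otimes> Ide C (gcomp A (Suc 0)))"
  proof -
    have "\<psi> (Suc n) \<cdot> tm n (Suc 0) = (m \<cdot> (\<iota> n \<otimes> \<iota> (Suc 0))) \<cdot> (\<phi> n \<otimes> Ide C (gcomp A (Suc 0)))"
      unfolding psi_Suc Suc by simp
    then show ?thesis unfolding mc(2) by simp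
  qed
  have "(\<iota> (Suc n) \<cdot> \<phi> (Suc n)) \<cdot> tm n (Suc 0) = \<iota> (Suc n) \<cdot> \<pi> (Suc n) \<cdot> (\<psi> (Suc n) \<cdot> tm n (Suc 0))"
    by (simp add: \<phi>_def)
  also have "\<dots> = \<psi> (Suc n) \<cdot> tm n (Suc 0)" unfolding s by simp
  finally show ?case
    by - (rule sym, rule epi_cancel[OF tm_1_epi[of n]], simp_all)
qed

lemma phi_mult: "\<phi> (p + q) \<cdot> tm p q = mc p q \<cdot> (\<phi> p \<otimes> \<phi> q)"
proof -
  have "\<phi> (p + q) \<cdot> tm p q = \<pi> (p + q) \<cdot> (\<psi> (p + q) \<cdot> tm p q)" by (simp add: \<phi>_def)
  also have "\<dots> = \<pi> (p + q) \<cdot> (m \<cdot> (\<iota> p \<otimes> \<iota> q)) \<cdot> (\<phi> p \<otimes> \<phi> q)"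
    unfolding psi_mult unfolding psi_phi by simp
  also have "\<dots> = mc p q \<cdot> (\<phi> p \<otimes> \<phi> q)" unfolding mc(2) by simp
  finally show ?thesis .
qed

lemma phi_0: "\<phi> 0 = Ide C (gcomp A 0)"
  by (simp add: \<phi>_def psi_0)

lemma phi_1: "\<phi> (Suc 0) = Ide C (gcomp A (Suc 0))"
  by (simp add: \<phi>_def psi_1)

definition "is_canonical f \<longleftrightarrow> alg_hom C (alg_of T) (alg_of A) f \<and>
    f \<cdot> ginj T 0 = \<iota> 0 \<and> f \<cdot> ginj T 1 = \<iota> 1"

text \<open>Gives at once uniqueness and the formula for the components.\<close>

lemma canonical_inj:
  assumes "is_canonical f"
  shows "f \<in> Hom C (gobj T) (gobj A)" "f \<cdot> ginj T n = \<psi> n"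
proof -
  show f: "f \<in> Hom C (gobj T) (gobj A)"
    using assms by (simp add: is_canonical_def alg_hom_def alg_of_def)
  note [simp] = HomD(1-3)[OF f]
  have f0: "f \<cdot> ginj T 0 = \<iota> 0" and f1: "f \<cdot> ginj T (Suc 0) = \<iota> (Suc 0)" and fm: "f \<cdot> gmult T = m \<cdot> (f \<otimes> f)"
    using assms by (simp_all add: is_canonical_def alg_hom_def alg_of_def)
  show "f \<cdot> ginj T n = \<psi> n"
  proof (induction n)
    case 0 then show ?case by (simp add: f0 psi_0)
  next
    case (Suc n)
    have [simp]: "Cod C (tm n (Suc 0)) = X (Suc n)" using tm_simps(3)[of n "Suc 0"] by simp
    have "(f \<cdot> ginj T (Suc n)) \<cdot> tm n (Suc 0) = f \<cdot> (gmult T \<cdot> (ginj T n \<otimes> ginj T (Suc 0)))"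
      unfolding gmult_T(2) by simp
    also have "\<dots> = (f \<cdot> gmult T) \<cdot> (ginj T n \<otimes> ginj T (Suc 0))" by simp
    also have "\<dots> = m \<cdot> ((f \<cdot> ginj T n) \<otimes> (f \<cdot> ginj T (Suc 0)))" unfolding fm by simp
    also have "\<dots> = \<psi> (Suc n) \<cdot> tm n (Suc 0)" unfolding Suc f1 psi_Suc ..
    finally show ?case by - (rule epi_cancel[OF tm_1_epi[of n]], simp_all)
  qed
qed

lemma canonical_ex1: "\<exists>!f. is_canonical f"
proof -
  have "\<exists>!f. f \<in> Hom C (gobj T) (gobj A) \<and> (\<forall>n\<in>UNIV. f \<cdot> ginj T n = \<psi> n)"
    by (rule coproduct_ex[OF T_coproduct]) (simp_all add: psi_Hom)
  then obtain f where f: "f \<in> Hom C (gobj T) (gobj A)" "\<And>n. f \<cdot> ginj T n = \<psi> n" by blast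
  note [simp] = HomD(1-3)[OF f(1)]
  have fm: "f \<cdot> gmult T = m \<cdot> (f \<otimes> f)"
  proof (rule tensor_coproduct_eqI[OF T_coproduct T_coproduct])
    fix p q
    have "(f \<cdot> gmult T) \<cdot> (ginj T p \<otimes> ginj T q) = f \<cdot> (gmult T \<cdot> (ginj T p \<otimes> ginj T q))" by simp
    also have "\<dots> = (f \<cdot> ginj T (p + q)) \<cdot> tm p q" unfolding gmult_T(2) by simp
    also have "\<dots> = m \<cdot> ((f \<cdot> ginj T p) \<otimes> (f \<cdot> ginj T q))" unfolding f(2) psi_mult ..
    finally show "(f \<cdot> gmult T) \<cdot> (ginj T p \<otimes> ginj T q) = (m \<cdot> (f \<otimes> f)) \<cdot> (ginj T p \<otimes> ginj T q)" by simp
  qed (simp_all add: Hom_iff)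
  \<comment> \<open>The unit of T is the image of that of A_0; it returns to \<open>u\<close>
    because the latter lives in degree zero.\<close>
  have "f \<cdot> gunit T = (f \<cdot> ginj T 0) \<cdot> aunit D" by simp
  also have "\<dots> = u" unfolding f(2) psi_0 by (simp add: unit_degree_zero)
  finally have fu: "f \<cdot> gunit T = u" .
  have "is_canonical f"
    unfolding is_canonical_def alg_hom_def using algebra_T algebra_A fm fu f psi_0 psi_1
    by (simp add: alg_of_def)
  moreover have "g = f" if g: "is_canonical g" for g
    by (rule coproduct_eqI[OF T_coproduct canonical_inj(1)[OF g] f(1)]) (simp add: canonical_inj(2)[OF g] f(2))
  ultimately show ?thesis by blast
qed

lemma canonical_graded:
  assumes "is_canonical f"
  shows "graded_alg_hom C T A f" "gmor_comp C T A f n = \<phi> n"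
proof -
  have c: "\<phi> n \<in> Hom C (gcomp T n) (gcomp A n) \<and> f \<cdot> ginj T n = \<iota> n \<cdot> \<phi> n" for n
    using canonical_inj(2)[OF assms] phi_Hom psi_phi by simp
  show "graded_alg_hom C T A f"
    unfolding graded_alg_hom_def graded_morphism_def
    using graded_algebra_T graded_algebra assms canonical_inj(1)[OF assms] c
    by (auto simp: is_canonical_def)
  show "gmor_comp C T A f n = \<phi> n"
    using c by (intro gmor_compI[OF graded_T graded_A]) auto
qed

end

section \<open>Strong grading and epimorphic components\<close>

context graded_algebra_in_category
begin

text \<open>In the square of \<open>phi_mult\<close> for degrees \<open>n\<close> and 1, the arrow
  \<open>\<phi> (Suc 0)\<close> is an identity, so epimorphy passes from \<open>\<phi> n\<close> to
  \<open>\<phi> (Suc n)\<close>.\<close>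

lemma phi_epi:
  assumes a: "\<And>a. is_epi C (mc a (Suc 0))"
  shows "is_epi C (\<phi> n)"
proof (induction n)
  case 0 then show ?case by (simp add: phi_0 Ide_epi)
next
  case (Suc n)
  have "is_epi C (\<phi> (n + Suc 0) \<cdot> tm n (Suc 0))"
    unfolding phi_mult by (intro epi_comp tensor_epi Suc a) (simp_all add: phi_1 Ide_epi)
  then have "is_epi C (\<phi> (Suc n) \<cdot> tm n (Suc 0))" by simp
  then show ?case
    by (rule epi_of_comp) (use tm_simps(3)[of n "Suc 0"] in simp_all)
qed

text \<open>\<open>tm i j\<close> is epi in all degrees, so one side of the square
  \<open>phi_mult\<close> is epi and the other ends in \<open>mc i j\<close>. This is the step from
  right multiplication by A_1 to all degrees.\<close>

lemma mc_epi:
  assumes "\<And>n. is_epi C (\<phi> n)"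
  shows "is_epi C (mc i j)"
proof -
  have "is_epi C (mc i j \<cdot> (\<phi> i \<otimes> \<phi> j))"
    unfolding phi_mult[symmetric] by (intro epi_comp tm_epi assms) simp
  then show ?thesis by (rule epi_of_comp) simp_all
qed

lemma strongly_graded_iff_right: "strongly_graded C A \<longleftrightarrow> (\<forall>a. is_epi C (mc a (Suc 0)))"
  unfolding strongly_graded_def using phi_epi mc_epi by blast

lemma strongly_graded_iff_phi: "strongly_graded C A \<longleftrightarrow> (\<forall>n. is_epi C (\<phi> n))"
  unfolding strongly_graded_iff_right using phi_epi mc_epi by blast

text \<open>\<open>f\<close> is the direct sum of the \<open>\<phi> n\<close>. Projections to a
  degree are epi, which gives one direction; injections are jointly epi, which gives the
  other.\<close>

lemma canonical_epi_iff:
  assumes f: "is_canonical f"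
  shows "is_epi C f \<longleftrightarrow> (\<forall>n. is_epi C (\<phi> n))"
proof
  note [simp] = HomD(1-3)[OF canonical_inj(1)[OF f]]
  have fi: "f \<cdot> ginj T n = \<iota> n \<cdot> \<phi> n" for n using canonical_inj(2)[OF f] psi_phi by simp
  note pT = gproj[OF graded_T, unfolded T_sel(2)]
  note [simp] = HomD(1-3)[OF pT(1)]
  show "\<forall>n. is_epi C (\<phi> n)" if e: "is_epi C f"
  proof
    fix n
    have "\<pi> n \<cdot> f = \<phi> n \<cdot> gproj C T n"
    proof (rule coproduct_eqI[OF T_coproduct])
      fix k
      have "(\<pi> n \<cdot> f) \<cdot> ginj T k = (\<pi> n \<cdot> \<iota> k) \<cdot> \<phi> k" using fi[of k] by simp
      also have "\<dots> = \<phi> n \<cdot> (gproj C T n \<cdot> ginj T k)"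
        unfolding pT(2) gproj(2)[OF graded_A] by simp
      finally show "(\<pi> n \<cdot> f) \<cdot> ginj T k = (\<phi> n \<cdot> gproj C T n) \<cdot> ginj T k" by simp
    qed (simp_all add: Hom_iff)
    moreover have "is_epi C (\<pi> n \<cdot> f)" by (intro epi_comp e gproj_epi[OF graded_A]) simp
    ultimately show "is_epi C (\<phi> n)" by - (rule epi_of_comp[of "\<phi> n" "gproj C T n"], simp_all)
  qed
  show "is_epi C f" if e: "\<forall>n. is_epi C (\<phi> n)"
  proof (rule epiI)
    fix x y assume [simp]: "x \<in> Arr C" "y \<in> Arr C" "Dom C x = Cod C f" "Dom C y = Cod C f" "Cod C x = Cod C y"
      and eq: "x \<cdot> f = y \<cdot> f"
    show "x = y"
    proof (rule graded_eqI[OF graded_A])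
      fix n
      have "(x \<cdot> \<iota> n) \<cdot> \<phi> n = (x \<cdot> f) \<cdot> ginj T n" using fi[of n] by simp
      also have "\<dots> = (y \<cdot> \<iota> n) \<cdot> \<phi> n" unfolding eq using fi[of n] by simp
      finally show "x \<cdot> \<iota> n = y \<cdot> \<iota> n" using e by - (rule epi_cancel[of "\<phi> n"], simp_all)
    qed (simp_all add: Hom_iff)
  qed simp
qed


subsection \<open>The ideal of elements of positive degree\<close>

abbreviation "\<nu> \<equiv> tail_inj C A"
abbreviation "N n \<equiv> coprod_obj C {n..} (gcomp A)"
abbreviation "\<nu>\<iota> n \<equiv> coprod_inj C {n..} (gcomp A)"

lemma tail_coproduct: "is_coproduct C {n..} (gcomp A) (N n) (\<nu>\<iota> n)"
  by (rule chosen_coproduct) simp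

lemma tail:
  shows tail_Hom: "\<nu> n \<in> Hom C (N n) (gobj A)"
    and tail_inj: "n \<le> k \<Longrightarrow> \<nu> n \<cdot> \<nu>\<iota> n k = \<iota> k"
  using copair[OF tail_coproduct[of n], of "gobj A" \<iota>] by (simp_all add: tail_inj_def Hom_iff)

lemmas tail_simps [simp] = HomD[OF tail_Hom] tail_inj

lemma tail_inj_simps [simp]:
  "n \<le> k \<Longrightarrow> \<nu>\<iota> n k \<in> Arr C" "n \<le> k \<Longrightarrow> Dom C (\<nu>\<iota> n k) = gcomp A k" "n \<le> k \<Longrightarrow> Cod C (\<nu>\<iota> n k) = N n"
  using HomD[OF coproduct_Hom[OF tail_coproduct, of k n]] by simp_all

text \<open>The retraction is the truncation of A that kills all degrees below
  \<open>n\<close>.\<close>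

lemma tail_retraction:
  obtains s where "s \<in> Hom C (gobj A) (N n)" "s \<cdot> \<nu> n = Ide C (N n)"
    "\<And>k. n \<le> k \<Longrightarrow> s \<cdot> \<iota> k = \<nu>\<iota> n k"
proof -
  have "\<exists>!s. s \<in> Hom C (gobj A) (N n) \<and> (\<forall>k\<in>UNIV. s \<cdot> \<iota> k = (if n \<le> k then \<nu>\<iota> n k else Zer C (gcomp A k) (N n)))"
    by (rule coproduct_ex[OF graded_coproduct[OF graded_A]]) (simp_all add: Hom_iff)
  then obtain s where s: "s \<in> Hom C (gobj A) (N n)"
    and s': "\<forall>k\<in>UNIV. s \<cdot> \<iota> k = (if n \<le> k then \<nu>\<iota> n k else Zer C (gcomp A k) (N n))" by blast
  have sk: "s \<cdot> \<iota> k = \<nu>\<iota> n k" if "n \<le> k" for k using s' that by simp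
  note [simp] = HomD(1-3)[OF s]
  have "s \<cdot> \<nu> n = Ide C (N n)"
  proof (rule coproduct_eqI[OF tail_coproduct])
    fix k assume "k \<in> {n..}"
    then have [simp]: "n \<le> k" by simp
    show "(s \<cdot> \<nu> n) \<cdot> \<nu>\<iota> n k = Ide C (N n) \<cdot> \<nu>\<iota> n k" by (simp add: sk)
  qed (simp_all add: Hom_iff)
  then show thesis using that s sk by blast
qed

lemma tail_mono: "is_mono C (\<nu> n)"
proof -
  obtain s where s: "s \<in> Hom C (gobj A) (N n)" "s \<cdot> \<nu> n = Ide C (N n)" by (rule tail_retraction)
  show ?thesis by (rule split_mono[of _ s]) (use s HomD[OF s(1)] in simp_all)
qed

text \<open>\<open>N 0\<close> is a chosen sum and need not be the object \<open>gobj A\<close>, so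
  the case of exponent 0 in (d) is a genuine isomorphism of subobjects.\<close>

lemma tail_0: "same_subobject C (\<nu> 0) (Ide C (gobj A))"
proof -
  obtain s where s: "s \<in> Hom C (gobj A) (N 0)" "\<And>k. s \<cdot> \<iota> k = \<nu>\<iota> 0 k"
    using tail_retraction[of 0] by (metis le0)
  note [simp] = HomD(1-3)[OF s(1)]
  have "\<nu> 0 \<cdot> s = Ide C (gobj A)"
    by (rule graded_eqI[OF graded_A]) (simp_all add: Hom_iff s(2) del: atLeast_0)
  then show ?thesis
    by (intro same_subobjectI[of _ _ "\<nu> 0" s] tail_mono iso_mono) (simp_all add: Hom_iff)
qed

lemma tail_mult:
  obtains \<kappa> where "\<kappa> \<in> Hom C (N n \<odot> N (Suc 0)) (N (Suc n))"
    "m \<cdot> (\<nu> n \<otimes> \<nu> (Suc 0)) = \<nu> (Suc n) \<cdot> \<kappa>"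
    "\<And>a b. n \<le> a \<Longrightarrow> Suc 0 \<le> b \<Longrightarrow> \<kappa> \<cdot> (\<nu>\<iota> n a \<otimes> \<nu>\<iota> (Suc 0) b) = \<nu>\<iota> (Suc n) (a + b) \<cdot> mc a b"
proof -
  have "\<exists>!\<kappa>. \<kappa> \<in> Hom C (N n \<odot> N (Suc 0)) (N (Suc n)) \<and>
    (\<forall>a\<in>{n..}. \<forall>b\<in>{Suc 0..}. \<kappa> \<cdot> (\<nu>\<iota> n a \<otimes> \<nu>\<iota> (Suc 0) b) = \<nu>\<iota> (Suc n) (a + b) \<cdot> mc a b)"
    by (rule tensor_coproduct_ex[OF tail_coproduct tail_coproduct]) (auto simp: Hom_iff)
  then obtain \<kappa> where \<kappa>: "\<kappa> \<in> Hom C (N n \<odot> N (Suc 0)) (N (Suc n))"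
    and \<kappa>': "\<forall>a\<in>{n..}. \<forall>b\<in>{Suc 0..}. \<kappa> \<cdot> (\<nu>\<iota> n a \<otimes> \<nu>\<iota> (Suc 0) b) = \<nu>\<iota> (Suc n) (a + b) \<cdot> mc a b"
    by blast
  have \<kappa>j: "\<kappa> \<cdot> (\<nu>\<iota> n a \<otimes> \<nu>\<iota> (Suc 0) b) = \<nu>\<iota> (Suc n) (a + b) \<cdot> mc a b"
    if "n \<le> a" "Suc 0 \<le> b" for a b using \<kappa>' that by simp
  note [simp] = HomD(1-3)[OF \<kappa>]
  have "m \<cdot> (\<nu> n \<otimes> \<nu> (Suc 0)) = \<nu> (Suc n) \<cdot> \<kappa>"
  proof (rule tensor_coproduct_eqI[OF tail_coproduct tail_coproduct])
    fix a b assume ab: "a \<in> {n..}" "b \<in> {Suc 0..}"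
    then have [simp]: "n \<le> a" "Suc 0 \<le> b" "Suc n \<le> a + b" by auto
    have "(m \<cdot> (\<nu> n \<otimes> \<nu> (Suc 0))) \<cdot> (\<nu>\<iota> n a \<otimes> \<nu>\<iota> (Suc 0) b) = m \<cdot> (\<iota> a \<otimes> \<iota> b)" by simp
    also have "\<dots> = (\<nu> (Suc n) \<cdot> \<nu>\<iota> (Suc n) (a + b)) \<cdot> mc a b" unfolding mc(2) by (simp del: Comp_assoc')
    also have "\<dots> = \<nu> (Suc n) \<cdot> (\<nu>\<iota> (Suc n) (a + b) \<cdot> mc a b)" by (subst Comp_assoc') simp_all
    also have "\<dots> = (\<nu> (Suc n) \<cdot> \<kappa>) \<cdot> (\<nu>\<iota> n a \<otimes> \<nu>\<iota> (Suc 0) b)"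
      unfolding \<kappa>j[OF \<open>n \<le> a\<close> \<open>Suc 0 \<le> b\<close>, symmetric] by simp
    finally show "(m \<cdot> (\<nu> n \<otimes> \<nu> (Suc 0))) \<cdot> (\<nu>\<iota> n a \<otimes> \<nu>\<iota> (Suc 0) b)
      = (\<nu> (Suc n) \<cdot> \<kappa>) \<cdot> (\<nu>\<iota> n a \<otimes> \<nu>\<iota> (Suc 0) b)" .
  qed (simp_all add: Hom_iff)
  then show thesis using that \<kappa> \<kappa>j by blast
qed

lemma tail_mult_epi:
  assumes epi: "\<And>a. is_epi C (mc a (Suc 0))"
  obtains \<kappa> where "\<kappa> \<in> Hom C (N n \<odot> N (Suc 0)) (N (Suc n))" "is_epi C \<kappa>"
    "m \<cdot> (\<nu> n \<otimes> \<nu> (Suc 0)) = \<nu> (Suc n) \<cdot> \<kappa>"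
proof -
  obtain \<kappa> where \<kappa>: "\<kappa> \<in> Hom C (N n \<odot> N (Suc 0)) (N (Suc n))" "m \<cdot> (\<nu> n \<otimes> \<nu> (Suc 0)) = \<nu> (Suc n) \<cdot> \<kappa>"
    and \<kappa>j: "\<And>a b. n \<le> a \<Longrightarrow> Suc 0 \<le> b \<Longrightarrow> \<kappa> \<cdot> (\<nu>\<iota> n a \<otimes> \<nu>\<iota> (Suc 0) b) = \<nu>\<iota> (Suc n) (a + b) \<cdot> mc a b"
    by (rule tail_mult[of n]) (rule that)
  note [simp] = HomD(1-3)[OF \<kappa>(1)]
  have "is_epi C \<kappa>"
  proof (rule epiI)
    fix x y assume [simp]: "x \<in> Arr C" "y \<in> Arr C" "Dom C x = Cod C \<kappa>" "Dom C y = Cod C \<kappa>" "Cod C x = Cod C y"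
      and eq: "x \<cdot> \<kappa> = y \<cdot> \<kappa>"
    show "x = y"
    proof (rule coproduct_eqI[OF tail_coproduct])
      fix k assume "k \<in> {Suc n..}"
      \<comment> \<open>Every degree above \<open>n\<close> is \<open>a + 1\<close> with
        \<open>a\<close> at least \<open>n\<close>, so the summands with second degree 1 already
        suffice.\<close>
      then obtain a where k: "k = Suc a" and [simp]: "n \<le> a" by (cases k) auto
      have mcC [simp]: "Cod C (mc a (Suc 0)) = gcomp A (Suc a)" using mc_simps(3)[of a "Suc 0"] by simp
      have j: "\<kappa> \<cdot> (\<nu>\<iota> n a \<otimes> \<nu>\<iota> (Suc 0) (Suc 0)) = \<nu>\<iota> (Suc n) (Suc a) \<cdot> mc a (Suc 0)"
        using \<kappa>j[of a "Suc 0"] by simp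
      have "(x \<cdot> \<nu>\<iota> (Suc n) (Suc a)) \<cdot> mc a (Suc 0) = (x \<cdot> \<kappa>) \<cdot> (\<nu>\<iota> n a \<otimes> \<nu>\<iota> (Suc 0) (Suc 0))" using j by simp
      also have "\<dots> = (y \<cdot> \<nu>\<iota> (Suc n) (Suc a)) \<cdot> mc a (Suc 0)" unfolding eq using j by simp
      finally show "x \<cdot> \<nu>\<iota> (Suc n) k = y \<cdot> \<nu>\<iota> (Suc n) k"
        unfolding k by - (rule epi_cancel[OF epi[of a]], simp_all)
    qed (simp_all add: Hom_iff)
  qed simp
  then show thesis using that \<kappa> by blast
qed

abbreviation "mu n \<equiv> mult_pow C (alg_of A) n \<cdot> arr_pow C (\<nu> (Suc 0)) n"

text \<open>Iterates \<open>tail_mult_epi\<close>. \<open>P\<close> and \<open>Q\<close> are the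
  left-bracketed tensor powers of \<open>N (Suc 0)\<close> and \<open>gobj A\<close>, which have no
  name of their own; exponent 0 follows another convention and is left out.\<close>

lemma mu_factor:
  assumes epi: "\<And>a. is_epi C (mc a (Suc 0))"
  shows "\<exists>P Q e. arr_pow C (\<nu> (Suc 0)) (Suc n) \<in> Hom C P Q \<and> mult_pow C (alg_of A) (Suc n) \<in> Hom C Q (gobj A) \<and>
    e \<in> Hom C P (N (Suc n)) \<and> is_epi C e \<and> mu (Suc n) = \<nu> (Suc n) \<cdot> e"
proof (induction n)
  case 0
  show ?case
    by (rule exI[of _ "N (Suc 0)"], rule exI[of _ "gobj A"], rule exI[of _ "Ide C (N (Suc 0))"])
      (simp add: Hom_iff Ide_epi)
next
  case (Suc n)
  let ?a = "arr_pow C (\<nu> (Suc 0)) (Suc n)" and ?p = "mult_pow C (alg_of A) (Suc n)"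
  obtain P Q e where a: "?a \<in> Hom C P Q" and p: "?p \<in> Hom C Q (gobj A)" and e: "e \<in> Hom C P (N (Suc n))" "is_epi C e"
    and mu: "mu (Suc n) = \<nu> (Suc n) \<cdot> e" using Suc by blast
  obtain \<kappa> where \<kappa>: "\<kappa> \<in> Hom C (N (Suc n) \<odot> N (Suc 0)) (N (Suc (Suc n)))" "is_epi C \<kappa>"
    "m \<cdot> (\<nu> (Suc n) \<otimes> \<nu> (Suc 0)) = \<nu> (Suc (Suc n)) \<cdot> \<kappa>" by (rule tail_mult_epi[OF epi])
  note [simp] = HomD[OF a] HomD[OF p] HomD[OF e(1)] HomD[OF \<kappa>(1)]
  have "mu (Suc (Suc n)) = m \<cdot> (mu (Suc n) \<otimes> \<nu> (Suc 0))" by simp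
  also have "\<dots> = (m \<cdot> (\<nu> (Suc n) \<otimes> \<nu> (Suc 0))) \<cdot> (e \<otimes> Ide C (N (Suc 0)))" unfolding mu by simp
  also have "\<dots> = \<nu> (Suc (Suc n)) \<cdot> (\<kappa> \<cdot> (e \<otimes> Ide C (N (Suc 0))))" unfolding \<kappa>(3) by simp
  finally have "mu (Suc (Suc n)) = \<nu> (Suc (Suc n)) \<cdot> (\<kappa> \<cdot> (e \<otimes> Ide C (N (Suc 0))))" .
  moreover have "is_epi C (\<kappa> \<cdot> (e \<otimes> Ide C (N (Suc 0))))"
    by (intro epi_comp tensor_epi e \<kappa> Ide_epi) simp_all
  moreover have "arr_pow C (\<nu> (Suc 0)) (Suc (Suc n)) \<in> Hom C (P \<odot> N (Suc 0)) (Q \<odot> gobj A)"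
    "mult_pow C (alg_of A) (Suc (Suc n)) \<in> Hom C (Q \<odot> gobj A) (gobj A)"
    "\<kappa> \<cdot> (e \<otimes> Ide C (N (Suc 0))) \<in> Hom C (P \<odot> N (Suc 0)) (N (Suc (Suc n)))"
    by (simp_all add: Hom_iff)
  ultimately show ?case by blast
qed

lemma ideal_power_image:
  assumes "mu (Suc n) \<in> Arr C"
  shows "is_image C (mu (Suc n)) (ideal_power C (alg_of A) (\<nu> (Suc 0)) (Suc n))"
  using someI_ex[OF image_exists[OF assms]] by (simp add: ideal_power_def)

text \<open>For positive exponents \<open>mu_factor\<close> is an epi-mono factorisation with mono
  part \<open>\<nu> n\<close>, and such a factorisation computes the image.\<close>

lemma tail_eq_ideal_power:
  assumes epi: "\<And>a. is_epi C (mc a (Suc 0))"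
  shows "same_subobject C (\<nu> n) (ideal_power C (alg_of A) (\<nu> (Suc 0)) n)"
proof (cases n)
  case 0 then show ?thesis using tail_0 by (simp add: ideal_power_def)
next
  case (Suc k)
  obtain P e where e: "e \<in> Hom C P (N (Suc k))" "is_epi C e" and mu: "mu (Suc k) = \<nu> (Suc k) \<cdot> e"
    using mu_factor[OF epi, of k] by blast
  note [simp] = HomD[OF e(1)]
  have "mu (Suc k) \<in> Arr C" unfolding mu by simp
  from ideal_power_image[OF this] show ?thesis
    unfolding Suc mu by (intro image_of_epi_mono[OF tail_mono e(2)]) simp_all
qed

text \<open>If \<open>f\<close> kills the displayed composite, \<open>f \<cdot> \<pi> n\<close>
  kills the image of the product, hence \<open>\<nu> 2\<close>, which factors through it. On the
  summand \<open>n\<close> of A[2] this says that \<open>f\<close> is zero.\<close>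

lemma proj_mult_epi:
  assumes s: "same_subobject C (\<nu> 2) (ideal_power C (alg_of A) (\<nu> (Suc 0)) 2)" and n: "2 \<le> n"
  shows "is_epi C (\<pi> n \<cdot> m \<cdot> (\<nu> (Suc 0) \<otimes> \<nu> (Suc 0)))"
proof (rule epi_of_zero)
  let ?mu = "m \<cdot> (\<nu> (Suc 0) \<otimes> \<nu> (Suc 0))" and ?l = "ideal_power C (alg_of A) (\<nu> (Suc 0)) 2"
  have mu: "mu (Suc (Suc 0)) = ?mu" by simp
  then have l: "is_image C ?mu ?l" using ideal_power_image[of "Suc 0"] by (simp add: numeral_2_eq_2)
  show "\<pi> n \<cdot> ?mu \<in> Arr C" by simp
  fix f assume [simp]: "f \<in> Arr C" "Dom C f = Cod C (\<pi> n \<cdot> ?mu)"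
    and z: "f \<cdot> \<pi> n \<cdot> ?mu = Zer C (Dom C (\<pi> n \<cdot> ?mu)) (Cod C f)"
  have fl: "(f \<cdot> \<pi> n) \<cdot> ?l = Zer C (Dom C ?l) (Cod C (f \<cdot> \<pi> n))"
    by (rule zero_on_image[OF l]) (use z in simp_all)
  obtain h where h: "h \<in> Hom C (N 2) (Dom C ?l)" "?l \<cdot> h = \<nu> 2"
  proof -
    obtain h where "h \<in> Hom C (Dom C (\<nu> 2)) (Dom C ?l)" "?l \<cdot> h = \<nu> 2"
      using s unfolding same_subobject_def by blast
    then show thesis using that by simp
  qed
  have [simp]: "?l \<in> Arr C" "Cod C ?l = gobj A" using s by (simp_all add: same_subobject_def is_mono_def)
  note [simp] = HomD[OF h(1)]
  have "f = f \<cdot> \<pi> n \<cdot> \<nu> 2 \<cdot> \<nu>\<iota> 2 n" using n by simp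
  also have "\<dots> = ((f \<cdot> \<pi> n) \<cdot> ?l) \<cdot> h \<cdot> \<nu>\<iota> 2 n" unfolding h(2)[symmetric] using n by simp
  also have "\<dots> = Zer C (gcomp A n) (Cod C f)" unfolding fl using n by simp
  finally show "f = Zer C (Cod C (\<pi> n \<cdot> ?mu)) (Cod C f)" by simp
qed

text \<open>
  \<open>A\<^sub>n\<^sub>+\<^sub>1\<close> is the sum of the \<open>A\<^sub>i A\<^sub>j\<close> with \<open>i, j \<ge> 1\<close>, and inductively \<open>A\<^sub>i A\<^sub>j = A\<^sub>i A\<^sub>j\<^sub>-\<^sub>1 A\<^sub>1\<close> lies in \<open>A\<^sub>n A\<^sub>1\<close>.
\<close>

lemma mc_epi_of_square:
  assumes s: "same_subobject C (\<nu> 2) (ideal_power C (alg_of A) (\<nu> (Suc 0)) 2)"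
  shows "is_epi C (mc n (Suc 0))"
proof (induction n rule: less_induct)
  case (less n)
  show ?case
  proof (cases "n = 0")
    \<comment> \<open>\<open>mc 0 (Suc 0)\<close> is the left action of A_0 on A_1, epi by
      unitality.\<close>
    case True then show ?thesis using lact_epi[OF bimodule_deg_one] by simp
  next
    case False
    have mcC [simp]: "Cod C (mc k (Suc 0)) = gcomp A (Suc k)" for k using mc_simps(3)[of k "Suc 0"] by simp
    show ?thesis
    proof (rule epiI)
      fix f g assume [simp]: "f \<in> Arr C" "g \<in> Arr C" "Dom C f = Cod C (mc n (Suc 0))" "Dom C g = Cod C (mc n (Suc 0))" "Cod C f = Cod C g"
        and eq: "f \<cdot> mc n (Suc 0) = g \<cdot> mc n (Suc 0)"
      have step: "f \<cdot> mc i j = g \<cdot> mc i j" if ij: "i + j = Suc n" "1 \<le> i" "1 \<le> j" for i j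
      proof (cases "j = 1")
        case True then show ?thesis using ij eq by simp
      next
        case False
        \<comment> \<open>\<open>k < n\<close> because \<open>i\<close> is at least 1, so the
          induction hypothesis makes \<open>mc k (Suc 0)\<close> epi.\<close>
        then obtain k where j: "j = Suc k" and k: "k < n" and [simp]: "i + k = n" using ij by (cases j) auto
        let ?e = "(Ide C (gcomp A i) \<otimes> mc k (Suc 0)) \<cdot> Assoc C (gcomp A i) (gcomp A k) (gcomp A (Suc 0))"
        have e: "is_epi C ?e" by (intro epi_comp[OF iso_epi] tensor_epi Ide_epi less k) simp_all
        have [simp]: "Cod C (mc i (Suc k)) = gcomp A (Suc n)" "Cod C (mc i k) = gcomp A n"
          using mc_simps(3)[of i "Suc k"] mc_simps(3)[of i k] by simp_all
        have sq: "mc i (Suc k) \<cdot> ?e = mc n (Suc 0) \<cdot> (mc i k \<otimes> Ide C (gcomp A (Suc 0)))"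
          using assoc_square_eq[OF mc_assoc[of i k "Suc 0"]] by simp
        have "(f \<cdot> mc i (Suc k)) \<cdot> ?e = (f \<cdot> mc n (Suc 0)) \<cdot> (mc i k \<otimes> Ide C (gcomp A (Suc 0)))" using sq by simp
        also have "\<dots> = (g \<cdot> mc i (Suc k)) \<cdot> ?e" unfolding eq using sq by simp
        finally show ?thesis unfolding j by - (rule epi_cancel[OF e], simp_all)
      qed
      have "f \<cdot> \<pi> (Suc n) \<cdot> m \<cdot> (\<nu> (Suc 0) \<otimes> \<nu> (Suc 0)) = g \<cdot> \<pi> (Suc n) \<cdot> m \<cdot> (\<nu> (Suc 0) \<otimes> \<nu> (Suc 0))"
      proof (rule tensor_coproduct_eqI[OF tail_coproduct tail_coproduct])
        fix a b assume "a \<in> {Suc 0..}" "b \<in> {Suc 0..}"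
        then have [simp]: "Suc 0 \<le> a" "Suc 0 \<le> b" by auto
        have c: "(x \<cdot> \<pi> (Suc n) \<cdot> m \<cdot> (\<nu> (Suc 0) \<otimes> \<nu> (Suc 0))) \<cdot> (\<nu>\<iota> (Suc 0) a \<otimes> \<nu>\<iota> (Suc 0) b)
            = x \<cdot> (\<pi> (Suc n) \<cdot> \<iota> (a + b)) \<cdot> mc a b"
          if [simp]: "x \<in> Arr C" "Dom C x = gcomp A (Suc n)" for x
        proof -
          have "(x \<cdot> \<pi> (Suc n) \<cdot> m \<cdot> (\<nu> (Suc 0) \<otimes> \<nu> (Suc 0))) \<cdot> (\<nu>\<iota> (Suc 0) a \<otimes> \<nu>\<iota> (Suc 0) b)
              = x \<cdot> \<pi> (Suc n) \<cdot> (m \<cdot> (\<iota> a \<otimes> \<iota> b))" by simp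
          then show ?thesis unfolding mc(2) by simp
        qed
        show "(f \<cdot> \<pi> (Suc n) \<cdot> m \<cdot> (\<nu> (Suc 0) \<otimes> \<nu> (Suc 0))) \<cdot> (\<nu>\<iota> (Suc 0) a \<otimes> \<nu>\<iota> (Suc 0) b)
          = (g \<cdot> \<pi> (Suc n) \<cdot> m \<cdot> (\<nu> (Suc 0) \<otimes> \<nu> (Suc 0))) \<cdot> (\<nu>\<iota> (Suc 0) a \<otimes> \<nu>\<iota> (Suc 0) b)"
        \<comment> \<open>Products of any other total degree vanish under
          \<open>\<pi> (Suc n)\<close>.\<close>
        proof (cases "a + b = Suc n")
          case True
          have [simp]: "Cod C (mc a b) = gcomp A (Suc n)" using mc_simps(3)[of a b] True by simp
          show ?thesis using step[OF True] by (simp add: c True del: Comp_assoc')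
        next
          case False
          then show ?thesis by (simp add: c gproj(2)[OF graded_A] del: Comp_assoc')
        qed
      qed (simp_all add: Hom_iff)
      \<comment> \<open>As \<open>n\<close> is positive, \<open>Suc n\<close> is at least 2, the
        range of degrees covered by A[2].\<close>
      then show "f = g"
        using False by - (rule epi_cancel[OF proj_mult_epi[OF s, of "Suc n"]], simp_all)
    qed simp
  qed
qed

text \<open>The converse specialises to exponent 2, which closes the circle through (e) and
  (a').\<close>

lemma strongly_graded_iff_powers:
  "strongly_graded C A \<longleftrightarrow> (\<forall>n. same_subobject C (\<nu> n) (ideal_power C (alg_of A) (\<nu> (Suc 0)) n))"
  unfolding strongly_graded_iff_right using tail_eq_ideal_power mc_epi_of_square by blast

lemma strongly_graded_iff_square:
  "strongly_graded C A \<longleftrightarrow> same_subobject C (\<nu> 2) (ideal_power C (alg_of A) (\<nu> (Suc 0)) 2)"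
  unfolding strongly_graded_iff_right using tail_eq_ideal_power mc_epi_of_square by blast

end

text \<open>An infinite type contains a copy \<open>\<sigma>\<close> of the naturals, along which
  sums over sets of naturals become small.\<close>

lemma sequential_monoidal_categoryI:
  fixes C :: "('o, 'm, 'z) moncat_scheme" (structure)
  assumes inf: "infinite (UNIV :: 's set)"
    and C: "abelian_monoidal_category C"
    and cc: "cocomplete TYPE('s) C"
    and tc: "tensor_commutes_with_direct_sums TYPE('s) C"
  shows "sequential_monoidal_category C"
proof -
  interpret abelian_monoidal_category C by (rule C)
  obtain \<sigma> :: "nat \<Rightarrow> 's" where \<sigma>: "inj \<sigma>"
    using infinite_countable_subset[OF inf] by blast
  show ?thesis
  proof
    fix I :: "nat set" and F
    assume "\<And>k. k \<in> I \<Longrightarrow> F k \<in> Obj C"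
    then show "\<exists>P j. is_coproduct C I F P j"
      by (intro cocomplete_coproduct[OF cc, of \<sigma>]) (auto intro: inj_on_subset[OF \<sigma>])
  next
    fix I :: "nat set" and F P j X
    assume c: "is_coproduct C I F P j" and X: "X \<in> Obj C"
    let ?\<tau> = "inv_into I \<sigma>"
    have \<tau>: "bij_betw ?\<tau> (\<sigma> ` I) I" and b: "bij_betw \<sigma> I (\<sigma> ` I)"
      using inj_on_subset[OF \<sigma>, of I] by (auto intro: bij_betw_inv_into simp: bij_betw_def inj_on_inv_into)
    have [simp]: "?\<tau> (\<sigma> k) = k" if "k \<in> I" for k using that inj_on_subset[OF \<sigma>, of I] by simp
    note t = tc[unfolded tensor_commutes_with_direct_sums_def, rule_format, OF X coproduct_reindex[OF c \<tau>]]
    show "is_coproduct C I (\<lambda>k. X \<odot> F k) (X \<odot> P) (\<lambda>k. Ide C X \<otimes> j k) \<and>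
      is_coproduct C I (\<lambda>k. F k \<odot> X) (P \<odot> X) (\<lambda>k. j k \<otimes> Ide C X)"
      by (intro conjI coproduct_cong[OF coproduct_reindex[OF t[THEN conjunct1] b]]
          coproduct_cong[OF coproduct_reindex[OF t[THEN conjunct2] b]]) simp_all
  qed
qed

theorem theorem3p11:
  fixes C :: "('o, 'm) moncat" (structure)
    and A T :: "('o, 'm) galg"
  assumes "infinite (UNIV :: 's set)"
    and "abelian_monoidal_category C"
    and "cocomplete TYPE('s) C"
    and "tensor_commutes_with_direct_sums TYPE('s) C"
    and "graded_algebra C A"
    and T: "T = tensor_algebra C (deg_zero_alg C A) (deg_one_bimod C A)"
  shows "(\<exists>!\<phi>. alg_hom C (alg_of T) (alg_of A) \<phi> \<and>
              \<phi> \<cdot> ginj T 0 = ginj A 0 \<and> \<phi> \<cdot> ginj T 1 = ginj A 1) \<and>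
    (\<forall>\<phi>. alg_hom C (alg_of T) (alg_of A) \<phi> \<and>
          \<phi> \<cdot> ginj T 0 = ginj A 0 \<and> \<phi> \<cdot> ginj T 1 = ginj A 1 \<longrightarrow>
      graded_alg_hom C T A \<phi> \<and>
      (\<forall>t. gmor_comp C T A \<phi> t =
        gproj C A t \<cdot> bal_mult_pow C A t \<cdot>
          bal_arr_pow C (deg_zero_alg C A) (deg_one_bimod C A) (bimod_via_deg_zero C A)
            (ginj A 1) t) \<and>
      (strongly_graded C A \<longleftrightarrow> (\<forall>a. is_epi C (mult_comp C A a 1))) \<and>
      (strongly_graded C A \<longleftrightarrow> (\<forall>n. is_epi C (gmor_comp C T A \<phi> n))) \<and>
      (strongly_graded C A \<longleftrightarrow> is_epi C \<phi>) \<and>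
      (strongly_graded C A \<longleftrightarrow>
        (\<forall>n. same_subobject C (tail_inj C A n) (ideal_power C (alg_of A) (tail_inj C A 1) n))) \<and>
      (strongly_graded C A \<longleftrightarrow>
        same_subobject C (tail_inj C A 2) (ideal_power C (alg_of A) (tail_inj C A 1) 2)))"
proof -
  interpret G: graded_algebra_in_category C A
    using sequential_monoidal_categoryI[OF assms(1-4)] assms(5)
    by (simp add: graded_algebra_in_category_def graded_algebra_in_category_axioms_def)
  show ?thesis
    unfolding T G.is_canonical_def[symmetric]
  proof (intro conjI allI impI)
    show "\<exists>!f. G.is_canonical f" by (rule G.canonical_ex1)
  next
    fix f assume f: "G.is_canonical f"
    show "strongly_graded C A = is_epi C f"
      using G.strongly_graded_iff_phi G.canonical_epi_iff[OF f] by simp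
  qed (auto simp: G.canonical_graded G.strongly_graded_iff_phi G.strongly_graded_iff_right[symmetric] G.\<phi>_def G.\<psi>_def
      G.strongly_graded_iff_powers[symmetric] G.strongly_graded_iff_square[symmetric])
qed

end
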